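(* Let $q=3^{2e+1}\ge3$, let $V$ and $\mathrm R(q)\le\mathrm{Sym}(V)$ be as in the context, and let $G=\langle\mathrm R(q),\zeta\rangle$ be a subgroup of $\mathrm{Sym}(V)$ containing $\mathrm R(q)$ as a normal subgroup, where $\zeta$ is an automorphism of $\mathbb F_q$ inducing a permutation of $V$ that fixes $\infty$ and acts componentwise on the elements of $V\setminus\{\infty\}$. Suppose that $P$ is an imprimitive block of $G_\infty$ on $V\setminus\{\infty\}$ containing $\mathbf 0$ such that $P\setminus\{\mathbf 0\}$ is an $\mathrm R(q)_{\infty,\mathbf 0}$-orbit on $V\setminus\{\infty,\mathbf 0\}$ of length $q-1$. Then: (a) $P=\{(0,0,\eta,\ldots)\in V:\eta\in\mathbb F_q\}$ and $G_{\infty,P}=\langle n_\kappa,t_{0,0,\xi},\zeta:\xi\in\mathbb F_q,\kappa\in\mathbb F_q^\times\rangle$; (b) setting $L:=P\cup\{\infty\}$, $\mathcal D:=(V,L^{\mathrm R(q)})=(V,L^G)$ is a $2$-$(q^3+1,q+1,q+1)$ design admitting $G$ as a $2$-point-transitive and block-transitive group of automorphisms, and $\Omega:=(\infty,L)^{\mathrm R(q)}=(\infty,L)^G$ is a 1-feasible $G$-orbit on the flag set of $\mathcal D$; moreover, the $G$-flag graph of $\mathcal D$ with respect to $(\Omega,\Xi)$ is the same as the $\mathrm R(q)$-flag graph $\Gamma(\mathcal D,\Omega,\Xi)$ with respect to $(\Omega,\Xi)$; (c) $\Gamma(\mathcal D,\Omega,\Xi)$ is connected with order $|\Omega|=q^2(q^3+1)$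 and valency $q$ when $q>3$, and has three connected components when $q=3$.
   Context: Groups act on the right. $G_x$ is a point stabilizer, $G_{x,P}$ the setwise stabilizer of $P$ in $G_x$. For a transitive group $X$ on $\Delta$, an imprimitive block is a nonempty $P\subseteq\Delta$ with $P^g=P$ or $P^g\cap P=\emptyset$ for all $g\in X$. Ree group: $\sigma:\xi\mapsto\xi^{3^{e+1}}$ is an automorphism of $\mathbb F_q$. $V$ consists of $\infty$ and all $(\eta_1,\eta_2,\eta_3,\lambda_1,\lambda_2,\lambda_3)$ with $\eta_i\in\mathbb F_q$ and $\lambda_1=\eta_1^2\eta_2-\eta_1\eta_3+\eta_2^\sigma-\eta_1^{\sigma+3}$, $\lambda_2=\eta_1^\sigma\eta_2^\sigma-\eta_3^\sigma+\eta_1\eta_2^2+\eta_2\eta_3-\eta_1^{2\sigma+3}$, $\lambda_3=\eta_1\eta_3^\sigma-\eta_1^{\sigma+1}\eta_2^\sigma+\eta_1^{\sigma+3}\eta_2+\eta_1^2\eta_2^2-\eta_2^{\sigma+1}-\eta_3^2+\eta_1^{2\sigma+4}$; such a point is written $(\eta_1,\eta_2,\eta_3,\ldots)$, and $\mathbf 0=(0,0,0,0,0,0)$. For $\alpha,\beta,\gamma,\kappa\in\mathbb F_q$, $\kappa\ne0$, the permutations $t_{\alpha,\beta,\gamma}$ and $n_\kappa$ fix $\infty$ and satisfy $t_{\alpha,\beta,\gamma}:(\eta_1,\eta_2,\eta_3,\ldots)\mapsto(\eta_1+\alpha,\eta_2+\beta+\alpha^\sigma\eta_1,\eta_3+\gamma-\alpha\eta_2+\beta\eta_1-\alpha^{\sigma+1}\eta_1,\ldots)$,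 $n_\kappa:(\eta_1,\eta_2,\eta_3,\ldots)\mapsto(\kappa\eta_1,\kappa^{\sigma+1}\eta_2,\kappa^{\sigma+2}\eta_3,\ldots)$. The involution $w$ is $(\eta_1,\eta_2,\eta_3,\lambda_1,\lambda_2,\lambda_3)\leftrightarrow(\lambda_2/\lambda_3,\lambda_1/\lambda_3,\eta_3/\lambda_3,\eta_2/\lambda_3,\eta_1/\lambda_3,1/\lambda_3)$ for $\lambda_3\neq0$, $\infty\leftrightarrow\mathbf 0$. $\mathrm R(q)$ is generated by $w$ and all $t_{\alpha,\beta,\gamma}$, $n_\kappa$; $\mathrm R(q)_{\infty,\mathbf 0}=\{n_\kappa:\kappa\in\mathbb F_q^\times\}$. Designs and flag graphs: $(V,L^G)$ is the incidence structure with point set $V$, block set $\{L^g:g\in G\}$ and incidence given by inclusion. A flag is a pair $(x,L)$ with $L$ a block, $x\in L$. For a $G$-orbit $\Omega$ on flags, $\Omega(x)$ is the set of flags in $\Omega$ with point entry $x$; $\Omega$ is 1-feasible if (i) $|\Omega(x)|\ge2$; (ii) for some (hence all) $(x,L)\in\Omega$, $G_{x,L}$ is transitive on $L\setminus\{x\}$; (iii) $L\cap N=\{x\}$ for distinct $(x,L),(x,N)\in\Omega(x)$. $\Xi=\Xi(\mathcal D,\Omega)$ is the set of $((x,L),(y,N))\in\Omega\times\Omega$ with $x\ne y$ and $x,y\in L\cap N$ (a self-paired $G$-orbit when $\Omega$ is 1-feasible and $G$ is 2-transitive on points). The $G$-flag graph $\Gamma(\mathcal D,\Omega,\Xi)$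 has vertex set $\Omega$ and arc set $\Xi$. *)

theory Defs
  imports
    "HOL-Algebra.Group_Action"
    "HOL-Algebra.Generated_Groups"
    "Graph_Theory.Graph_Theory"
begin

section \<open>Permutation groups\<close>

text \<open>
  A permutation group on \<open>V\<close> is a subgroup of the library's \<open>BijGroup V\<close>, presented as
  \<open>(BijGroup V)\<lparr>carrier := H\<rparr>\<close>. The library composes permutations from right to left, whereas the
  source lets groups act on the right. All notions below (generated subgroups, normality, orbits,
  stabilisers) depend only on sets of permutations closed under composition and inversion, so the
  two conventions give the same objects: \<open>x\<^sup>g\<close> is \<open>g x\<close>, and \<open>P\<^sup>g\<close> is \<open>g ` P\<close>.
\<close>

definition perm_group_generated :: "'p set \<Rightarrow> ('p \<Rightarrow> 'p) set \<Rightarrow> ('p \<Rightarrow> 'p) monoid" where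
  "perm_group_generated V S = (BijGroup V)\<lparr>carrier := generate (BijGroup V) S\<rparr>"

definition point_stab :: "('p \<Rightarrow> 'p) monoid \<Rightarrow> 'p \<Rightarrow> ('p \<Rightarrow> 'p) monoid" where
  "point_stab G x = G\<lparr>carrier := stabilizer G (\<lambda>g. g) x\<rparr>"

definition set_stab :: "('p \<Rightarrow> 'p) monoid \<Rightarrow> 'p set \<Rightarrow> ('p \<Rightarrow> 'p) monoid" where
  "set_stab G P = G\<lparr>carrier := stabilizer G (`) P\<rparr>"

definition transitive_on :: "('g, 'm) monoid_scheme \<Rightarrow> ('g \<Rightarrow> 'x \<Rightarrow> 'x) \<Rightarrow> 'x set \<Rightarrow> bool" where
  "transitive_on G \<phi> A \<longleftrightarrow> (\<forall>a\<in>A. Group_Action.orbit G \<phi> a = A)"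

definition two_transitive_on :: "('p \<Rightarrow> 'p) monoid \<Rightarrow> 'p set \<Rightarrow> bool" where
  "two_transitive_on G V \<longleftrightarrow>
     transitive_on G (\<lambda>g. map_prod g g) {(x, y). x \<in> V \<and> y \<in> V \<and> x \<noteq> y}"

definition imprimitive_block :: "('p \<Rightarrow> 'p) monoid \<Rightarrow> 'p set \<Rightarrow> 'p set \<Rightarrow> bool" where
  "imprimitive_block G \<Delta> P \<longleftrightarrow>
     P \<noteq> {} \<and> P \<subseteq> \<Delta> \<and> (\<forall>g\<in>carrier G. g ` P = P \<or> g ` P \<inter> P = {})"


section \<open>The point set and the Ree group\<close>

datatype 'a ree_point = Infinity | Pt 'a 'a 'a 'a 'a 'a

definition ree_sigma :: "nat \<Rightarrow> 'a::field \<Rightarrow> 'a" where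
  "ree_sigma e \<xi> = \<xi> ^ (3 ^ (e + 1))"

text \<open>A power such as \<open>\<eta>\<^sup>2\<^sup>\<sigma>\<^sup>+\<^sup>3\<close> stands for \<open>(\<eta>\<^sup>\<sigma>)\<^sup>2 \<eta>\<^sup>3\<close>.\<close>

definition ree_lambda1 :: "nat \<Rightarrow> 'a::field \<Rightarrow> 'a \<Rightarrow> 'a \<Rightarrow> 'a" where
  "ree_lambda1 e \<eta>1 \<eta>2 \<eta>3 = (let s = ree_sigma e in
     \<eta>1^2 * \<eta>2 - \<eta>1 * \<eta>3 + s \<eta>2 - s \<eta>1 * \<eta>1^3)"

definition ree_lambda2 :: "nat \<Rightarrow> 'a::field \<Rightarrow> 'a \<Rightarrow> 'a \<Rightarrow> 'a" where
  "ree_lambda2 e \<eta>1 \<eta>2 \<eta>3 = (let s = ree_sigma e in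
     s \<eta>1 * s \<eta>2 - s \<eta>3 + \<eta>1 * \<eta>2^2 + \<eta>2 * \<eta>3 - (s \<eta>1)^2 * \<eta>1^3)"

definition ree_lambda3 :: "nat \<Rightarrow> 'a::field \<Rightarrow> 'a \<Rightarrow> 'a \<Rightarrow> 'a" where
  "ree_lambda3 e \<eta>1 \<eta>2 \<eta>3 = (let s = ree_sigma e in
     \<eta>1 * s \<eta>3 - s \<eta>1 * \<eta>1 * s \<eta>2 + s \<eta>1 * \<eta>1^3 * \<eta>2 + \<eta>1^2 * \<eta>2^2
       - s \<eta>2 * \<eta>2 - \<eta>3^2 + (s \<eta>1)^2 * \<eta>1^4)"

text \<open>\<open>ree_pt e \<eta>1 \<eta>2 \<eta>3\<close> is the point written \<open>(\<eta>1, \<eta>2, \<eta>3, \<dots>)\<close>.\<close>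

definition ree_pt :: "nat \<Rightarrow> 'a::field \<Rightarrow> 'a \<Rightarrow> 'a \<Rightarrow> 'a ree_point" where
  "ree_pt e \<eta>1 \<eta>2 \<eta>3 =
     Pt \<eta>1 \<eta>2 \<eta>3 (ree_lambda1 e \<eta>1 \<eta>2 \<eta>3) (ree_lambda2 e \<eta>1 \<eta>2 \<eta>3) (ree_lambda3 e \<eta>1 \<eta>2 \<eta>3)"

definition ree_zero :: "'a::field ree_point" where
  "ree_zero = Pt 0 0 0 0 0 0"

definition ree_points :: "nat \<Rightarrow> 'a::field ree_point set" where
  "ree_points e = insert Infinity {ree_pt e \<eta>1 \<eta>2 \<eta>3 | \<eta>1 \<eta>2 \<eta>3. True}"

definition ree_t :: "nat \<Rightarrow> 'a::field \<Rightarrow> 'a \<Rightarrow> 'a \<Rightarrow> 'a ree_point \<Rightarrow> 'a ree_point" where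
  "ree_t e \<alpha> \<beta> \<gamma> = (\<lambda>p\<in>ree_points e. case p of
       Infinity \<Rightarrow> Infinity
     | Pt \<eta>1 \<eta>2 \<eta>3 _ _ _ \<Rightarrow>
         ree_pt e (\<eta>1 + \<alpha>) (\<eta>2 + \<beta> + ree_sigma e \<alpha> * \<eta>1)
           (\<eta>3 + \<gamma> - \<alpha> * \<eta>2 + \<beta> * \<eta>1 - ree_sigma e \<alpha> * \<alpha> * \<eta>1))"

definition ree_n :: "nat \<Rightarrow> 'a::field \<Rightarrow> 'a ree_point \<Rightarrow> 'a ree_point" where
  "ree_n e \<kappa> = (\<lambda>p\<in>ree_points e. case p of
       Infinity \<Rightarrow> Infinity
     | Pt \<eta>1 \<eta>2 \<eta>3 _ _ _ \<Rightarrow>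
         ree_pt e (\<kappa> * \<eta>1) (ree_sigma e \<kappa> * \<kappa> * \<eta>2) (ree_sigma e \<kappa> * \<kappa>^2 * \<eta>3))"

text \<open>On \<open>ree_points e\<close> the last coordinate vanishes only at \<open>ree_zero\<close>.\<close>

definition ree_w :: "nat \<Rightarrow> 'a::field ree_point \<Rightarrow> 'a ree_point" where
  "ree_w e = (\<lambda>p\<in>ree_points e. case p of
       Infinity \<Rightarrow> ree_zero
     | Pt \<eta>1 \<eta>2 \<eta>3 l1 l2 l3 \<Rightarrow>
         if p = ree_zero then Infinity
         else Pt (l2 / l3) (l1 / l3) (\<eta>3 / l3) (\<eta>2 / l3) (\<eta>1 / l3) (1 / l3))"

definition ree_group :: "nat \<Rightarrow> ('a::field ree_point \<Rightarrow> 'a ree_point) monoid" where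
  "ree_group e = perm_group_generated (ree_points e)
     ({ree_w e} \<union> {ree_t e \<alpha> \<beta> \<gamma> | \<alpha> \<beta> \<gamma>. True} \<union> {ree_n e \<kappa> | \<kappa>. \<kappa> \<noteq> 0})"

definition field_automorphism :: "('a::field \<Rightarrow> 'a) \<Rightarrow> bool" where
  "field_automorphism \<tau> \<longleftrightarrow>
     bij \<tau> \<and> (\<forall>x y. \<tau> (x + y) = \<tau> x + \<tau> y) \<and> (\<forall>x y. \<tau> (x * y) = \<tau> x * \<tau> y)"

text \<open>The map on points that fixes \<open>Infinity\<close> and applies \<open>\<tau>\<close> to each of the six coordinates.\<close>

definition ree_componentwise :: "nat \<Rightarrow> ('a::field \<Rightarrow> 'a) \<Rightarrow> 'a ree_point \<Rightarrow> 'a ree_point" where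
  "ree_componentwise e \<tau> = (\<lambda>p\<in>ree_points e. map_ree_point \<tau> p)"

definition ree_group_extension ::
    "nat \<Rightarrow> ('a::field \<Rightarrow> 'a) \<Rightarrow> ('a ree_point \<Rightarrow> 'a ree_point) monoid" where
  "ree_group_extension e \<tau> = perm_group_generated (ree_points e)
     (carrier (ree_group e) \<union> {ree_componentwise e \<tau>})"


section \<open>Designs\<close>

text \<open>
  All incidence structures here have sets of points as blocks and membership as incidence, so they
  are pairs consisting of a point set and a block set.
\<close>

type_synonym 'p incidence = "'p set \<times> 'p set set"
type_synonym 'p flag = "'p \<times> 'p set"

definition block_orbit_structure :: "'p set \<Rightarrow> ('p \<Rightarrow> 'p) monoid \<Rightarrow> 'p set \<Rightarrow> 'p incidence" where
  "block_orbit_structure V G L = (V, Group_Action.orbit G (`) L)"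

definition t_design :: "nat \<Rightarrow> nat \<Rightarrow> nat \<Rightarrow> nat \<Rightarrow> 'p incidence \<Rightarrow> bool" where
  "t_design t v k l D \<longleftrightarrow>
     finite (fst D) \<and> card (fst D) = v \<and>
     (\<forall>B\<in>snd D. B \<subseteq> fst D \<and> card B = k) \<and>
     (\<forall>S. S \<subseteq> fst D \<and> card S = t \<longrightarrow> card {B \<in> snd D. S \<subseteq> B} = l)"

definition automorphism_group :: "'p incidence \<Rightarrow> ('p \<Rightarrow> 'p) monoid" where
  "automorphism_group D =
     (BijGroup (fst D))\<lparr>carrier := {g \<in> Bij (fst D). (`) g ` snd D = snd D}\<rparr>"


section \<open>Flag graphs\<close>

definition flags :: "'p incidence \<Rightarrow> 'p flag set" where
  "flags D = {(x, L). x \<in> fst D \<and> L \<in> snd D \<and> x \<in> L}"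

definition flag_act :: "('p \<Rightarrow> 'p) \<Rightarrow> 'p flag \<Rightarrow> 'p flag" where
  "flag_act g = map_prod g ((`) g)"

definition flags_at :: "'p flag set \<Rightarrow> 'p \<Rightarrow> 'p flag set" where
  "flags_at \<Omega> x = {F \<in> \<Omega>. fst F = x}"

definition one_feasible :: "('p \<Rightarrow> 'p) monoid \<Rightarrow> 'p incidence \<Rightarrow> 'p flag set \<Rightarrow> bool" where
  "one_feasible G D \<Omega> \<longleftrightarrow>
     \<Omega> \<in> orbits G (flags D) flag_act \<and>
     (\<forall>x\<in>fst D. card (flags_at \<Omega> x) \<ge> 2) \<and>
     (\<exists>(x, L)\<in>\<Omega>. transitive_on (set_stab (point_stab G x) L) (\<lambda>g. g) (L - {x})) \<and>
     (\<forall>x L N. (x, L) \<in> flags_at \<Omega> x \<and> (x, N) \<in> flags_at \<Omega> x \<and> (x, L) \<noteq> (x, N)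
        \<longrightarrow> L \<inter> N = {x})"

text \<open>
  \<open>\<Xi>(\<D>, \<Omega>)\<close>; the incidence structure enters only through \<open>\<Omega>\<close>, which is a set of flags of it.
\<close>

definition flag_arcs :: "'p flag set \<Rightarrow> ('p flag \<times> 'p flag) set" where
  "flag_arcs \<Omega> = {((x, L), (y, N)). (x, L) \<in> \<Omega> \<and> (y, N) \<in> \<Omega> \<and>
     x \<noteq> y \<and> x \<in> L \<inter> N \<and> y \<in> L \<inter> N}"

definition flag_graph ::
    "'p flag set \<Rightarrow> ('p flag \<times> 'p flag) set \<Rightarrow> 'p flag pair_pre_digraph" where
  "flag_graph \<Omega> \<Xi> = \<lparr>pverts = \<Omega>, parcs = \<Xi>\<rparr>"

text \<open>
  \<open>flag_graph\<close> does not mention the group. That \<open>\<Gamma>\<close> is the flag graph \<^emph>\<open>of the group\<close> \<open>G\<close>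
  means moreover that \<open>\<Omega>\<close> is a 1-feasible \<open>G\<close>-orbit on flags and that \<open>\<Xi>\<close> is a self-paired
  \<open>G\<close>-orbit on pairs of flags.
\<close>

definition is_flag_graph_of :: "('p \<Rightarrow> 'p) monoid \<Rightarrow> 'p incidence \<Rightarrow> 'p flag set \<Rightarrow>
    ('p flag \<times> 'p flag) set \<Rightarrow> 'p flag pair_pre_digraph \<Rightarrow> bool" where
  "is_flag_graph_of G D \<Omega> \<Xi> \<Gamma> \<longleftrightarrow>
     one_feasible G D \<Omega> \<and>
     \<Xi> = flag_arcs \<Omega> \<and>
     \<Xi> \<in> orbits G (\<Omega> \<times> \<Omega>) (\<lambda>g. map_prod (flag_act g) (flag_act g)) \<and>
     \<Xi>\<inverse> = \<Xi> \<and>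
     \<Gamma> = flag_graph \<Omega> \<Xi>"

text \<open>
  The arc set of a flag graph is symmetric, so its connected components as an undirected graph are
  the strongly connected components of the digraph, and its valency at a vertex is the out-degree.
\<close>

definition num_components :: "'v pair_pre_digraph \<Rightarrow> nat" where
  "num_components \<Gamma> = card (pre_digraph.sccs (with_proj \<Gamma>))"

definition has_valency :: "'v pair_pre_digraph \<Rightarrow> nat \<Rightarrow> bool" where
  "has_valency \<Gamma> k \<longleftrightarrow> (\<forall>v\<in>pverts \<Gamma>. out_degree (with_proj \<Gamma>) v = k)"

end

theory Submission
  imports Defs "HOL-Number_Theory.Residues" "HOL-Algebra.Zassenhaus"
begin

text \<open>
  Two facts about the Ree group carry the proof: \<open>w\<close> permutes the points (\<open>w_pt\<close>), and the stabilizer of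
  infinity and the origin consists of the \<open>n\<close> only (\<open>R_fixing_Infinity_zero\<close>). Neither is visible from the
  generators, and expanding the formulas for \<open>w\<close> leads to polynomials of very high degree. Instead,
  points are read as vectors of length 7. They are the absolute points of a polarity of the split
  Cayley hexagon, and the line that belongs to a point by the polarity satisfies equations of low degree
  on which \<open>w\<close> acts by reversal; this gives the first fact. For the second, the generators preserve, up to
  scalars, a symmetric bilinear form and Dickson's trilinear form (\<open>R_similitude\<close>), and a permutation of
  the points that does so and fixes infinity and the origin is an \<open>n\<close>
  (\<open>similitude_fixing_Infinity_zero\<close>). So the stabilizer of infinity is the product of the
  group of all \<open>t\<close>, which is regular on the remaining points, and the group of all \<open>n\<close>.

  Let \<open>P\<close> be as in the theorem. Applying to a point \<open>p\<close> of \<open>P\<close> the map \<open>t\<close> that takes the origin to \<open>p\<close>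
  yields a point of \<open>P\<close> again; since \<open>-1\<close> is not a square, this forces the first two coordinates of \<open>p\<close> to vanish
  (\<open>block_eq_centre_orbit\<close>). The blocks in flags at infinity are then the orbits of the centre of the group
  of all \<open>t\<close>, each together with infinity. They partition the remaining points, whence the flag with given
  point \<open>x\<close> whose block contains a given \<open>y \<noteq> x\<close> is unique (\<open>\<Omega>_unique\<close>). Because \<open>w\<close> moves \<open>L0\<close>, a block
  is the block of only one flag (\<open>centre_unique\<close>), and the parameters of the design follow by counting
  centres. All transitivity statements are consequences of 2-transitivity on points. The extended group
  permutes the same flags because \<open>R\<close> is normal in it and \<open>\<zeta>\<close> fixes the base flag
  (\<open>flag_preserving_G\<close>).

  For connectedness, consider the group of those elements that preserve the component of the base flag. It
  contains \<open>w\<close>, all \<open>n\<close> and the centre of the group of all \<open>t\<close>. An explicit word in these, evaluated over the prime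
  field, gives a \<open>t\<close> with nonzero first parameter in the group (\<open>reached_1\<close>). If \<open>q > 3\<close>, products of
  its conjugates under the \<open>n\<close> yield all \<open>t\<close> (\<open>reached_UNIV\<close>), and the graph is connected. If \<open>q = 3\<close>, one obtains
  only a subgroup of index 3, the kernel of a homomorphism \<open>\<phi>\<close>; at most three components remain, and a
  colouring of the flags built from \<open>\<phi>\<close> is constant along arcs and takes three values
  (\<open>arc_same_colour\<close>).
\<close>

section \<open>Subgroups of the group of all permutations of a set\<close>

text \<open>
  Invariants of permutations are checked on points, so closure under inverses is put in terms of
  the values of the inverse and not in terms of \<open>inv_into\<close>.
\<close>

lemma subgroup_BijGroupI:
  assumes "X \<subseteq> Bij S" "(\<lambda>x\<in>S. x) \<in> X"
    and "\<And>g h. g \<in> X \<Longrightarrow> h \<in> X \<Longrightarrow> compose S g h \<in> X"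
    and "\<And>g h. g \<in> X \<Longrightarrow> h \<in> Bij S \<Longrightarrow> (\<And>x. x \<in> S \<Longrightarrow> h (g x) = x) \<Longrightarrow> (\<And>x. x \<in> S \<Longrightarrow> g (h x) = x)
          \<Longrightarrow> h \<in> X"
  shows "subgroup X (BijGroup S)"
proof
  show "X \<subseteq> carrier (BijGroup S)" using assms(1) by (simp add: BijGroup_def)
  show "\<one>\<^bsub>BijGroup S\<^esub> \<in> X" using assms(2) by (simp add: BijGroup_def)
  fix g assume g: "g \<in> X"
  then have gB: "g \<in> Bij S" using assms(1) by auto
  then have bij: "bij_betw g S S" by (simp add: Bij_def)
  show "inv\<^bsub>BijGroup S\<^esub> g \<in> X"
    unfolding inv_BijGroup[OF gB]
  proof (rule assms(4)[OF g restrict_inv_into_Bij[OF gB]])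
    fix x assume x: "x \<in> S"
    show "restrict (inv_into S g) S (g x) = x"
      using bij x by (simp add: bij_betw_apply bij_betw_inv_into_left)
    show "g (restrict (inv_into S g) S x) = x"
      using bij x by (simp add: bij_betw_inv_into_right)
  qed
  fix h assume "h \<in> X"
  with g assms(1,3) show "g \<otimes>\<^bsub>BijGroup S\<^esub> h \<in> X"
    by (simp add: BijGroup_def subset_iff)
qed

lemma subgroup_BijGroup_compose:
  assumes "subgroup X (BijGroup S)" "g \<in> X" "h \<in> X"
  shows "compose S g h \<in> X"
proof -
  have "g \<in> Bij S" "h \<in> Bij S"
    using subgroup.subset[OF assms(1)] assms(2,3) by (auto simp: BijGroup_def)
  then show ?thesis
    using subgroup.m_closed[OF assms] by (simp add: BijGroup_def)
qed

lemma subgroup_BijGroup_Bij: "subgroup X (BijGroup S) \<Longrightarrow> g \<in> X \<Longrightarrow> g \<in> Bij S"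
  by (drule subgroup.subset) (auto simp: BijGroup_def)

lemma subgroup_BijGroup_in: "subgroup X (BijGroup S) \<Longrightarrow> g \<in> X \<Longrightarrow> x \<in> S \<Longrightarrow> g x \<in> S"
  by (rule funcset_mem[OF Bij_imp_funcset[OF subgroup_BijGroup_Bij]])

lemma subgroup_BijGroup_image_subset:
  "subgroup X (BijGroup S) \<Longrightarrow> g \<in> X \<Longrightarrow> A \<subseteq> S \<Longrightarrow> g ` A \<subseteq> S"
  by (auto intro: subgroup_BijGroup_in)

lemma subgroup_BijGroup_id:
  "subgroup X (BijGroup S) \<Longrightarrow> (\<lambda>x\<in>S. x) \<in> X"
  by (drule subgroup.one_closed) (simp add: BijGroup_def)

lemma subgroup_BijGroup_inverse:
  assumes "subgroup X (BijGroup S)" "g \<in> X"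
  obtains h where "h \<in> X" "\<And>x. x \<in> S \<Longrightarrow> h (g x) = x" "\<And>x. x \<in> S \<Longrightarrow> g (h x) = x"
proof
  have gB: "g \<in> Bij S" by (rule subgroup_BijGroup_Bij[OF assms])
  then have bij: "bij_betw g S S" by (simp add: Bij_def)
  show "inv\<^bsub>BijGroup S\<^esub> g \<in> X" using subgroup.m_inv_closed[OF assms] .
  fix x assume x: "x \<in> S"
  show "(inv\<^bsub>BijGroup S\<^esub> g) (g x) = x"
    unfolding inv_BijGroup[OF gB] using bij x by (simp add: bij_betw_apply bij_betw_inv_into_left)
  show "g ((inv\<^bsub>BijGroup S\<^esub> g) x) = x"
    unfolding inv_BijGroup[OF gB] using bij x by (simp add: bij_betw_inv_into_right)
qed

lemma subgroup_generate_BijGroup: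
  "A \<subseteq> Bij S \<Longrightarrow> subgroup (generate (BijGroup S) A) (BijGroup S)"
  by (rule group.generate_is_subgroup[OF group_BijGroup]) (simp add: BijGroup_def)

lemma generate_BijGroup_subset:
  "subgroup X (BijGroup S) \<Longrightarrow> A \<subseteq> X \<Longrightarrow> generate (BijGroup S) A \<subseteq> X"
  by (rule group.generate_subgroup_incl[OF group_BijGroup])

lemma Bij_eqI: "g \<in> Bij S \<Longrightarrow> h \<in> Bij S \<Longrightarrow> (\<And>x. x \<in> S \<Longrightarrow> g x = h x) \<Longrightarrow> g = h"
  by (rule extensionalityI[OF Bij_imp_extensional Bij_imp_extensional])

section \<open>The field and its automorphism \<open>\<sigma>\<close>\<close>

text \<open>
  The parameter \<open>field_type\<close> serves only to make the type of the field a parameter.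
\<close>

locale ree_field =
  fixes e :: nat and q :: nat and field_type :: "'a::{field,finite} itself"
  assumes q_def: "q = 3 ^ (2 * e + 1)"
    and card_field: "card (UNIV :: 'a set) = q"
begin

abbreviation \<sigma> :: "'a \<Rightarrow> 'a" where "\<sigma> \<equiv> ree_sigma e"

lemma CHAR_3: "CHAR('a) = 3"
proof -
  have "CHAR('a) dvd 3 ^ (2 * e + 1)"
    using CHAR_dvd_CARD[where 'a='a] card_field q_def by simp
  moreover have "prime CHAR('a)"
    by (rule prime_CHAR_semidom) (simp add: finite_imp_CHAR_pos)
  ultimately have "CHAR('a) dvd 3"
    using prime_dvd_power by blast
  then show ?thesis
    using primes_dvd_imp_eq[OF \<open>prime CHAR('a)\<close>, of 3] by simp
qed

lemma three: "(3::'a) = 0"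
  using of_nat_CHAR[where 'a='a] by (simp add: CHAR_3)

text \<open>
  The polynomial identities of this development hold only modulo 3. Each is reduced to an identity
  over the integers by giving the polynomial \<open>Q\<close> for which the two sides differ by \<open>3 Q\<close>.
\<close>

lemma eq_mod_3: "l = r + 3 * Q \<Longrightarrow> l = (r::'a)"
  by (simp add: three)

lemma two: "(2::'a) = -1"
  using three by (simp add: eq_neg_iff_add_eq_0)

lemma one_neq_minus_one: "(1::'a) \<noteq> -1"
  using two by (metis add_cancel_left_right one_add_one zero_neq_one add.right_inverse neg_equal_0_iff_equal)

lemma power_q: "(x::'a) ^ q = x"
proof (cases "x = 0")
  case True
  then show ?thesis by (simp add: q_def)
next
  case False
  let ?S = "UNIV - {0::'a}"
  have "x ^ card ?S * \<Prod>?S = (\<Prod>y\<in>?S. x * y)"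
    by (simp add: prod.distrib)
  also have "\<dots> = \<Prod>?S"
    by (rule prod.reindex_bij_witness[of _ "\<lambda>y. y / x" "\<lambda>y. x * y"]) (use False in auto)
  finally have "x ^ card ?S = 1"
    by simp
  moreover have "q = Suc (card ?S)"
    using card_field by (metis UNIV_I card.remove finite_class.finite_UNIV)
  ultimately show ?thesis
    by simp
qed

lemma sigma_add [simp]: "\<sigma> (x + y) = \<sigma> x + \<sigma> y"
  unfolding ree_sigma_def
  by (rule freshmans_dream'[where n = "e + 1"]) (simp_all add: CHAR_3)

lemma sigma_mult [simp]: "\<sigma> (x * y) = \<sigma> x * \<sigma> y"
  by (simp add: ree_sigma_def power_mult_distrib)

lemma sigma_power [simp]: "\<sigma> (x ^ n) = \<sigma> x ^ n"
  by (simp add: ree_sigma_def power_mult[symmetric] mult.commute)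

lemma sigma_0 [simp]: "\<sigma> 0 = 0"
  and sigma_1 [simp]: "\<sigma> 1 = 1"
  by (simp_all add: ree_sigma_def)

lemma sigma_minus [simp]: "\<sigma> (- x) = - \<sigma> x"
  by (metis sigma_add sigma_0 add_eq_0_iff2 add.left_inverse)

lemma sigma_diff [simp]: "\<sigma> (x - y) = \<sigma> x - \<sigma> y"
  using sigma_add[of x "- y"] by simp

text \<open>
  Since \<open>3\<^bsup>e+1\<^esup> \<cdot> 3\<^bsup>e+1\<^esup> = 3 q\<close>, the automorphism \<open>\<sigma>\<close> is a square root of the Frobenius map. The
  polynomial identities below treat \<open>x\<close> and \<open>\<sigma> x\<close> as independent variables, exchanged by \<open>\<sigma>\<close> up to a cube.
\<close>

lemma sigma_sigma [simp]: "\<sigma> (\<sigma> x) = x ^ 3"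
proof -
  have "(3::nat) ^ (e + 1) * 3 ^ (e + 1) = q * 3"
    by (simp add: q_def power_add mult_2)
  then have "\<sigma> (\<sigma> x) = (x ^ q) ^ 3"
    by (simp only: ree_sigma_def power_mult[symmetric] mult.commute)
  then show ?thesis
    by (simp add: power_q)
qed

lemma sigma_eq_0 [simp]: "\<sigma> x = 0 \<longleftrightarrow> x = 0"
  by (simp add: ree_sigma_def)

lemma sigma_inverse [simp]: "\<sigma> (inverse x) = inverse (\<sigma> x)"
  by (simp add: ree_sigma_def power_inverse)

lemma sigma_divide [simp]: "\<sigma> (x / y) = \<sigma> x / \<sigma> y"
  by (simp add: divide_inverse)

text \<open>
  As an odd power of 3, \<open>q\<close> is 3 modulo 4, so a square root \<open>x\<close> of \<open>-1\<close> would satisfy \<open>x = x\<^sup>q = -x\<close>.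
\<close>

lemma minus_one_not_square: "(x::'a) ^ 2 \<noteq> -1"
proof
  assume *: "x ^ 2 = -1"
  have "q mod 4 = 3"
  proof -
    have "(3::nat) ^ (2 * e + 1) mod 4 = 3" for e
    proof (induction e)
      case (Suc e)
      have "(3::nat) ^ (2 * Suc e + 1) mod 4 = (9 * (3 ^ (2 * e + 1) mod 4)) mod 4"
        by (simp add: mod_mult_right_eq)
      with Suc show ?case by simp
    qed simp
    then show ?thesis by (simp add: q_def)
  qed
  then obtain k where "q = 4 * k + 3"
    by (metis mult.commute mod_div_decomp)
  then have "x ^ q = (x ^ 2) ^ (2 * k) * x ^ 2 * x"
    by (simp add: power_mult[symmetric] power_add[symmetric] power_Suc[symmetric] del: power_Suc)
       (simp add: eval_nat_numeral)
  also have "\<dots> = - x"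
    by (simp add: *)
  finally have "x = - x" by (simp add: power_q)
  then have "2 * x = 0" by simp
  with * show False by (simp add: two)
qed

section \<open>Points as vectors, and their absolute lines\<close>

text \<open>
  Homogeneous coordinates in 7-dimensional space. In them the point at infinity is the last basis
  vector, every \<open>t\<close> and every \<open>n\<close> is induced by a linear map, and \<open>w\<close> reverses the order of the coordinates.
\<close>

definition ree_vec :: "'a ree_point \<Rightarrow> nat \<Rightarrow> 'a" where
  "ree_vec p i = (case p of Infinity \<Rightarrow> [0,0,0,0,0,0,1] ! i
                  | Pt x1 x2 x3 x4 x5 x6 \<Rightarrow> [1,x1,x2,x3,x4,x5,x6] ! i)"

definition pluecker :: "(nat \<Rightarrow> 'a) \<Rightarrow> (nat \<Rightarrow> 'a) \<Rightarrow> nat \<Rightarrow> nat \<Rightarrow> 'a" where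
  "pluecker x y i j = x i * y j - x j * y i"

text \<open>
  The points of the Ree unital are the absolute points of a polarity of the split Cayley hexagon: a
  point \<open>x\<close> of the hexagon is absolute if it lies on the line that the polarity assigns to it. Here \<open>y\<close>
  is a second point of that line. Six of its Pluecker coordinates are, up to sign, the images under
  \<open>\<sigma>\<close> of coordinates of \<open>x\<close>; the other equations say that the line belongs to the hexagon and
  relate its weight-zero coordinates to \<open>\<sigma> (x 3)\<close>. Unlike the formulas for \<open>\<lambda>\<^sub>1, \<lambda>\<^sub>2, \<lambda>\<^sub>3\<close>, these equations
  have low degree, and reversing the order of the coordinates preserves them up to signs.
\<close>

definition absolute_line :: "(nat \<Rightarrow> 'a) \<Rightarrow> (nat \<Rightarrow> 'a) \<Rightarrow> bool" where
  "absolute_line x y \<longleftrightarrow>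
     pluecker x y 0 1 = \<sigma> (x 0) \<and> pluecker x y 0 2 = \<sigma> (x 1) \<and> pluecker x y 1 4 = - \<sigma> (x 2) \<and>
     pluecker x y 2 5 = - \<sigma> (x 4) \<and> pluecker x y 4 6 = \<sigma> (x 5) \<and> pluecker x y 5 6 = \<sigma> (x 6) \<and>
     pluecker x y 1 2 = - pluecker x y 0 3 \<and> pluecker x y 1 3 = pluecker x y 0 4 \<and> pluecker x y 2 3 = - pluecker x y 0 5 \<and>
     pluecker x y 3 4 = - pluecker x y 1 6 \<and> pluecker x y 3 5 = pluecker x y 2 6 \<and> pluecker x y 4 5 = - pluecker x y 3 6 \<and>
     pluecker x y 0 6 + pluecker x y 2 4 = \<sigma> (x 3) \<and> pluecker x y 1 5 - pluecker x y 2 4 = \<sigma> (x 3)"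

lemma less_7_cases: "(i::nat) < 7 \<longleftrightarrow> i = 0 \<or> i = 1 \<or> i = 2 \<or> i = 3 \<or> i = 4 \<or> i = 5 \<or> i = 6"
  by auto

text \<open>
  The line meets the hyperplane \<open>x\<^sub>0 = 0\<close> in a point \<open>z\<close> with \<open>z\<^sub>1 = 1\<close>. The equations then determine
  \<open>z\<^sub>2, z\<^sub>3, z\<^sub>4, x\<^sub>4, z\<^sub>5, x\<^sub>5, z\<^sub>6, x\<^sub>6\<close> one after the other in terms of \<open>x\<^sub>1, x\<^sub>2, x\<^sub>3\<close>.
\<close>

lemma absolute_line_affine:
  assumes "absolute_line x y" "x 0 = 1"
  shows "x 4 = ree_lambda1 e (x 1) (x 2) (x 3)" (is ?g1)
    "x 5 = ree_lambda2 e (x 1) (x 2) (x 3)" (is ?g2)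
    "x 6 = ree_lambda3 e (x 1) (x 2) (x 3)" (is ?g3)
proof -
  define z where "z i = pluecker x y 0 i" for i
  have pl: "pluecker x y i j = x i * z j - x j * z i" for i j
    by (simp add: z_def pluecker_def assms algebra_simps)
  note h = assms(1)[unfolded absolute_line_def pl]
  have z0: "z 0 = 0" by (simp add: z_def pluecker_def)
  have z1: "z 1 = 1" and z2: "z 2 = \<sigma> (x 1)"
    using h assms(2) z0 by simp_all
  have z3: "z 3 = x 2 - x 1 * \<sigma> (x 1)"
    using h assms(2) z0 z1 z2 by (simp add: algebra_simps del: One_nat_def)
  have z4: "z 4 = x 1 * z 3 - x 3"
    using h assms(2) z0 z1 z2 by (simp add: algebra_simps del: One_nat_def)
  have x4: "x 4 = \<sigma> (x 2) + x 1 * z 4"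
    using h assms(2) z0 z1 z2 by (simp add: algebra_simps del: One_nat_def)
  show ?g1
    using three
    by (simp add: x4 z4 z3 ree_lambda1_def Let_def algebra_simps power2_eq_square power3_eq_cube)
  have z5: "z 5 = x 3 * z 2 - x 2 * z 3"
    using h assms(2) z0 z1 z2 by (simp add: algebra_simps del: One_nat_def)
  have x5: "x 5 = x 1 * z 5 - x 2 * z 4 + x 4 * z 2 - \<sigma> (x 3)"
    using h assms(2) z0 z1 z2 by (simp add: algebra_simps del: One_nat_def)
  show ?g2
    unfolding x5 ree_lambda2_def Let_def x4 z5 z4 z3 z2
    by (rule eq_mod_3[where Q = "(x 1)^2 * x 2 * \<sigma> (x 1) - x 1 * (x 2)^2"])
       (simp add: algebra_simps power_numeral_reduce del: One_nat_def)
  have z6: "z 6 = \<sigma> (x 3) - x 2 * z 4 + x 4 * z 2"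
    using h assms(2) z0 z1 z2 by (simp add: algebra_simps del: One_nat_def)
  have x6: "x 6 = x 1 * z 6 + x 3 * z 4 - x 4 * z 3"
    using h assms(2) z0 z1 z2 by (simp add: algebra_simps del: One_nat_def)
  show ?g3
    unfolding x6 ree_lambda3_def Let_def z6 x4 z5 z4 z3 z2
    by (rule eq_mod_3[where Q = "x 1 * \<sigma> (x 1) * \<sigma> (x 2) + x 1 * x 2 * x 3
          - (x 1)^2 * x 3 * \<sigma> (x 1) - (x 1)^2 * (x 2)^2 + (x 1)^3 * x 2 * \<sigma> (x 1)
          - (x 1)^4 * (\<sigma> (x 1))^2"])
       (simp add: algebra_simps power_numeral_reduce del: One_nat_def)
qed

text \<open>
  The point in which the absolute line through \<open>(a, b, c, \<dots>)\<close> meets the hyperplane \<open>x\<^sub>0 = 0\<close>. It is the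
  image of the second basis vector under the linear map that induces \<open>t\<close> with parameters \<open>a, b, c\<close>.
\<close>

definition ree_dir :: "'a \<Rightarrow> 'a \<Rightarrow> 'a \<Rightarrow> nat \<Rightarrow> 'a" where
  "ree_dir a b c i =
     [0, 1, \<sigma> a, b - a * \<sigma> a, a * b - c - a^2 * \<sigma> a, c * \<sigma> a - b^2 + a * b * \<sigma> a,
      \<sigma> c + \<sigma> a * \<sigma> b + b * c - a * c * \<sigma> a - a * b^2 - a^2 * b * \<sigma> a - a^3 * (\<sigma> a)^2] ! i"

lemma absolute_line_ree_pt: "absolute_line (ree_vec (ree_pt e a b c)) (ree_dir a b c)"
  unfolding absolute_line_def
  apply (simp only: ree_vec_def ree_pt_def ree_dir_def pluecker_def ree_point.case nth_Cons_numeral nth_Cons_0 One_nat_def[symmetric] nth_Cons'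
     ree_lambda1_def ree_lambda2_def ree_lambda3_def Let_def)
  apply (simp only: sigma_add sigma_diff sigma_mult sigma_power sigma_minus sigma_sigma sigma_1 sigma_0 rel_simps if_True if_False arith_simps numeral_One)
  apply (intro conjI)
  subgoal by (simp add: algebra_simps power_numeral_reduce)
  subgoal by (simp add: algebra_simps power_numeral_reduce)
  subgoal by (simp add: algebra_simps power_numeral_reduce)
  subgoal by (simp add: algebra_simps power_numeral_reduce)
  subgoal by (rule eq_mod_3[where Q = "- (a * c * (\<sigma> a) * (\<sigma> b)) + a^2 * b^2 * c - a^3 * (\<sigma> a)^2 * (\<sigma> b) - a^3 * b^3 + a^4 * c * (\<sigma> a)^2 + a^6 * (\<sigma> a)^3"])
      (simp add: algebra_simps power_numeral_reduce)
  subgoal by (rule eq_mod_3[where Q = "b * c * (\<sigma> a) * (\<sigma> b) + a * b^2 * (\<sigma> c) - a^2 * b^2 * c * (\<sigma> a) - a^3 * (\<sigma> a)^3 * (\<sigma> b) - a^3 * b * c * (\<sigma> a)^2"])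
      (simp add: algebra_simps power_numeral_reduce)
  subgoal by (simp add: algebra_simps power_numeral_reduce)
  subgoal by (simp add: algebra_simps power_numeral_reduce)
  subgoal by (simp add: algebra_simps power_numeral_reduce)
  subgoal by (rule eq_mod_3[where Q = "a * (\<sigma> a) * (\<sigma> b) + a * b * c - a^2 * c * (\<sigma> a) - a^2 * b^2 - a^4 * (\<sigma> a)^2"])
      (simp add: algebra_simps power_numeral_reduce)
  subgoal by (rule eq_mod_3[where Q = "- (b * (\<sigma> a) * (\<sigma> b)) - b^2 * c + a * b * c * (\<sigma> a) + a^2 * b^2 * (\<sigma> a) + a^3 * b * (\<sigma> a)^2"])
      (simp add: algebra_simps power_numeral_reduce)
  subgoal by (rule eq_mod_3[where Q = "c * (\<sigma> a) * (\<sigma> b) + b * c^2 - a * c^2 * (\<sigma> a) - a^2 * b^3 - a^3 * c * (\<sigma> a)^2 + a^3 * b^2 * (\<sigma> a)"])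
      (simp add: algebra_simps power_numeral_reduce)
  subgoal by (rule eq_mod_3[where Q = "- (a^2 * b * (\<sigma> a))"])
      (simp add: algebra_simps power_numeral_reduce)
  subgoal by (rule eq_mod_3[where Q = "- (a * b^2) + a^2 * b * (\<sigma> a)"])
      (simp add: algebra_simps power_numeral_reduce)
  done

section \<open>The involution \<open>w\<close> preserves the set of points\<close>

abbreviation V :: "'a ree_point set" where "V \<equiv> ree_points e"
abbreviation pt :: "'a \<Rightarrow> 'a \<Rightarrow> 'a \<Rightarrow> 'a ree_point" where "pt \<equiv> ree_pt e"
abbreviation N :: "'a \<Rightarrow> 'a \<Rightarrow> 'a \<Rightarrow> 'a" where "N \<equiv> ree_lambda3 e"

lemma Infinity_in_V [simp]: "Infinity \<in> V"
  and pt_in_V [simp]: "pt a b c \<in> V"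
  by (auto simp: ree_points_def)

lemma V_cases:
  assumes "p \<in> V"
  obtains "p = Infinity" | a b c where "p = pt a b c"
  using assms by (auto simp: ree_points_def)

lemma pt_eq_iff [simp]: "pt a b c = pt a' b' c' \<longleftrightarrow> a = a' \<and> b = b' \<and> c = c'"
  by (auto simp: ree_pt_def)

lemma pt_neq_Infinity [simp]: "pt a b c \<noteq> Infinity" "Infinity \<noteq> pt a b c"
  by (auto simp: ree_pt_def)

lemma ree_zero_eq: "ree_zero = pt 0 0 0"
  by (simp add: ree_zero_def ree_pt_def ree_lambda1_def ree_lambda2_def ree_lambda3_def Let_def)

lemma t_Infinity [simp]: "ree_t e \<alpha> \<beta> \<gamma> Infinity = (Infinity :: 'a ree_point)"
  and n_Infinity [simp]: "ree_n e \<kappa> Infinity = (Infinity :: 'a ree_point)"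
  and w_Infinity [simp]: "ree_w e Infinity = (pt 0 0 0 :: 'a ree_point)"
  by (simp_all add: ree_t_def ree_n_def ree_w_def ree_zero_eq)

lemma t_pt [simp]: "ree_t e \<alpha> \<beta> \<gamma> (pt a b c) =
    pt (a + \<alpha>) (b + \<beta> + \<sigma> \<alpha> * a) (c + \<gamma> - \<alpha> * b + \<beta> * a - \<sigma> \<alpha> * \<alpha> * a)"
  unfolding ree_t_def by (subst restrict_apply', simp) (simp add: ree_pt_def)

lemma n_pt [simp]: "ree_n e \<kappa> (pt a b c) = pt (\<kappa> * a) (\<sigma> \<kappa> * \<kappa> * b) (\<sigma> \<kappa> * \<kappa>^2 * c)"
  unfolding ree_n_def by (subst restrict_apply', simp) (simp add: ree_pt_def)

lemma ree_vec_pt [simp]: "ree_vec (pt a b c) i =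
    [1, a, b, c, ree_lambda1 e a b c, ree_lambda2 e a b c, N a b c] ! i"
  by (simp add: ree_vec_def ree_pt_def)

lemma ree_vec_Infinity [simp]: "ree_vec Infinity i = [0,0,0,0,0,0,1] ! i"
  by (simp add: ree_vec_def)

text \<open>
  This is the anisotropy of \<open>\<lambda>\<^sub>3\<close>, read off from the equations: \<open>x\<^sub>4 y\<^sub>6 = \<sigma> x\<^sub>5\<close> and \<open>x\<^sub>5 y\<^sub>6 = 0\<close> give
  \<open>x\<^sub>5 = 0\<close>, and the first nonzero coordinate among \<open>y\<^sub>6, y\<^sub>5, y\<^sub>4\<close>, if any, then forces the remaining ones
  of \<open>x\<close> to vanish.
\<close>

lemma absolute_line_isotropic:
  assumes "absolute_line x y" "x 0 = 1" "y 0 = 0" "x 6 = 0"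
  shows "x 1 = 0" "x 2 = 0" "x 3 = 0"
proof -
  note h = assms(1)[unfolded absolute_line_def pluecker_def]
  have y1: "y 1 = 1" and y2: "y 2 = \<sigma> (x 1)"
    using h assms(2,3) by simp_all
  have e3: "y 3 = x 2 - x 1 * \<sigma> (x 1)" and e4: "y 4 = x 1 * y 3 - x 3"
    and e14: "x 1 * y 4 - x 4 = - \<sigma> (x 2)" and e25: "x 2 * y 5 - x 5 * y 2 = - \<sigma> (x 4)"
    and e46: "x 4 * y 6 = \<sigma> (x 5)" and e56: "x 5 * y 6 = 0"
    and e34: "x 3 * y 4 - x 4 * y 3 = - (x 1 * y 6)" and e35: "x 3 * y 5 - x 5 * y 3 = x 2 * y 6"
    and e45: "x 4 * y 5 - x 5 * y 4 = - (x 3 * y 6)"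
    and e06: "y 6 + (x 2 * y 4 - x 4 * y 2) = \<sigma> (x 3)"
    and e15: "x 1 * y 5 - x 5 - (x 2 * y 4 - x 4 * y 2) = \<sigma> (x 3)"
    using h assms(2-4) y1 y2 by (simp_all add: algebra_simps del: One_nat_def)
  have x5: "x 5 = 0"
    using e46 e56 by auto
  have "x 1 = 0 \<and> x 2 = 0 \<and> x 3 = 0"
  proof (cases "y 6 = 0")
    case False
    with e46 x5 have x4: "x 4 = 0" by simp
    with e45 x5 False have "x 3 = 0" by simp
    with e34 e35 x4 x5 False show ?thesis by simp
  next
    case y6: True
    show ?thesis
    proof (cases "y 5 = 0")
      case False
      with e35 e45 x5 y6 have x34: "x 3 = 0" "x 4 = 0" by simp_all
      with e25 x5 False have "x 2 = 0" by simp
      with e15 x34 x5 False show ?thesis by simp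
    next
      case y5: True
      with e25 x5 have x4: "x 4 = 0" by simp
      have "2 * \<sigma> (x 3) = 0"
        using e15 e06 x5 y5 y6 x4 by (simp add: algebra_simps)
      then have x3: "x 3 = 0" by (simp add: two)
      show ?thesis
      proof (cases "y 4 = 0")
        case False
        with e06 x3 x4 y6 have "x 2 = 0" by simp
        with e14 x4 False x3 show ?thesis by simp
      next
        case True
        with e14 x4 have "x 2 = 0" by simp
        with e3 e4 True x3 show ?thesis by simp
      qed
    qed
  qed
  then show "x 1 = 0" "x 2 = 0" "x 3 = 0" by simp_all
qed

lemma N_eq_0_iff: "N a b c = 0 \<longleftrightarrow> a = 0 \<and> b = 0 \<and> c = 0"
proof
  assume "N a b c = 0"
  then show "a = 0 \<and> b = 0 \<and> c = 0"
    using absolute_line_isotropic[OF absolute_line_ree_pt[of a b c]]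
    by (simp add: ree_dir_def)
qed (simp add: ree_lambda3_def Let_def)

text \<open>
  Reversal exchanges the equations in pairs but negates all Pluecker coordinates; moreover the line
  has to be rescaled by \<open>\<sigma> k\<close> when the point is rescaled by \<open>k\<close>.
\<close>

lemma absolute_line_reverse:
  assumes "absolute_line x y" and "k * m = - \<sigma> k"
  shows "absolute_line (\<lambda>i. k * x (6 - i)) (\<lambda>i. m * y (6 - i))"
proof -
  have *: "pluecker (\<lambda>i. k * x (6 - i)) (\<lambda>i. m * y (6 - i)) i j = \<sigma> k * pluecker x y (6 - j) (6 - i)" for i j
  proof -
    have "pluecker (\<lambda>i. k * x (6 - i)) (\<lambda>i. m * y (6 - i)) i j = - (k * m) * pluecker x y (6 - j) (6 - i)"
      by (simp add: pluecker_def algebra_simps)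
    then show ?thesis by (simp add: assms(2))
  qed
  show ?thesis
    using assms(1) unfolding absolute_line_def *
    by (simp add: distrib_left[symmetric] right_diff_distrib[symmetric] del: One_nat_def)
       (simp add: algebra_simps)
qed

text \<open>
  The reversed coordinate vector, divided by \<open>\<lambda>\<^sub>3\<close>, again carries an absolute line and has first
  coordinate 1, so its last three coordinates are the required functions of the preceding ones.
\<close>

lemma w_pt:
  assumes "\<not> (a = 0 \<and> b = 0 \<and> c = 0)"
  shows "ree_w e (pt a b c) =
    pt (ree_lambda2 e a b c / N a b c) (ree_lambda1 e a b c / N a b c) (c / N a b c)"
proof -
  let ?k = "1 / N a b c"
  have N: "N a b c \<noteq> 0" using assms by (simp add: N_eq_0_iff)
  define x where "x i = ?k * ree_vec (pt a b c) (6 - i)" for i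
  have "\<exists>m. ?k * m = - \<sigma> ?k"
    by (rule exI[of _ "- \<sigma> ?k * N a b c"]) (simp add: N)
  then obtain y where "absolute_line x y"
    using absolute_line_reverse[OF absolute_line_ree_pt[of a b c]] unfolding x_def by blast
  moreover have "x 0 = 1" by (simp add: x_def N)
  ultimately have "x 4 = ree_lambda1 e (x 1) (x 2) (x 3)" "x 5 = ree_lambda2 e (x 1) (x 2) (x 3)"
     "x 6 = ree_lambda3 e (x 1) (x 2) (x 3)"
    by (simp_all only: absolute_line_affine)
  moreover have "pt a b c \<noteq> ree_zero"
    using assms by (simp add: ree_zero_eq)
  ultimately show ?thesis
    unfolding ree_w_def
    by (subst restrict_apply', simp) (simp add: ree_pt_def x_def ree_vec_def ree_zero_def)
qed

lemma w_zero [simp]: "ree_w e (pt 0 0 0) = (Infinity :: 'a ree_point)"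
  unfolding ree_w_def by (subst restrict_apply', simp) (simp add: ree_zero_eq ree_pt_def)

lemma w_vec:
  assumes "p \<in> V"
  shows "ree_w e p \<in> V" and "\<exists>k. k \<noteq> 0 \<and> (\<forall>i<7. ree_vec (ree_w e p) i = k * ree_vec p (6 - i))"
proof -
  have "ree_w e p \<in> V \<and> (\<exists>k. k \<noteq> 0 \<and> (\<forall>i<7. ree_vec (ree_w e p) i = k * ree_vec p (6 - i)))"
    using assms
  proof (cases p rule: V_cases)
    case 1
    then show ?thesis
      by (auto intro!: exI[of _ 1] simp: less_7_cases ree_lambda1_def ree_lambda2_def ree_lambda3_def Let_def)
  next
    case (2 a b c)
    show ?thesis
    proof (cases "a = 0 \<and> b = 0 \<and> c = 0")
      case True
      with 2 show ?thesis
        by (auto intro!: exI[of _ 1] simp: less_7_cases ree_lambda1_def ree_lambda2_def ree_lambda3_def Let_def)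
    next
      case False
      then have N: "N a b c \<noteq> 0" by (simp add: N_eq_0_iff)
      have "pt a b c \<noteq> ree_zero"
        using False by (simp add: ree_zero_eq)
      then have "\<forall>i<7. ree_vec (ree_w e p) i = (1 / N a b c) * ree_vec p (6 - i)"
        unfolding ree_w_def 2
        by (subst restrict_apply', simp) (auto simp: less_7_cases ree_pt_def ree_vec_def ree_zero_def N)
      then show ?thesis
        using N by (auto simp: 2 w_pt[OF False] intro!: exI[of _ "1 / N a b c"])
    qed
  qed
  then show "ree_w e p \<in> V" "\<exists>k. k \<noteq> 0 \<and> (\<forall>i<7. ree_vec (ree_w e p) i = k * ree_vec p (6 - i))"
    by auto
qed

lemma ree_vec_proportional_imp_eq:
  assumes "p \<in> V" "p' \<in> V" "k \<noteq> 0" "\<forall>i<7. ree_vec p' i = k * ree_vec p i"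
  shows "p' = p"
  using assms(1)
proof (cases p rule: V_cases)
  case 1
  with assms(4) have "ree_vec p' 0 = 0" by simp
  with assms(2) 1 show ?thesis by (auto elim!: V_cases)
next
  case (2 a b c)
  with assms(3,4) have "ree_vec p' 0 = k" by simp
  with assms(2,3) obtain a' b' c' where p': "p' = pt a' b' c'" by (auto elim!: V_cases)
  with \<open>ree_vec p' 0 = k\<close> have "k = 1" by simp
  then have "ree_vec p' 1 = ree_vec p 1" "ree_vec p' 2 = ree_vec p 2" "ree_vec p' 3 = ree_vec p 3"
    using assms(4) by simp_all
  then show ?thesis by (simp add: 2 p')
qed

lemma w_w [simp]:
  assumes "p \<in> V"
  shows "ree_w e (ree_w e p) = p"
proof -
  obtain k where k: "k \<noteq> 0" "\<forall>i<7. ree_vec (ree_w e p) i = k * ree_vec p (6 - i)"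
    using w_vec(2)[OF assms] by blast
  obtain l where l: "l \<noteq> 0"
    "\<forall>i<7. ree_vec (ree_w e (ree_w e p)) i = l * ree_vec (ree_w e p) (6 - i)"
    using w_vec(2)[OF w_vec(1)[OF assms]] by blast
  have "\<forall>i<7. ree_vec (ree_w e (ree_w e p)) i = (l * k) * ree_vec p i"
    using k l by simp
  then show ?thesis
    using ree_vec_proportional_imp_eq[OF assms, of _ "l * k"] w_vec(1) assms k l by simp
qed

section \<open>Forms preserved up to scalars\<close>

text \<open>
  The points lie on the quadric of the symmetric form \<open>bil\<close>. The alternating product \<open>cross\<close> is that of
  the trace-zero octonions, and \<open>tri\<close> is Dickson's alternating trilinear form, whose isometry group is
  of type \<open>G\<^sub>2\<close>. Absolute lines are spanned by vectors with vanishing product.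
\<close>

definition bil :: "(nat \<Rightarrow> 'a) \<Rightarrow> (nat \<Rightarrow> 'a) \<Rightarrow> 'a" where
  "bil x y = x 0 * y 6 + x 6 * y 0 + x 1 * y 5 + x 5 * y 1 + x 2 * y 4 + x 4 * y 2 - x 3 * y 3"

definition cross :: "(nat \<Rightarrow> 'a) \<Rightarrow> (nat \<Rightarrow> 'a) \<Rightarrow> nat \<Rightarrow> 'a" where
  "cross x y i =
     [pluecker x y 0 3 + pluecker x y 1 2, pluecker x y 0 4 - pluecker x y 1 3, - pluecker x y 0 5 - pluecker x y 2 3,
      pluecker x y 0 6 - pluecker x y 1 5 - pluecker x y 2 4,
      - pluecker x y 1 6 - pluecker x y 3 4, pluecker x y 2 6 - pluecker x y 3 5, pluecker x y 3 6 + pluecker x y 4 5] ! i"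

definition tri :: "(nat \<Rightarrow> 'a) \<Rightarrow> (nat \<Rightarrow> 'a) \<Rightarrow> (nat \<Rightarrow> 'a) \<Rightarrow> 'a" where
  "tri x y z = bil (cross x y) z"

text \<open>
  The linear maps that induce \<open>t\<close> with parameters \<open>(a, 0, 0)\<close>, \<open>(0, b, 0)\<close> and \<open>(0, 0, c)\<close>; every \<open>t\<close> is
  a product of three such maps.
\<close>

definition shear1 :: "'a \<Rightarrow> (nat \<Rightarrow> 'a) \<Rightarrow> nat \<Rightarrow> 'a" where
  "shear1 a x i = [x 0, x 1 + a * x 0, x 2 + \<sigma> a * x 1, x 3 - a * x 2 - a * \<sigma> a * x 1,
     x 4 - a * x 3 - a^2 * x 2 - a^2 * \<sigma> a * x 1 - a^3 * \<sigma> a * x 0,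
     x 5 - \<sigma> a * x 4 - a^3 * (\<sigma> a)^2 * x 0,
     x 6 - a * x 5 + a * \<sigma> a * x 4 + a^3 * \<sigma> a * x 2 - a^3 * (\<sigma> a)^2 * x 1 + a^4 * (\<sigma> a)^2 * x 0] ! i"

definition shear2 :: "'a \<Rightarrow> (nat \<Rightarrow> 'a) \<Rightarrow> nat \<Rightarrow> 'a" where
  "shear2 b x i = [x 0, x 1, x 2 + b * x 0, x 3 + b * x 1, x 4 + \<sigma> b * x 0,
     x 5 + b * x 3 - b^2 * x 1, x 6 - b * x 4 - \<sigma> b * x 2 - b * \<sigma> b * x 0] ! i"

definition shear3 :: "'a \<Rightarrow> (nat \<Rightarrow> 'a) \<Rightarrow> nat \<Rightarrow> 'a" where
  "shear3 c x i = [x 0, x 1, x 2, x 3 + c * x 0, x 4 - c * x 1, x 5 + c * x 2 - \<sigma> c * x 0,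
     x 6 + c * x 3 + \<sigma> c * x 1 - c^2 * x 0] ! i"

lemma bil_shear1: "bil (shear1 a x) (shear1 a y) = bil x y"
  unfolding bil_def shear1_def
  by (rule eq_mod_3[where Q = "- (a^2 * x 2 * y 2) - a^2 * (\<sigma> a) * x 2 * y 1 - a^2 * (\<sigma> a) * x 1 * y 2 - a^2 * (\<sigma> a)^2 * x 1 * y 1 - a^3 * (\<sigma> a)^2 * x 1 * y 0 - a^3 * (\<sigma> a)^2 * x 0 * y 1"])
     (simp add: algebra_simps power_numeral_reduce)

lemma cross_shear1:
  assumes "i < 7"
  shows "cross (shear1 a x) (shear1 a y) i = shear1 a (cross x y) i"
  using assms unfolding less_7_cases
  apply (elim disjE; hypsubst; unfold cross_def shear1_def pluecker_def)
  subgoal by (simp add: algebra_simps power_numeral_reduce)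
  subgoal by (rule eq_mod_3[where Q = "a * x 3 * y 0 - a * x 0 * y 3"])
      (simp add: algebra_simps power_numeral_reduce)
  subgoal by (simp add: algebra_simps power_numeral_reduce)
  subgoal by (rule eq_mod_3[where Q = "a * x 5 * y 0 - a * x 0 * y 5 - a * (\<sigma> a) * x 4 * y 0 + a * (\<sigma> a) * x 0 * y 4 + a^3 * (\<sigma> a)^2 * x 1 * y 0 - a^3 * (\<sigma> a)^2 * x 0 * y 1"])
      (simp add: algebra_simps power_numeral_reduce)
  subgoal by (rule eq_mod_3[where Q = "a^2 * x 3 * y 2 - a^2 * x 2 * y 3 + a^2 * (\<sigma> a) * x 3 * y 1 - a^2 * (\<sigma> a) * x 1 * y 3 - a^4 * (\<sigma> a)^2 * x 1 * y 0 + a^4 * (\<sigma> a)^2 * x 0 * y 1"])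
      (simp add: algebra_simps power_numeral_reduce)
  subgoal by (rule eq_mod_3[where Q = "- (a^3 * (\<sigma> a)^2 * x 2 * y 1) + a^3 * (\<sigma> a)^2 * x 1 * y 2"])
      (simp add: algebra_simps power_numeral_reduce)
  subgoal by (rule eq_mod_3[where Q = "a * x 5 * y 3 - a * x 3 * y 5 - a * (\<sigma> a) * x 4 * y 3 + a * (\<sigma> a) * x 3 * y 4 - a^3 * (\<sigma> a)^2 * x 4 * y 0 + a^3 * (\<sigma> a)^2 * x 0 * y 4 + a^4 * (\<sigma> a)^2 * x 3 * y 0 + a^4 * (\<sigma> a)^2 * x 2 * y 1 - a^4 * (\<sigma> a)^2 * x 1 * y 2 - a^4 * (\<sigma> a)^2 * x 0 * y 3"])
      (simp add: algebra_simps power_numeral_reduce)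
  done

lemma bil_shear2: "bil (shear2 b x) (shear2 b y) = bil x y"
  unfolding bil_def shear2_def
  by (rule eq_mod_3[where Q = "- (b^2 * x 1 * y 1)"])
     (simp add: algebra_simps power_numeral_reduce)

lemma cross_shear2:
  assumes "i < 7"
  shows "cross (shear2 b x) (shear2 b y) i = shear2 b (cross x y) i"
  using assms unfolding less_7_cases
  apply (elim disjE; hypsubst; unfold cross_def shear2_def pluecker_def)
  subgoal by (simp add: algebra_simps power_numeral_reduce)
  subgoal by (simp add: algebra_simps power_numeral_reduce)
  subgoal by (rule eq_mod_3[where Q = "b * x 3 * y 0 - b * x 0 * y 3"])
      (simp add: algebra_simps power_numeral_reduce)
  subgoal by (rule eq_mod_3[where Q = "b * x 4 * y 0 - b * x 0 * y 4"])
      (simp add: algebra_simps power_numeral_reduce)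
  subgoal by (simp add: algebra_simps power_numeral_reduce)
  subgoal by (rule eq_mod_3[where Q = "b^2 * x 3 * y 1 - b^2 * x 1 * y 3"])
      (simp add: algebra_simps power_numeral_reduce)
  subgoal by (rule eq_mod_3[where Q = "b * x 4 * y 3 - b * x 3 * y 4 - b * (\<sigma> b) * x 3 * y 0 + b * (\<sigma> b) * x 0 * y 3"])
      (simp add: algebra_simps power_numeral_reduce)
  done

lemma bil_shear3: "bil (shear3 c x) (shear3 c y) = bil x y"
  unfolding bil_def shear3_def
  by (rule eq_mod_3[where Q = "- (c^2 * x 0 * y 0)"])
     (simp add: algebra_simps power_numeral_reduce)

lemma cross_shear3:
  assumes "i < 7"
  shows "cross (shear3 c x) (shear3 c y) i = shear3 c (cross x y) i"
  using assms unfolding less_7_cases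
  apply (elim disjE; hypsubst; unfold cross_def shear3_def pluecker_def)
  subgoal by (simp add: algebra_simps power_numeral_reduce)
  subgoal by (simp add: algebra_simps power_numeral_reduce)
  subgoal by (simp add: algebra_simps power_numeral_reduce)
  subgoal by (rule eq_mod_3[where Q = "c * x 2 * y 1 - c * x 1 * y 2"])
      (simp add: algebra_simps power_numeral_reduce)
  subgoal by (rule eq_mod_3[where Q = "c * x 3 * y 1 - c * x 1 * y 3"])
      (simp add: algebra_simps power_numeral_reduce)
  subgoal by (rule eq_mod_3[where Q = "- (c * x 3 * y 2) + c * x 2 * y 3"])
      (simp add: algebra_simps power_numeral_reduce)
  subgoal by (rule eq_mod_3[where Q = "- (c^2 * x 3 * y 0) + c^2 * x 0 * y 3"])
      (simp add: algebra_simps power_numeral_reduce)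
  done

lemmas list_nth_simps = nth_Cons_numeral nth_Cons_0 nth_Cons_Suc nth_Cons' One_nat_def[symmetric] rel_simps if_True if_False arith_simps numeral_One diff_numeral_special

lemma bil_cong: "(\<And>i. i < 7 \<Longrightarrow> x i = x' i) \<Longrightarrow> (\<And>i. i < 7 \<Longrightarrow> y i = y' i) \<Longrightarrow> bil x y = bil x' y'"
  by (simp add: bil_def)

lemma tri_cong: "(\<And>i. i < 7 \<Longrightarrow> x i = x' i) \<Longrightarrow> (\<And>i. i < 7 \<Longrightarrow> y i = y' i) \<Longrightarrow>
    (\<And>i. i < 7 \<Longrightarrow> z i = z' i) \<Longrightarrow> tri x y z = tri x' y' z'"
  by (simp add: tri_def bil_def cross_def pluecker_def)

lemma bil_scale: "bil (\<lambda>i. k * x i) (\<lambda>i. l * y i) = k * l * bil x y"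
  by (simp add: bil_def algebra_simps)

lemma cross_scale: "i < 7 \<Longrightarrow> cross (\<lambda>i. k * x i) (\<lambda>i. l * y i) i = (k * l) * cross x y i"
  unfolding less_7_cases by (elim disjE; simp add: cross_def pluecker_def algebra_simps)

lemma tri_scale: "tri (\<lambda>i. k * x i) (\<lambda>i. l * y i) (\<lambda>i. m * z i) = k * l * m * tri x y z"
  unfolding tri_def by (subst bil_cong[OF cross_scale refl], assumption, rule bil_scale)

lemma bil_reverse: "bil (\<lambda>i. x (6 - i)) (\<lambda>i. y (6 - i)) = bil x y"
  by (simp add: bil_def algebra_simps)

lemma cross_reverse: "i < 7 \<Longrightarrow>
    cross (\<lambda>i. x (6 - i)) (\<lambda>i. y (6 - i)) i = (- 1) * cross x y (6 - i)"
  unfolding less_7_cases by (elim disjE; simp add: cross_def pluecker_def algebra_simps)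

lemma tri_reverse: "tri (\<lambda>i. x (6 - i)) (\<lambda>i. y (6 - i)) (\<lambda>i. z (6 - i)) = - tri x y z"
proof -
  have "tri (\<lambda>i. x (6 - i)) (\<lambda>i. y (6 - i)) (\<lambda>i. z (6 - i))
      = bil (\<lambda>i. (- 1) * cross x y (6 - i)) (\<lambda>i. 1 * z (6 - i))"
    unfolding tri_def by (intro bil_cong cross_reverse) simp_all
  then show ?thesis
    by (simp only: bil_scale tri_def bil_reverse[of "cross x y" z]) simp
qed

text \<open>
  A linear map that preserves both \<open>bil\<close> and \<open>cross\<close> preserves \<open>tri\<close>; the determinants in \<open>tri\<close> need
  not be expanded.
\<close>

lemma tri_shear:
  "tri (shear1 u x) (shear1 u y) (shear1 u z) = tri x y z"
  "tri (shear2 u x) (shear2 u y) (shear2 u z) = tri x y z"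
  "tri (shear3 u x) (shear3 u y) (shear3 u z) = tri x y z"
  unfolding tri_def
  by (subst bil_cong[OF cross_shear1 refl], assumption, rule bil_shear1,
      subst bil_cong[OF cross_shear2 refl], assumption, rule bil_shear2,
      subst bil_cong[OF cross_shear3 refl], assumption, rule bil_shear3)

text \<open>
  A factor for every point is needed because \<open>w\<close> maps coordinate vectors only to multiples of coordinate
  vectors. Quantifying over points instead of vectors spares the construction of linear extensions.
\<close>

definition similitude :: "('a ree_point \<Rightarrow> 'a ree_point) \<Rightarrow> bool" where
  "similitude g \<longleftrightarrow> (\<exists>c. (\<forall>p\<in>V. c p \<noteq> 0) \<and>
     (\<forall>p\<in>V. \<forall>r\<in>V. bil (ree_vec (g p)) (ree_vec (g r)) = c p * c r * bil (ree_vec p) (ree_vec r)) \<and>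
     (\<forall>p\<in>V. \<forall>r\<in>V. \<forall>s\<in>V. tri (ree_vec (g p)) (ree_vec (g r)) (ree_vec (g s)) =
         c p * c r * c s * tri (ree_vec p) (ree_vec r) (ree_vec s)))"

lemma similitudeI:
  assumes "\<And>p. p \<in> V \<Longrightarrow> c p \<noteq> 0" "m \<noteq> 0"
    and "\<And>p i. p \<in> V \<Longrightarrow> i < 7 \<Longrightarrow> ree_vec (g p) i = c p * M (ree_vec p) i"
    and "\<And>x y. bil (M x) (M y) = m^2 * bil x y" "\<And>x y z. tri (M x) (M y) (M z) = m^3 * tri x y z"
  shows "similitude g"
  unfolding similitude_def
proof (intro exI[of _ "\<lambda>p. m * c p"] conjI ballI)
  fix p r s assume p: "p \<in> V" and r: "r \<in> V"
  show "bil (ree_vec (g p)) (ree_vec (g r)) = (m * c p) * (m * c r) * bil (ree_vec p) (ree_vec r)"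
    using bil_cong[OF assms(3)[OF p] assms(3)[OF r]]
    by (simp add: bil_scale assms(4) power2_eq_square)
  assume s: "s \<in> V"
  show "tri (ree_vec (g p)) (ree_vec (g r)) (ree_vec (g s)) =
         (m * c p) * (m * c r) * (m * c s) * tri (ree_vec p) (ree_vec r) (ree_vec s)"
    using tri_cong[OF assms(3)[OF p] assms(3)[OF r] assms(3)[OF s]]
    by (simp add: tri_scale assms(5) power3_eq_cube)
qed (use assms(1,2) in auto)

lemma similitude_compose:
  assumes "similitude g" "similitude h" "\<And>p. p \<in> V \<Longrightarrow> h p \<in> V"
    and "\<And>p. p \<in> V \<Longrightarrow> f p = g (h p)"
  shows "similitude f"
proof -
  from assms(1,2) obtain c d where c: "\<forall>p\<in>V. c p \<noteq> 0"
     "\<forall>p\<in>V. \<forall>r\<in>V. bil (ree_vec (g p)) (ree_vec (g r)) = c p * c r * bil (ree_vec p) (ree_vec r)"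
     "\<forall>p\<in>V. \<forall>r\<in>V. \<forall>s\<in>V. tri (ree_vec (g p)) (ree_vec (g r)) (ree_vec (g s)) =
         c p * c r * c s * tri (ree_vec p) (ree_vec r) (ree_vec s)"
   and d: "\<forall>p\<in>V. d p \<noteq> 0"
     "\<forall>p\<in>V. \<forall>r\<in>V. bil (ree_vec (h p)) (ree_vec (h r)) = d p * d r * bil (ree_vec p) (ree_vec r)"
     "\<forall>p\<in>V. \<forall>r\<in>V. \<forall>s\<in>V. tri (ree_vec (h p)) (ree_vec (h r)) (ree_vec (h s)) =
         d p * d r * d s * tri (ree_vec p) (ree_vec r) (ree_vec s)"
    unfolding similitude_def by blast
  show ?thesis
    unfolding similitude_def
    by (rule exI[of _ "\<lambda>p. c (h p) * d p"]) (use c d assms(3,4) in auto)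
qed

lemma similitude_inverse:
  assumes "similitude g" "\<And>p. p \<in> V \<Longrightarrow> h p \<in> V" "\<And>p. p \<in> V \<Longrightarrow> g (h p) = p"
  shows "similitude h"
proof -
  from assms(1) obtain c where c: "\<forall>p\<in>V. c p \<noteq> 0"
     "\<forall>p\<in>V. \<forall>r\<in>V. bil (ree_vec (g p)) (ree_vec (g r)) = c p * c r * bil (ree_vec p) (ree_vec r)"
     "\<forall>p\<in>V. \<forall>r\<in>V. \<forall>s\<in>V. tri (ree_vec (g p)) (ree_vec (g r)) (ree_vec (g s)) =
         c p * c r * c s * tri (ree_vec p) (ree_vec r) (ree_vec s)"
    unfolding similitude_def by blast
  have "bil (ree_vec p) (ree_vec r) = c (h p) * c (h r) * bil (ree_vec (h p)) (ree_vec (h r))"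
    if "p \<in> V" "r \<in> V" for p r
    using c(2)[rule_format, of "h p" "h r"] assms(2,3) that by simp
  moreover have "tri (ree_vec p) (ree_vec r) (ree_vec s) =
      c (h p) * c (h r) * c (h s) * tri (ree_vec (h p)) (ree_vec (h r)) (ree_vec (h s))"
    if "p \<in> V" "r \<in> V" "s \<in> V" for p r s
    using c(3)[rule_format, of "h p" "h r" "h s"] assms(2,3) that by simp
  ultimately show ?thesis
    unfolding similitude_def
    by (intro exI[of _ "\<lambda>p. 1 / c (h p)"]) (use c(1) assms(2) in auto)
qed

lemma vec_shear1_pt:
  assumes "i < 7"
  shows "ree_vec (ree_t e u 0 0 (pt a b c)) i = shear1 u (ree_vec (pt a b c)) i"
  using assms unfolding less_7_cases
  apply (elim disjE; hypsubst; simp only: t_pt ree_vec_pt shear1_def list_nth_simps)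
  subgoal by (simp add: ree_lambda1_def ree_lambda2_def ree_lambda3_def Let_def algebra_simps power_numeral_reduce)
  subgoal by (simp add: ree_lambda1_def ree_lambda2_def ree_lambda3_def Let_def algebra_simps power_numeral_reduce)
  subgoal by (simp add: ree_lambda1_def ree_lambda2_def ree_lambda3_def Let_def algebra_simps power_numeral_reduce)
  subgoal by (simp add: ree_lambda1_def ree_lambda2_def ree_lambda3_def Let_def algebra_simps power_numeral_reduce)
  subgoal by (rule eq_mod_3[where Q = "u * a * b - u * a^2 * (\<sigma> a) + u^2 * b - u^2 * a * (\<sigma> a)"])
      (simp add: ree_lambda1_def ree_lambda2_def ree_lambda3_def Let_def algebra_simps power_numeral_reduce)
  subgoal by (rule eq_mod_3[where Q = "(\<sigma> u) * (\<sigma> b) + a^2 * b * (\<sigma> u) - a^3 * (\<sigma> u) * (\<sigma> a) - u * a^2 * (\<sigma> a)^2 - 2 * u * a^2 * (\<sigma> u) * (\<sigma> a) - u * a^2 * (\<sigma> u)^2 - u^2 * a * (\<sigma> a)^2 - 2 * u^2 * a * (\<sigma> u) * (\<sigma> a) - u^2 * a * (\<sigma> u)^2"])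
      (simp add: ree_lambda1_def ree_lambda2_def ree_lambda3_def Let_def algebra_simps power_numeral_reduce)
  subgoal by (rule eq_mod_3[where Q = "- (a * (\<sigma> u) * (\<sigma> b)) + a^3 * b * (\<sigma> u) + a^4 * (\<sigma> u) * (\<sigma> a) + a^4 * (\<sigma> u)^2 - u * (\<sigma> u) * (\<sigma> b) + u * b * c + u * a * c * (\<sigma> u) + u * a * b^2 + u * a^2 * b * (\<sigma> a) + 2 * u * a^2 * b * (\<sigma> u) + u * a^3 * (\<sigma> a)^2 + 4 * u * a^3 * (\<sigma> u) * (\<sigma> a) + 3 * u * a^3 * (\<sigma> u)^2 + u^2 * a * b * (\<sigma> a) + u^2 * a * b * (\<sigma> u) + 2 * u^2 * a^2 * (\<sigma> a)^2 + 5 * u^2 * a^2 * (\<sigma> u) * (\<sigma> a) + 3 * u^2 * a^2 * (\<sigma> u)^2 + u^3 * a * (\<sigma> a)^2 + 2 * u^3 * a * (\<sigma> u) * (\<sigma> a) + 2 * u^3 * a * (\<sigma> u)^2"])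
      (simp add: ree_lambda1_def ree_lambda2_def ree_lambda3_def Let_def algebra_simps power_numeral_reduce)
  done

lemma vec_shear2_pt:
  assumes "i < 7"
  shows "ree_vec (ree_t e 0 u 0 (pt a b c)) i = shear2 u (ree_vec (pt a b c)) i"
  using assms unfolding less_7_cases
  apply (elim disjE; hypsubst; simp only: t_pt ree_vec_pt shear2_def list_nth_simps)
  subgoal by (simp add: ree_lambda1_def ree_lambda2_def ree_lambda3_def Let_def algebra_simps power_numeral_reduce)
  subgoal by (simp add: ree_lambda1_def ree_lambda2_def ree_lambda3_def Let_def algebra_simps power_numeral_reduce)
  subgoal by (simp add: ree_lambda1_def ree_lambda2_def ree_lambda3_def Let_def algebra_simps power_numeral_reduce)
  subgoal by (simp add: ree_lambda1_def ree_lambda2_def ree_lambda3_def Let_def algebra_simps power_numeral_reduce)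
  subgoal by (simp add: ree_lambda1_def ree_lambda2_def ree_lambda3_def Let_def algebra_simps power_numeral_reduce)
  subgoal by (rule eq_mod_3[where Q = "u * a * b + u^2 * a"])
      (simp add: ree_lambda1_def ree_lambda2_def ree_lambda3_def Let_def algebra_simps power_numeral_reduce)
  subgoal by (rule eq_mod_3[where Q = "- (u * a * c) + u * a^2 * b"])
      (simp add: ree_lambda1_def ree_lambda2_def ree_lambda3_def Let_def algebra_simps power_numeral_reduce)
  done

lemma vec_shear3_pt:
  assumes "i < 7"
  shows "ree_vec (ree_t e 0 0 u (pt a b c)) i = shear3 u (ree_vec (pt a b c)) i"
  using assms unfolding less_7_cases
  apply (elim disjE; hypsubst; simp only: t_pt ree_vec_pt shear3_def list_nth_simps)
  subgoal by (simp add: ree_lambda1_def ree_lambda2_def ree_lambda3_def Let_def algebra_simps power_numeral_reduce)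
  subgoal by (simp add: ree_lambda1_def ree_lambda2_def ree_lambda3_def Let_def algebra_simps power_numeral_reduce)
  subgoal by (simp add: ree_lambda1_def ree_lambda2_def ree_lambda3_def Let_def algebra_simps power_numeral_reduce)
  subgoal by (simp add: ree_lambda1_def ree_lambda2_def ree_lambda3_def Let_def algebra_simps power_numeral_reduce)
  subgoal by (simp add: ree_lambda1_def ree_lambda2_def ree_lambda3_def Let_def algebra_simps power_numeral_reduce)
  subgoal by (simp add: ree_lambda1_def ree_lambda2_def ree_lambda3_def Let_def algebra_simps power_numeral_reduce)
  subgoal by (rule eq_mod_3[where Q = "- (u * c)"])
      (simp add: ree_lambda1_def ree_lambda2_def ree_lambda3_def Let_def algebra_simps power_numeral_reduce)
  done

lemma similitude_shears:
  "similitude (ree_t e u 0 0)" "similitude (ree_t e 0 u 0)" "similitude (ree_t e 0 0 u)"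
proof -
  have "i < 7 \<Longrightarrow> ree_vec Infinity i = shear1 u (ree_vec Infinity) i"
     "i < 7 \<Longrightarrow> ree_vec Infinity i = shear2 u (ree_vec Infinity) i"
     "i < 7 \<Longrightarrow> ree_vec Infinity i = shear3 u (ree_vec Infinity) i" for i
    unfolding less_7_cases by (auto simp: shear1_def shear2_def shear3_def)
  then have "p \<in> V \<Longrightarrow> i < 7 \<Longrightarrow> ree_vec (ree_t e u 0 0 p) i = shear1 u (ree_vec p) i"
      "p \<in> V \<Longrightarrow> i < 7 \<Longrightarrow> ree_vec (ree_t e 0 u 0 p) i = shear2 u (ree_vec p) i"
      "p \<in> V \<Longrightarrow> i < 7 \<Longrightarrow> ree_vec (ree_t e 0 0 u p) i = shear3 u (ree_vec p) i" for p i
    by (metis V_cases t_Infinity vec_shear1_pt vec_shear2_pt vec_shear3_pt)+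
  then show "similitude (ree_t e u 0 0)" "similitude (ree_t e 0 u 0)" "similitude (ree_t e 0 0 u)"
    by - (rule similitudeI[where c = "\<lambda>_. 1" and m = 1 and M = "shear1 u"]
               similitudeI[where c = "\<lambda>_. 1" and m = 1 and M = "shear2 u"]
               similitudeI[where c = "\<lambda>_. 1" and m = 1 and M = "shear3 u"];
          simp add: bil_shear1 bil_shear2 bil_shear3 tri_shear)+
qed

lemma t_in_V [simp]: "p \<in> V \<Longrightarrow> ree_t e \<alpha> \<beta> \<gamma> p \<in> V"
  by (auto elim!: V_cases)

lemma n_in_V [simp]: "p \<in> V \<Longrightarrow> ree_n e \<kappa> p \<in> V"
  by (auto elim!: V_cases)

lemma w_in_V [simp]: "p \<in> V \<Longrightarrow> ree_w e p \<in> V"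
  by (rule w_vec)

lemma similitude_t: "similitude (ree_t e \<alpha> \<beta> \<gamma>)"
proof (rule similitude_compose[OF similitude_shears(3)[of "\<gamma> - \<alpha> * \<beta>"]])
  show "similitude (ree_t e 0 \<beta> 0 \<circ> ree_t e \<alpha> 0 0)"
    by (rule similitude_compose[OF similitude_shears(2) similitude_shears(1)]) simp_all
  fix p :: "'a ree_point" assume "p \<in> V"
  then show "ree_t e \<alpha> \<beta> \<gamma> p = ree_t e 0 0 (\<gamma> - \<alpha> * \<beta>) ((ree_t e 0 \<beta> 0 \<circ> ree_t e \<alpha> 0 0) p)"
    by (cases p rule: V_cases) (simp_all add: algebra_simps)
qed simp

text \<open>
  Reversal preserves \<open>bil\<close> and negates \<open>tri\<close>, so \<open>w\<close> is induced by the negative of a reversal.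
\<close>

lemma similitude_w: "similitude (ree_w e)"
proof -
  have "\<forall>p\<in>V. \<exists>k. k \<noteq> 0 \<and> (\<forall>i<7. ree_vec (ree_w e p) i = - k * ree_vec p (6 - i))"
    using w_vec(2) by (metis add.inverse_inverse neg_equal_0_iff_equal)
  then obtain k where k: "\<forall>p\<in>V. k p \<noteq> 0 \<and> (\<forall>i<7. ree_vec (ree_w e p) i = - k p * ree_vec p (6 - i))"
    by metis
  show ?thesis
  proof (rule similitudeI[where c = k and m = 1 and M = "\<lambda>x i. (- 1) * x (6 - i)"])
    show "bil (\<lambda>i. (- 1) * x (6 - i)) (\<lambda>i. (- 1) * y (6 - i)) = 1^2 * bil x y" for x y
      by (simp only: bil_scale bil_reverse) simp
    show "tri (\<lambda>i. (- 1) * x (6 - i)) (\<lambda>i. (- 1) * y (6 - i)) (\<lambda>i. (- 1) * z (6 - i)) = 1^3 * tri x y z" for x y z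
      by (simp only: tri_scale tri_reverse) simp
  qed (use k in auto)
qed

lemma similitude_n:
  assumes "\<kappa> \<noteq> 0"
  shows "similitude (ree_n e \<kappa>)"
proof -
  define d where "d i = [1, \<kappa>, \<sigma> \<kappa> * \<kappa>, \<sigma> \<kappa> * \<kappa>^2, \<sigma> \<kappa> * \<kappa>^3, (\<sigma> \<kappa>)^2 * \<kappa>^3, (\<sigma> \<kappa>)^2 * \<kappa>^4] ! i" for i
  show ?thesis
  proof (rule similitudeI[where M = "\<lambda>x i. d i * x i" and m = "\<sigma> \<kappa> * \<kappa>^2" and
        c = "\<lambda>p. if p = Infinity then 1 / d 6 else 1"])
    show bil: "bil (\<lambda>i. d i * x i) (\<lambda>i. d i * y i) = (\<sigma> \<kappa> * \<kappa>^2)^2 * bil x y" for x y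
      by (simp add: bil_def d_def algebra_simps power_numeral_reduce)
    show "tri (\<lambda>i. d i * x i) (\<lambda>i. d i * y i) (\<lambda>i. d i * z i) = (\<sigma> \<kappa> * \<kappa>^2)^3 * tri x y z" for x y z
    proof -
      have "cross (\<lambda>i. d i * x i) (\<lambda>i. d i * y i) i = (\<sigma> \<kappa> * \<kappa>^2) * (d i * cross x y i)" if "i < 7" for i
        using that unfolding less_7_cases
        by (elim disjE; simp add: cross_def pluecker_def d_def algebra_simps power_numeral_reduce)
      then have "tri (\<lambda>i. d i * x i) (\<lambda>i. d i * y i) (\<lambda>i. d i * z i)
          = bil (\<lambda>i. (\<sigma> \<kappa> * \<kappa>^2) * (d i * cross x y i)) (\<lambda>i. 1 * (d i * z i))"
        unfolding tri_def by (intro bil_cong) simp_all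
      then show ?thesis
        by (simp only: bil_scale bil tri_def) (simp add: power3_eq_cube power2_eq_square)
    qed
    fix p :: "'a ree_point" and i :: nat assume "p \<in> V" "i < 7"
    then show "ree_vec (ree_n e \<kappa> p) i = (if p = Infinity then 1 / d 6 else 1) * (d i * ree_vec p i)"
    proof (cases p rule: V_cases)
      case 1
      then show ?thesis using \<open>i < 7\<close> assms unfolding less_7_cases by (elim disjE) (simp_all add: d_def)
    next
      case (2 a b c)
      have "ree_vec (ree_n e \<kappa> p) i = d i * ree_vec p i"
        using \<open>i < 7\<close> unfolding less_7_cases 2
        by (elim disjE; simp add: d_def ree_lambda1_def ree_lambda2_def ree_lambda3_def Let_def
              algebra_simps power_numeral_reduce)
      then show ?thesis by (simp add: 2)
    qed
  qed (use assms in \<open>auto simp: d_def\<close>)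
qed

section \<open>The stabilizer of two points\<close>

text \<open>
  The forms with one or two arguments at the two fixed points show that all affine points have the
  same factor \<open>k\<close>, that \<open>\<eta>\<^sub>3\<close> is multiplied by \<open>k\<close>, and that the \<open>2 \<times> 2\<close> determinants in \<open>(\<eta>\<^sub>1, \<eta>\<^sub>2)\<close> and in
  \<open>(\<lambda>\<^sub>1, \<lambda>\<^sub>2)\<close> are preserved up to scalars. So the affine points with \<open>\<eta>\<^sub>1 = \<eta>\<^sub>2 = 0\<close> are permuted, and
  evaluating the forms there and at \<open>(0, 1, 0)\<close> makes the map diagonal. That \<open>\<lambda>\<^sub>1\<close> is not homogeneous
  relates the diagonal entries to each other.
\<close>

lemma similitude_fixing_Infinity_zero:
  assumes sim: "similitude g" and gV: "\<And>p. p \<in> V \<Longrightarrow> g p \<in> V" and inj: "inj_on g V"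
    and inf: "g Infinity = Infinity" and zero: "g (pt 0 0 0) = pt 0 0 0"
  shows "\<exists>\<kappa>. \<kappa> \<noteq> 0 \<and> (\<forall>p\<in>V. g p = ree_n e \<kappa> p)"
proof -
  from sim obtain c where c0: "\<And>p. p \<in> V \<Longrightarrow> c p \<noteq> 0"
    and cb: "\<And>p r. p \<in> V \<Longrightarrow> r \<in> V \<Longrightarrow>
      bil (ree_vec (g p)) (ree_vec (g r)) = c p * c r * bil (ree_vec p) (ree_vec r)"
    and ct: "\<And>p r s. p \<in> V \<Longrightarrow> r \<in> V \<Longrightarrow> s \<in> V \<Longrightarrow> tri (ree_vec (g p)) (ree_vec (g r)) (ree_vec (g s)) =
         c p * c r * c s * tri (ree_vec p) (ree_vec r) (ree_vec s)"
    unfolding similitude_def by blast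
  have "\<forall>a b d. \<exists>a' b' d'. g (pt a b d) = pt a' b' d'"
    using inj inf gV by (metis V_cases Infinity_in_V pt_in_V pt_neq_Infinity(1) inj_on_eq_iff)
  then obtain g1 g2 g3 where g: "\<And>a b d. g (pt a b d) = pt (g1 a b d) (g2 a b d) (g3 a b d)"
    by metis
  define k where "k = c (pt 0 0 0)"
  have k0: "k \<noteq> 0" unfolding k_def by (rule c0) simp
  let ?l1 = "ree_lambda1 e" and ?l2 = "ree_lambda2 e"
  define h1 where "h1 a b d = ?l1 (g1 a b d) (g2 a b d) (g3 a b d)" for a b d
  define h2 where "h2 a b d = ?l2 (g1 a b d) (g2 a b d) (g3 a b d)" for a b d
  define h3 where "h3 a b d = N (g1 a b d) (g2 a b d) (g3 a b d)" for a b d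
  note defs = bil_def tri_def cross_def pluecker_def g inf zero h1_def[symmetric] h2_def[symmetric] h3_def[symmetric]
  have l0: "?l1 0 0 0 = (0::'a)" "?l2 0 0 0 = (0::'a)" "N 0 0 0 = 0"
    by (simp_all add: ree_lambda1_def ree_lambda2_def ree_lambda3_def Let_def)
  have g000: "g1 0 0 0 = 0" "g2 0 0 0 = 0" "g3 0 0 0 = 0"
    using g[of 0 0 0] zero by simp_all
  have h000: "h1 0 0 0 = 0" "h2 0 0 0 = 0" "h3 0 0 0 = 0"
    by (simp_all add: h1_def h2_def h3_def g000 l0)
  note l0 = l0 g000 h000
  have cc: "c Infinity * c (pt a b d) = 1" for a b d
    using cb[of Infinity "pt a b d"] by (simp add: defs)
  then have cpt: "c (pt a b d) = k" for a b d
    unfolding k_def by (metis mult_cancel_left mult_zero_left zero_neq_one)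
  have cinf: "c Infinity * k = 1"
    using cc cpt by metis
  have g3: "g3 a b d = k * d" for a b d
    using ct[of Infinity "pt 0 0 0" "pt a b d"] by (simp add: defs l0 cpt cinf)
  have h3: "h3 a b d = k^2 * N a b d" for a b d
    using cb[of "pt 0 0 0" "pt a b d"] by (simp add: defs l0 cpt power2_eq_square)
  \<comment> \<open>\<open>tri\<close> with one argument at infinity, after removal of the terms in \<open>\<eta>\<^sub>3\<close>\<close>
  have D12: "g1 a b d * g2 a' b' d' - g1 a' b' d' * g2 a b d = k * (a * b' - a' * b)" for a b d a' b' d'
    using ct[of Infinity "pt a b d" "pt a' b' d'"]
    by (simp add: defs l0 cpt cinf g3) (simp add: algebra_simps)
  \<comment> \<open>\<open>tri\<close> with one argument at the origin, after removal of the terms in \<open>\<eta>\<^sub>3\<close> and \<open>\<lambda>\<^sub>3\<close>\<close>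
  have D45: "h1 a b d * h2 a' b' d' - h1 a' b' d' * h2 a b d
      = k^3 * (?l1 a b d * ?l2 a' b' d' - ?l1 a' b' d' * ?l2 a b d)" for a b d a' b' d'
    using ct[of "pt 0 0 0" "pt a b d" "pt a' b' d'"]
    by (simp add: defs l0 cpt) (simp add: g3 h3 algebra_simps power3_eq_cube power2_eq_square)
  have B: "g1 a b d * h2 a' b' d' + h2 a b d * g1 a' b' d' + g2 a b d * h1 a' b' d' + h1 a b d * g2 a' b' d'
     = k^2 * (a * ?l2 a' b' d' + ?l2 a b d * a' + b * ?l1 a' b' d' + ?l1 a b d * b')" for a b d a' b' d'
    using cb[of "pt a b d" "pt a' b' d'"]
    by (simp add: defs l0 cpt) (simp add: g3 h3 algebra_simps power2_eq_square)
  note lambda_formulas = ree_lambda1_def ree_lambda2_def ree_lambda3_def Let_def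
  have l001: "?l1 0 0 1 = (0::'a)" "?l2 0 0 1 = (- 1::'a)" and l010: "?l1 0 1 0 = (1::'a)" "?l2 0 1 0 = (0::'a)"
    and l100: "?l1 1 0 0 = (- 1::'a)"
    by (simp_all add: lambda_formulas)
  \<comment> \<open>the determinants with two independent vectors vanish, so the vector vanishes\<close>
  have centre: "g1 0 0 d = 0 \<and> g2 0 0 d = 0" for d
  proof -
    let ?x = "g1 0 0 d" and ?y = "g2 0 0 d"
    have 1: "?x * g2 1 0 0 = g1 1 0 0 * ?y" "?x * g2 0 1 0 = g1 0 1 0 * ?y"
      using D12[of 0 0 d 1 0 0] D12[of 0 0 d 0 1 0] by simp_all
    have 2: "g1 1 0 0 * g2 0 1 0 - g1 0 1 0 * g2 1 0 0 = k"
      using D12[of 1 0 0 0 1 0] by simp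
    have "?x * k = g1 1 0 0 * (?x * g2 0 1 0) - g1 0 1 0 * (?x * g2 1 0 0)"
      by (simp add: 2[symmetric] algebra_simps)
    also have "\<dots> = 0" by (simp add: 1 algebra_simps)
    finally have x: "?x = 0" using k0 by simp
    have "?y * k = (g1 1 0 0 * ?y) * g2 0 1 0 - (g1 0 1 0 * ?y) * g2 1 0 0"
      by (simp add: 2[symmetric] algebra_simps)
    also have "\<dots> = 0" by (simp add: 1[symmetric] x)
    finally show ?thesis using x k0 by simp
  qed
  have h001: "h1 0 0 1 = 0" "h2 0 0 1 = - \<sigma> k"
    by (simp_all add: h1_def h2_def centre g3 lambda_formulas)
  define \<kappa> where "\<kappa> = k^2 / \<sigma> k"
  have \<kappa>0: "\<kappa> \<noteq> 0" and \<sigma>k: "\<sigma> k \<noteq> 0"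
    using k0 by (simp_all add: \<kappa>_def)
  have g1: "g1 a b d = \<kappa> * a" for a b d
    using B[of a b d 0 0 1] \<sigma>k by (simp add: l001 h001 centre \<kappa>_def field_simps)
  have h1: "h1 a b d = k * \<kappa> * ?l1 a b d" for a b d
    using D45[of a b d 0 0 1] \<sigma>k
    by (simp add: l001 h001 \<kappa>_def field_simps power3_eq_cube power2_eq_square)
  define \<delta> where "\<delta> = g2 0 1 0"
  have h010: "h1 0 1 0 = \<sigma> \<delta>" "h2 0 1 0 = 0"
    by (simp_all add: h1_def h2_def g1 g3 lambda_formulas \<delta>_def)
  have \<sigma>\<delta>: "\<sigma> \<delta> = k * \<kappa>"
    using h1[of 0 1 0] by (simp add: h010 l010)
  have "2 * (\<delta> * \<sigma> \<delta>) = 2 * k^2"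
    using B[of 0 1 0 0 1 0] by (simp add: h010 l010 g1 \<delta>_def[symmetric] algebra_simps)
  then have "\<delta> * (k * \<kappa>) = k * k"
    by (simp add: two \<sigma>\<delta> power2_eq_square)
  then have \<delta>: "\<delta> * \<kappa> = k"
    using k0 by (simp add: algebra_simps)
  have g2: "g2 a b d * \<kappa> = k * b" for a b d
  proof -
    have "g2 a b d * (k * \<kappa>) + k * (\<delta> * \<kappa>) * ?l1 a b d = k^2 * b + k^2 * ?l1 a b d"
      using B[of a b d 0 1 0]
      by (simp add: h010 l010 g1 h1 \<delta>_def[symmetric] \<sigma>\<delta> algebra_simps)
    then have "k * (g2 a b d * \<kappa>) = k * (k * b)"
      by (simp add: \<delta> power2_eq_square algebra_simps)
    then show ?thesis using k0 by simp
  qed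
  have "g2 1 0 0 = 0" using g2[of 1 0 0] \<kappa>0 by simp
  then have "h1 1 0 0 = - (\<sigma> \<kappa> * \<kappa>^3)"
    by (simp add: h1_def g1 g3 lambda_formulas)
  then have "k * \<kappa> = (\<sigma> \<kappa> * \<kappa>^2) * \<kappa>"
    by (simp add: h1 l100 power3_eq_cube power2_eq_square)
  then have k: "k = \<sigma> \<kappa> * \<kappa>^2" using \<kappa>0 by simp
  have "g2 a b d = \<sigma> \<kappa> * \<kappa> * b" for a b d
    using g2[of a b d] \<kappa>0 by (simp add: k power2_eq_square)
  then have "\<forall>p\<in>V. g p = ree_n e \<kappa> p"
    by (auto elim!: V_cases simp: inf g g1 g3 k)
  with \<kappa>0 show ?thesis by blast
qed

section \<open>The Ree group\<close>

abbreviation R :: "('a ree_point \<Rightarrow> 'a ree_point) set" where "R \<equiv> carrier (ree_group e)"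

lemma V_eq: "V = insert Infinity ((\<lambda>(a, b, c). pt a b c) ` UNIV)"
  by (auto simp: ree_points_def image_iff)

lemma finite_V: "finite V"
  by (simp add: V_eq)

lemma card_V: "card V = q ^ 3 + 1"
proof -
  have "inj (\<lambda>(a, b, c). pt a b c)"
    by (auto simp: inj_on_def)
  then have "card (range (\<lambda>(a, b, c). pt a b c)) = card (UNIV :: ('a \<times> 'a \<times> 'a) set)"
    by (rule card_image)
  also have "\<dots> = q ^ 3"
    by (simp only: UNIV_Times_UNIV[symmetric] card_cartesian_product card_field power3_eq_cube mult.assoc)
  finally show ?thesis
    unfolding V_eq by (subst card_insert_disjoint) auto
qed

lemma BijI_V:
  assumes "g \<in> extensional V" "\<And>p. p \<in> V \<Longrightarrow> g p \<in> V" "\<And>p. p \<in> V \<Longrightarrow> h (g p) = p"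
  shows "g \<in> Bij V"
proof -
  have "inj_on g V" using assms(3) by (rule inj_on_inverseI)
  then have "bij_betw g V V"
    using endo_inj_surj[OF finite_V] assms(2) by (metis bij_betw_def image_subsetI)
  with assms(1) show ?thesis by (simp add: Bij_def)
qed

lemma t_t:
  assumes "p \<in> V"
  shows "ree_t e \<alpha>' \<beta>' \<gamma>' (ree_t e \<alpha> \<beta> \<gamma> p) =
    ree_t e (\<alpha> + \<alpha>') (\<beta> + \<beta>' + \<sigma> \<alpha>' * \<alpha>) (\<gamma> + \<gamma>' - \<alpha>' * \<beta> + \<beta>' * \<alpha> - \<sigma> \<alpha>' * \<alpha>' * \<alpha>) p"
  using assms by (cases p rule: V_cases) (simp_all add: algebra_simps)

lemma t_0 [simp]: "p \<in> V \<Longrightarrow> ree_t e 0 0 0 p = p"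
  by (auto elim!: V_cases)

lemma t_inverse [simp]:
  assumes "p \<in> V"
  shows "ree_t e (- \<alpha>) (\<sigma> \<alpha> * \<alpha> - \<beta>) (- \<gamma>) (ree_t e \<alpha> \<beta> \<gamma> p) = p"
  using assms by (simp add: t_t algebra_simps)

lemma t_Bij: "ree_t e \<alpha> \<beta> \<gamma> \<in> Bij V"
  by (rule BijI_V[where h = "ree_t e (- \<alpha>) (\<sigma> \<alpha> * \<alpha> - \<beta>) (- \<gamma>)"]) (simp_all, simp add: ree_t_def)

lemma n_n [simp]: "p \<in> V \<Longrightarrow> \<kappa> \<noteq> 0 \<Longrightarrow> ree_n e (1 / \<kappa>) (ree_n e \<kappa> p) = p"
  by (auto elim!: V_cases simp: power2_eq_square)

lemma n_Bij: "\<kappa> \<noteq> 0 \<Longrightarrow> ree_n e \<kappa> \<in> Bij V"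
  by (rule BijI_V[where h = "ree_n e (1 / \<kappa>)"]) (simp_all, simp add: ree_n_def)

lemma w_Bij: "ree_w e \<in> Bij V"
  by (rule BijI_V[where h = "ree_w e"]) (simp_all, simp add: ree_w_def)

lemma ree_generators_subset_Bij:
  "{ree_w e} \<union> {ree_t e \<alpha> \<beta> \<gamma> | \<alpha> \<beta> \<gamma>. True} \<union> {ree_n e \<kappa> | \<kappa>. \<kappa> \<noteq> 0} \<subseteq> Bij V"
  using t_Bij n_Bij w_Bij by auto

lemma R_eq: "R = generate (BijGroup V)
     ({ree_w e} \<union> {ree_t e \<alpha> \<beta> \<gamma> | \<alpha> \<beta> \<gamma>. True} \<union> {ree_n e \<kappa> | \<kappa>. \<kappa> \<noteq> 0})"
  by (simp add: ree_group_def perm_group_generated_def)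

lemma R_subgroup: "subgroup R (BijGroup V)"
  unfolding R_eq by (rule subgroup_generate_BijGroup[OF ree_generators_subset_Bij])

lemma t_in_R [simp]: "ree_t e \<alpha> \<beta> \<gamma> \<in> R"
  and n_in_R [simp]: "\<kappa> \<noteq> 0 \<Longrightarrow> ree_n e \<kappa> \<in> R"
  and w_in_R [simp]: "ree_w e \<in> R"
  unfolding R_eq by (rule generate.incl; blast)+

lemmas R_compose = subgroup_BijGroup_compose[OF R_subgroup]
  and R_Bij = subgroup_BijGroup_Bij[OF R_subgroup]
  and R_in_V = subgroup_BijGroup_in[OF R_subgroup]
  and R_inverse = subgroup_BijGroup_inverse[OF R_subgroup]
  and R_id = subgroup_BijGroup_id[OF R_subgroup]

lemma R_inj: "g \<in> R \<Longrightarrow> inj_on g V"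
  using R_Bij by (auto simp: Bij_def bij_betw_def)

lemma R_similitude:
  assumes "g \<in> R"
  shows "similitude g"
proof -
  let ?X = "{g \<in> Bij V. similitude g}"
  have "subgroup ?X (BijGroup V)"
  proof (rule subgroup_BijGroupI)
    have "similitude (\<lambda>x\<in>V. x)"
      by (rule similitude_compose[OF similitude_t[of 0 0 0] similitude_t[of 0 0 0]]) simp_all
    then show "(\<lambda>x\<in>V. x) \<in> ?X"
      by (simp add: id_Bij)
    show "compose V g h \<in> ?X" if "g \<in> ?X" "h \<in> ?X" for g h
    proof -
      from that have "h \<in> V \<rightarrow> V" by (simp add: Bij_imp_funcset)
      with that show ?thesis
        by (auto simp: compose_Bij compose_eq intro!: similitude_compose[of g h])
    qed
    show "h \<in> ?X" if "g \<in> ?X" "h \<in> Bij V" "\<And>x. x \<in> V \<Longrightarrow> g (h x) = x" for g h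
      using that Bij_imp_funcset[OF that(2)] by (auto intro!: similitude_inverse[of g h])
  qed auto
  moreover have "{ree_w e} \<union> {ree_t e \<alpha> \<beta> \<gamma> | \<alpha> \<beta> \<gamma>. True} \<union> {ree_n e \<kappa> | \<kappa>. \<kappa> \<noteq> 0} \<subseteq> ?X"
    using t_Bij n_Bij w_Bij similitude_t similitude_n similitude_w by auto
  ultimately have "R \<subseteq> ?X"
    unfolding R_eq by (rule generate_BijGroup_subset)
  with assms show ?thesis by auto
qed

text \<open>
  This is the Bruhat decomposition in disguise. A direct proof would express \<open>w t w\<close> in the form
  \<open>t w n t\<close>; invariance of the forms replaces that computation.
\<close>

lemma R_fixing_Infinity_zero:
  assumes "g \<in> R" "g Infinity = Infinity" "g (pt 0 0 0) = pt 0 0 0"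
  obtains \<kappa> where "\<kappa> \<noteq> 0" "g = ree_n e \<kappa>"
proof -
  obtain \<kappa> where \<kappa>: "\<kappa> \<noteq> 0" "\<forall>p\<in>V. g p = ree_n e \<kappa> p"
    using similitude_fixing_Infinity_zero[OF R_similitude[OF assms(1)] R_in_V[OF assms(1)]
        R_inj[OF assms(1)] assms(2,3)] by auto
  then have "g = ree_n e \<kappa>"
    by (intro Bij_eqI[OF R_Bij[OF assms(1)] n_Bij]) auto
  with \<kappa> that show thesis by blast
qed

text \<open>
  The group of all \<open>t\<close> is regular on the affine points.
\<close>

lemma R_fixing_Infinity:
  assumes "g \<in> R" "g Infinity = Infinity"
  obtains a b c \<kappa> where "\<kappa> \<noteq> 0" "g = compose V (ree_t e a b c) (ree_n e \<kappa>)"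
proof -
  have "g (pt 0 0 0) \<noteq> Infinity"
    using inj_onD[OF R_inj[OF assms(1)], of "pt 0 0 0" Infinity] assms(2) by auto
  then obtain a b c where abc: "g (pt 0 0 0) = pt a b c"
    using R_in_V[OF assms(1), of "pt 0 0 0"] by (auto elim: V_cases)
  let ?u = "ree_t e (- a) (\<sigma> a * a - b) (- c)"
  have u: "?u (pt a b c) = pt 0 0 0"
    using t_inverse[of "pt 0 0 0" a b c] by simp
  have "compose V ?u g Infinity = Infinity"
    using assms(2) by (simp add: compose_eq)
  moreover have "compose V ?u g (pt 0 0 0) = pt 0 0 0"
    using u by (simp only: compose_eq pt_in_V abc)
  ultimately obtain \<kappa> where \<kappa>: "\<kappa> \<noteq> 0" "compose V ?u g = ree_n e \<kappa>"
    using R_fixing_Infinity_zero[OF R_compose[OF t_in_R assms(1)]] by blast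
  have "g p = compose V (ree_t e a b c) (ree_n e \<kappa>) p" if p: "p \<in> V" for p
  proof -
    have "ree_n e \<kappa> p = ?u (g p)"
      using \<kappa>(2) p by (metis compose_eq)
    then show ?thesis
      using p R_in_V[OF assms(1) p] by (simp add: compose_eq t_t algebra_simps)
  qed
  then have "g = compose V (ree_t e a b c) (ree_n e \<kappa>)"
    using \<kappa>(1) by (intro Bij_eqI[OF R_Bij[OF assms(1)]]) (auto intro!: compose_Bij t_Bij n_Bij)
  with \<kappa>(1) that show thesis by blast
qed

lemma R_two_transitive:
  assumes "x \<in> V" "y \<in> V" "x \<noteq> y"
  obtains g where "g \<in> R" "g Infinity = x" "g (pt 0 0 0) = y"
proof -
  have "\<exists>g\<in>R. g Infinity = x"
    using assms(1)
  proof (cases x rule: V_cases)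
    case 1
    then show ?thesis by (intro bexI[of _ "ree_t e 0 0 0"]) auto
  next
    case (2 a b c)
    then show ?thesis
      by (intro bexI[OF _ R_compose[OF t_in_R[of a b c] w_in_R]]) (auto simp: compose_eq)
  qed
  then obtain g where g: "g \<in> R" "g Infinity = x" by blast
  obtain h where h: "h \<in> R" "\<And>x. x \<in> V \<Longrightarrow> h (g x) = x" "\<And>x. x \<in> V \<Longrightarrow> g (h x) = x"
    using R_inverse[OF g(1)] by blast
  have "h y \<noteq> Infinity"
    using h(3)[OF assms(2)] g(2) assms(3) by auto
  then obtain a b c where abc: "h y = pt a b c"
    using R_in_V[OF h(1) assms(2)] by (auto elim: V_cases)
  have "g (h y) = y" by (rule h(3)[OF assms(2)])
  then show thesis
    using that[OF R_compose[OF g(1) t_in_R[of a b c]]] g(2) abc by (simp add: compose_eq)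
qed

section \<open>Flags and centres of blocks\<close>

text \<open>
  The blocks with centre at infinity: the images of \<open>L0\<close> under the \<open>t\<close>. Their affine parts partition
  the affine points.
\<close>

definition centred_block :: "'a \<Rightarrow> 'a \<Rightarrow> 'a ree_point set" where
  "centred_block a b = insert Infinity {pt a b c | c. True}"

abbreviation L0 :: "'a ree_point set" where "L0 \<equiv> centred_block 0 0"

abbreviation \<Omega> :: "'a ree_point flag set" where
  "\<Omega> \<equiv> Group_Action.orbit (ree_group e) flag_act (Infinity, L0)"

lemma pt_in_centred_block [simp]: "pt a b c \<in> centred_block a' b' \<longleftrightarrow> a = a' \<and> b = b'"
  and Infinity_in_centred_block [simp]: "Infinity \<in> centred_block a b"
  and centred_block_subset_V: "centred_block a b \<subseteq> V"
  by (auto simp: centred_block_def)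

lemma centred_block_eq_iff: "centred_block a b = centred_block a' b' \<longleftrightarrow> a = a' \<and> b = b'"
  by (metis pt_in_centred_block)

lemma card_centred_block: "card (centred_block a b) = q + 1"
proof -
  have "{pt a b c | c. True} = range (pt a b)" by auto
  moreover have "inj (pt a b)" by (auto simp: inj_on_def)
  ultimately have "card {pt a b c | c. True} = q"
    by (simp add: card_image card_field)
  then show ?thesis
    unfolding centred_block_def by (subst card_insert_disjoint) (auto simp: full_SetCompr_eq)
qed

lemma n_image_L0:
  assumes "\<kappa> \<noteq> 0"
  shows "ree_n e \<kappa> ` L0 = L0"
proof
  show "ree_n e \<kappa> ` L0 \<subseteq> L0" by (auto simp: centred_block_def)
  show "L0 \<subseteq> ree_n e \<kappa> ` L0"
  proof
    fix p assume "p \<in> L0"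
    then consider "p = Infinity" | c where "p = pt 0 0 c" by (auto simp: centred_block_def)
    then show "p \<in> ree_n e \<kappa> ` L0"
    proof cases
      case (2 c)
      then show ?thesis using assms
        by (intro image_eqI[of _ _ "pt 0 0 (c / (\<sigma> \<kappa> * \<kappa>^2))"]) auto
    qed (auto intro: image_eqI[of _ _ Infinity])
  qed
qed

lemma t_image_L0: "ree_t e a b c ` L0 = centred_block a b"
proof
  show "ree_t e a b c ` L0 \<subseteq> centred_block a b" by (auto simp: centred_block_def)
  show "centred_block a b \<subseteq> ree_t e a b c ` L0"
  proof
    fix p assume "p \<in> centred_block a b"
    then consider "p = Infinity" | c' where "p = pt a b c'" by (auto simp: centred_block_def)
    then show "p \<in> ree_t e a b c ` L0"
    proof cases
      case (2 c')
      then show ?thesis by (intro image_eqI[of _ _ "pt 0 0 (c' - c)"]) auto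
    qed (auto intro: image_eqI[of _ _ Infinity])
  qed
qed

lemma compose_image: "A \<subseteq> S \<Longrightarrow> compose S g h ` A = g ` h ` A"
  by (force simp: compose_eq image_image subset_iff intro!: image_cong)

lemma \<Omega>_eq: "\<Omega> = {(g Infinity, g ` L0) | g. g \<in> R}"
  by (auto simp: Group_Action.orbit_def flag_act_def)

lemma flag_in_\<Omega>: "g \<in> R \<Longrightarrow> (g Infinity, g ` L0) \<in> \<Omega>"
  by (auto simp: \<Omega>_eq)

lemma L0_in_V: "L0 \<subseteq> V" by (rule centred_block_subset_V)

lemma \<Omega>_act:
  assumes "g \<in> R" "(x, M) \<in> \<Omega>"
  shows "(g x, g ` M) \<in> \<Omega>"
proof -
  from assms(2) obtain h where h: "h \<in> R" "x = h Infinity" "M = h ` L0"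
    by (auto simp: \<Omega>_eq)
  then show ?thesis
    using flag_in_\<Omega>[OF R_compose[OF assms(1) h(1)]] by (simp add: compose_eq compose_image L0_in_V)
qed

lemma \<Omega>_subset: "(x, M) \<in> \<Omega> \<Longrightarrow> x \<in> V \<and> M \<subseteq> V \<and> x \<in> M \<and> card M = q + 1 \<and> finite M"
proof -
  assume "(x, M) \<in> \<Omega>"
  then obtain h where h: "h \<in> R" "x = h Infinity" "M = h ` L0"
    by (auto simp: \<Omega>_eq)
  have "M \<subseteq> V" using h L0_in_V R_in_V by blast
  moreover have "card M = q + 1"
    using h card_image[OF inj_on_subset[OF R_inj[OF h(1)] L0_in_V]] card_centred_block by simp
  moreover have "finite M" using finite_subset[OF \<open>M \<subseteq> V\<close> finite_V] .
  ultimately show ?thesis using h R_in_V by auto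
qed

lemma \<Omega>_at_Infinity: "(Infinity, M) \<in> \<Omega> \<longleftrightarrow> (\<exists>a b. M = centred_block a b)"
proof
  assume "(Infinity, M) \<in> \<Omega>"
  then obtain h where h: "h \<in> R" "h Infinity = Infinity" "M = h ` L0"
    by (auto simp: \<Omega>_eq)
  obtain a b c \<kappa> where "\<kappa> \<noteq> 0" "h = compose V (ree_t e a b c) (ree_n e \<kappa>)"
    by (rule R_fixing_Infinity[OF h(1,2)])
  then have "M = centred_block a b"
    using h(3) by (simp add: compose_image L0_in_V n_image_L0 t_image_L0)
  then show "\<exists>a b. M = centred_block a b" by blast
next
  assume "\<exists>a b. M = centred_block a b"
  then obtain a b where "M = ree_t e a b 0 ` L0" by (auto simp: t_image_L0)
  then show "(Infinity, M) \<in> \<Omega>"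
    using flag_in_\<Omega>[OF t_in_R[of a b 0]] by simp
qed

text \<open>
  Transported by \<open>g\<close>, this says that \<open>L0\<close> is the only block with centre at infinity that contains the
  origin. By 2-transitivity, a block is therefore determined by its centre and one further point.
\<close>

lemma \<Omega>_through:
  assumes g: "g \<in> R"
  shows "(g Infinity, M) \<in> \<Omega> \<and> g (pt 0 0 0) \<in> M \<longleftrightarrow> M = g ` L0"
proof
  assume "M = g ` L0"
  with flag_in_\<Omega>[OF g] show "(g Infinity, M) \<in> \<Omega> \<and> g (pt 0 0 0) \<in> M" by simp
next
  assume *: "(g Infinity, M) \<in> \<Omega> \<and> g (pt 0 0 0) \<in> M"
  then have MV: "M \<subseteq> V" using \<Omega>_subset by blast
  obtain h where h: "h \<in> R" "\<And>x. x \<in> V \<Longrightarrow> h (g x) = x" "\<And>x. x \<in> V \<Longrightarrow> g (h x) = x"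
    using R_inverse[OF g] by blast
  have "(Infinity, h ` M) \<in> \<Omega>"
    using \<Omega>_act[OF h(1) conjunct1[OF *]] h(2) by simp
  moreover have "pt 0 0 0 \<in> h ` M"
    using conjunct2[OF *] h(2) by (metis image_eqI pt_in_V)
  ultimately have "h ` M = L0"
    unfolding \<Omega>_at_Infinity by (metis pt_in_centred_block)
  moreover have "g ` h ` M = M"
    using h(3) MV by (force simp: image_image)
  ultimately show "M = g ` L0" by simp
qed

text \<open>
  The first coordinate of this point does not vanish, so \<open>w\<close> does not fix \<open>L0\<close>.
\<close>

lemma w_pt_centre:
  assumes "c \<noteq> 0"
  shows "ree_w e (pt 0 0 c) = pt (\<sigma> c / c^2) 0 (- (1 / c))"
  using assms by (subst w_pt) (simp_all add: ree_lambda1_def ree_lambda2_def ree_lambda3_def Let_def power2_eq_square)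

lemma w_image_L0_neq: "ree_w e ` L0 \<noteq> L0"
proof
  assume "ree_w e ` L0 = L0"
  then have "ree_w e (pt 0 0 1) \<in> L0" by (metis image_eqI pt_in_centred_block)
  then show False by (simp add: w_pt_centre)
qed

text \<open>
  If a block had two centres, they could be moved to infinity and the origin, and the block would be
  \<open>L0\<close> as well as its image under \<open>w\<close>.
\<close>

lemma centre_unique:
  assumes "(x, M) \<in> \<Omega>" "(y, M) \<in> \<Omega>"
  shows "x = y"
proof (rule ccontr)
  assume "x \<noteq> y"
  have "x \<in> V" "y \<in> V" "x \<in> M" "y \<in> M" using assms \<Omega>_subset by auto
  then obtain g where g: "g \<in> R" "g Infinity = x" "g (pt 0 0 0) = y"
    using R_two_transitive \<open>x \<noteq> y\<close> by metis
  have gw: "compose V g (ree_w e) \<in> R" by (rule R_compose[OF g(1) w_in_R])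
  have 1: "M = g ` L0"
    using \<Omega>_through[OF g(1), of M] g assms(1) \<open>y \<in> M\<close> by simp
  have "M = compose V g (ree_w e) ` L0"
    using \<Omega>_through[OF gw, of M] g assms(2) \<open>x \<in> M\<close> by (simp add: compose_eq)
  then have "g ` ree_w e ` L0 = g ` L0"
    using 1 by (simp add: compose_image L0_in_V)
  moreover have "ree_w e ` L0 \<subseteq> V" using w_in_V L0_in_V by blast
  ultimately have "ree_w e ` L0 = L0"
    using R_inj[OF g(1)] L0_in_V by (meson inj_on_image_eq_iff)
  with w_image_L0_neq show False by contradiction
qed

section \<open>Arcs of the flag graph\<close>

abbreviation perm_group :: "('a ree_point \<Rightarrow> 'a ree_point) set \<Rightarrow> ('a ree_point \<Rightarrow> 'a ree_point) monoid" where
  "perm_group S \<equiv> (BijGroup V)\<lparr>carrier := S\<rparr>"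

abbreviation blocks :: "'a ree_point set set" where "blocks \<equiv> snd ` \<Omega>"

abbreviation \<D> :: "'a ree_point incidence" where "\<D> \<equiv> (V, blocks)"

lemma ree_group_eq: "ree_group e = perm_group R"
  by (simp add: ree_group_def perm_group_generated_def)

lemma image_inverse: "(\<And>x. x \<in> S \<Longrightarrow> h (g x) = x) \<Longrightarrow> A \<subseteq> S \<Longrightarrow> h ` g ` A = A"
  by (simp add: image_image subset_iff)

lemma q_ge_3: "q \<ge> 3"
  using self_le_power[of 3 "2 * e + 1"] by (simp add: q_def)

lemma orbit_perm_group: "Group_Action.orbit (perm_group S) \<phi> x = (\<lambda>g. \<phi> g x) ` S"
  by (auto simp: Group_Action.orbit_def)

lemma finite_\<Omega>: "finite \<Omega>"
proof (rule finite_subset)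
  show "\<Omega> \<subseteq> V \<times> Pow V" using \<Omega>_subset by fast
qed (simp add: finite_V)

lemma \<Omega>_unique:
  assumes "(x, M) \<in> \<Omega>" "(x, M') \<in> \<Omega>" "y \<in> M" "y \<in> M'" "y \<noteq> x"
  shows "M = M'"
proof -
  have "x \<in> V" "y \<in> V" using assms \<Omega>_subset by auto
  then obtain g where "g \<in> R" "g Infinity = x" "g (pt 0 0 0) = y"
    using R_two_transitive assms(5) by metis
  then show ?thesis using assms \<Omega>_through by metis
qed

lemma \<Omega>_exists:
  assumes "x \<in> V" "y \<in> V" "x \<noteq> y"
  obtains M where "(x, M) \<in> \<Omega>" "y \<in> M"
proof -
  obtain g where "g \<in> R" "g Infinity = x" "g (pt 0 0 0) = y"
    using R_two_transitive assms by metis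
  then show thesis using that \<Omega>_through by metis
qed

text \<open>
  An arc is determined by its two points, so 2-transitivity on points makes the arcs a single orbit.
\<close>

lemma arcs_iff:
  "((x, M), (y, M')) \<in> flag_arcs \<Omega> \<longleftrightarrow>
    (\<exists>g\<in>R. x = g Infinity \<and> y = g (pt 0 0 0) \<and> M = g ` L0 \<and> M' = g ` ree_w e ` L0)"
proof
  assume "((x, M), (y, M')) \<in> flag_arcs \<Omega>"
  then have *: "(x, M) \<in> \<Omega>" "(y, M') \<in> \<Omega>" "x \<noteq> y" "y \<in> M" "x \<in> M'"
    by (auto simp: flag_arcs_def)
  then obtain g where g: "g \<in> R" "g Infinity = x" "g (pt 0 0 0) = y"
    using R_two_transitive \<Omega>_subset by metis
  have gw: "compose V g (ree_w e) \<in> R" by (rule R_compose[OF g(1) w_in_R])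
  have 1: "M = g ` L0"
    using \<Omega>_through[OF g(1), of M] g * by simp
  have "M' = compose V g (ree_w e) ` L0"
    using \<Omega>_through[OF gw, of M'] g * by (simp add: compose_eq)
  then have "M' = g ` ree_w e ` L0"
    by (simp add: compose_image L0_in_V)
  with 1 g show "\<exists>g\<in>R. x = g Infinity \<and> y = g (pt 0 0 0) \<and> M = g ` L0 \<and> M' = g ` ree_w e ` L0"
    by blast
next
  assume "\<exists>g\<in>R. x = g Infinity \<and> y = g (pt 0 0 0) \<and> M = g ` L0 \<and> M' = g ` ree_w e ` L0"
  then obtain g where g: "g \<in> R" "x = g Infinity" "y = g (pt 0 0 0)" "M = g ` L0" "M' = g ` ree_w e ` L0"
    by blast
  have gw: "compose V g (ree_w e) \<in> R" by (rule R_compose[OF g(1) w_in_R])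
  have "M' = compose V g (ree_w e) ` L0"
    using g by (simp add: compose_image L0_in_V)
  then have "(y, M') \<in> \<Omega> \<and> x \<in> M'"
    using \<Omega>_through[OF gw, of M'] g by (simp add: compose_eq)
  moreover have "(x, M) \<in> \<Omega> \<and> y \<in> M"
    using \<Omega>_through[OF g(1), of M] g by simp
  moreover have "x \<noteq> y"
    using inj_onD[OF R_inj[OF g(1)], of Infinity "pt 0 0 0"] g by auto
  ultimately show "((x, M), (y, M')) \<in> flag_arcs \<Omega>"
    using \<Omega>_subset by (auto simp: flag_arcs_def)
qed

lemma arcs_converse: "(flag_arcs \<Omega>)\<inverse> = flag_arcs \<Omega>"
  by (auto simp: flag_arcs_def)

lemma flag_act_compose:
  "x \<in> V \<Longrightarrow> M \<subseteq> V \<Longrightarrow> flag_act (compose V g h) (x, M) = flag_act g (flag_act h (x, M))"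
  by (simp add: flag_act_def compose_eq compose_image)

lemma flag_act_inverse:
  assumes "\<And>x. x \<in> V \<Longrightarrow> h (g x) = x" "f \<in> \<Omega>"
  shows "flag_act h (flag_act g f) = f"
proof -
  obtain x M where f: "f = (x, M)" by fastforce
  with assms(2) have "(x, M) \<in> \<Omega>" by (simp only:)
  then have "x \<in> V" "M \<subseteq> V" using \<Omega>_subset by blast+
  with assms(1) show ?thesis by (simp add: f flag_act_def image_inverse[of V h g])
qed

lemma base_flag: "(Infinity, L0) \<in> \<Omega>"
  unfolding \<Omega>_at_Infinity by blast

lemma \<Omega>_rep: "f \<in> \<Omega> \<Longrightarrow> \<exists>g\<in>R. f = flag_act g (Infinity, L0)"
  unfolding Group_Action.orbit_def by auto

lemma R_flag_transitive:
  assumes "f \<in> \<Omega>" "f' \<in> \<Omega>"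
  obtains g where "g \<in> R" "flag_act g f = f'"
proof -
  let ?f0 = "(Infinity, L0)"
  obtain h where h: "h \<in> R" "f = flag_act h ?f0" using \<Omega>_rep[OF assms(1)] by blast
  obtain k where k: "k \<in> R" "f' = flag_act k ?f0" using \<Omega>_rep[OF assms(2)] by blast
  obtain h' where h': "h' \<in> R" "\<And>x. x \<in> V \<Longrightarrow> h' (h x) = x" "\<And>x. x \<in> V \<Longrightarrow> h (h' x) = x"
    using R_inverse[OF h(1)] by blast
  have "flag_act h' f = ?f0"
    unfolding h(2) by (rule flag_act_inverse[of h' h, OF h'(2) base_flag])
  moreover have "flag_act (compose V k h') f = flag_act k (flag_act h' f)"
  proof (cases f)
    case (Pair x M)
    then have "(x, M) \<in> \<Omega>" using assms(1) by (simp only:)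
    from \<Omega>_subset[OF this] show ?thesis unfolding Pair by (intro flag_act_compose) blast+
  qed
  ultimately have "flag_act (compose V k h') f = f'"
    by (simp only: k(2))
  then show thesis by (rule that[OF R_compose[OF k(1) h'(1)]])
qed

lemma flags_at_Infinity: "flags_at \<Omega> Infinity = (\<lambda>(a, b). (Infinity, centred_block a b)) ` UNIV"
  by (auto simp: flags_at_def \<Omega>_at_Infinity image_iff) blast

lemma card_flags_at:
  assumes "x \<in> V"
  shows "card (flags_at \<Omega> x) = q ^ 2"
proof -
  have inj: "inj (\<lambda>(a, b). (Infinity :: 'a ree_point, centred_block a b))"
    by (auto simp: inj_on_def centred_block_eq_iff)
  have inf: "card (flags_at \<Omega> Infinity) = q ^ 2"
    unfolding flags_at_Infinity card_image[OF inj]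
    by (simp only: UNIV_Times_UNIV[symmetric] card_cartesian_product card_field power2_eq_square)
  have "\<exists>y\<in>V. y \<noteq> x" by (metis Infinity_in_V pt_in_V pt_neq_Infinity(1))
  then obtain g where g: "g \<in> R" "g Infinity = x"
    using R_two_transitive[OF assms] by metis
  obtain h where h: "h \<in> R" "\<And>x. x \<in> V \<Longrightarrow> h (g x) = x" "\<And>x. x \<in> V \<Longrightarrow> g (h x) = x"
    using R_inverse[OF g(1)] by blast
  have "bij_betw (flag_act g) (flags_at \<Omega> Infinity) (flags_at \<Omega> x)"
  proof (rule bij_betw_byWitness[where f' = "flag_act h"])
    show "\<forall>f\<in>flags_at \<Omega> Infinity. flag_act h (flag_act g f) = f"
      using flag_act_inverse[of h g, OF h(2)] by (simp add: flags_at_def)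
    show "\<forall>f\<in>flags_at \<Omega> x. flag_act g (flag_act h f) = f"
      using flag_act_inverse[of g h, OF h(3)] by (simp add: flags_at_def)
    show "flag_act g ` flags_at \<Omega> Infinity \<subseteq> flags_at \<Omega> x"
      using \<Omega>_act[OF g(1), of Infinity] g(2) by (auto simp: flags_at_def flag_act_def)
    show "flag_act h ` flags_at \<Omega> x \<subseteq> flags_at \<Omega> Infinity"
      using \<Omega>_act[OF h(1), of x] h(2)[of Infinity] g(2) by (auto simp: flags_at_def flag_act_def)
  qed
  then show ?thesis using inf bij_betw_same_card by fastforce
qed

lemma card_\<Omega>: "card \<Omega> = q ^ 2 * (q ^ 3 + 1)"
proof -
  have "\<Omega> = (\<Union>x\<in>V. flags_at \<Omega> x)"
    using \<Omega>_subset by (auto simp: flags_at_def)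
  moreover have "card (\<Union>x\<in>V. flags_at \<Omega> x) = (\<Sum>x\<in>V. card (flags_at \<Omega> x))"
    by (rule card_UN_disjoint[OF finite_V])
       (auto simp: flags_at_def intro: finite_subset[OF _ finite_\<Omega>])
  ultimately have "card \<Omega> = (\<Sum>x\<in>V. q ^ 2)"
    using card_flags_at by simp
  then show ?thesis by (simp add: card_V mult.commute)
qed

section \<open>The design\<close>

text \<open>
  The image of the origin under the inverse of the map \<open>t\<close> that takes the origin to the given point.
\<close>

definition inverse_pt :: "'a ree_point \<Rightarrow> 'a ree_point" where
  "inverse_pt p = (case p of Infinity \<Rightarrow> Infinity
     | Pt a b c _ _ _ \<Rightarrow> pt (- a) (\<sigma> a * a - b) (- c))"

lemma inverse_pt_pt: "inverse_pt (pt a b c) = pt (- a) (\<sigma> a * a - b) (- c)"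
  by (simp add: inverse_pt_def ree_pt_def)

lemma inverse_pt_inverse_pt: "p \<in> V \<Longrightarrow> inverse_pt (inverse_pt p) = p"
  by (auto elim!: V_cases simp: inverse_pt_pt) (simp add: inverse_pt_def)

lemma block_through_Infinity_zero:
  "(pt a b c, M) \<in> \<Omega> \<and> Infinity \<in> M \<and> pt 0 0 0 \<in> M \<longleftrightarrow>
    M = ree_t e a b c ` ree_w e ` L0 \<and> inverse_pt (pt a b c) \<in> ree_w e ` L0"
proof -
  let ?t = "ree_t e a b c" and ?u = "ree_t e (- a) (\<sigma> a * a - b) (- c)"
  have tw: "compose V ?t (ree_w e) \<in> R" by (rule R_compose) simp_all
  have wL: "ree_w e ` L0 \<subseteq> V" using L0_in_V by auto
  have "(pt a b c, M) \<in> \<Omega> \<and> Infinity \<in> M \<longleftrightarrow> M = ?t ` ree_w e ` L0"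
    using \<Omega>_through[OF tw, of M] by (simp add: compose_eq compose_image L0_in_V)
  moreover have "pt 0 0 0 \<in> ?t ` ree_w e ` L0 \<longleftrightarrow> inverse_pt (pt a b c) \<in> ree_w e ` L0"
  proof
    assume "pt 0 0 0 \<in> ?t ` ree_w e ` L0"
    then obtain p where p: "p \<in> ree_w e ` L0" "pt 0 0 0 = ?t p" by blast
    then have "?u (pt 0 0 0) = p" using wL t_inverse by (metis subsetD)
    moreover have "inverse_pt (pt a b c) = ?u (pt 0 0 0)" by (simp add: inverse_pt_pt)
    ultimately show "inverse_pt (pt a b c) \<in> ree_w e ` L0" using p(1) by (simp only:)
  next
    assume "inverse_pt (pt a b c) \<in> ree_w e ` L0"
    moreover have "?t (inverse_pt (pt a b c)) = pt 0 0 0"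
      by (simp add: inverse_pt_pt algebra_simps)
    ultimately show "pt 0 0 0 \<in> ?t ` ree_w e ` L0" by (metis imageI)
  qed
  ultimately show ?thesis by blast
qed

text \<open>
  By uniqueness of centres these blocks may be counted by their centres. One of them has its centre
  at infinity. For an affine centre \<open>p\<close> the only candidate is the block with centre \<open>p\<close> through infinity, and
  it contains the origin if and only if \<open>inverse_pt p\<close> lies on the image of \<open>L0\<close> under \<open>w\<close>, which has \<open>q\<close>
  affine points.
\<close>

lemma card_blocks_through_Infinity_zero:
  "card {B \<in> blocks. Infinity \<in> B \<and> pt 0 0 0 \<in> B} = q + 1"
proof -
  define X where "X = {f \<in> \<Omega>. Infinity \<in> snd f \<and> pt 0 0 0 \<in> snd f}"
  have "inj_on snd X"
    using centre_unique by (auto simp: inj_on_def X_def)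
  moreover have "snd ` X = {B \<in> blocks. Infinity \<in> B \<and> pt 0 0 0 \<in> B}"
    by (force simp: X_def)
  ultimately have 1: "card {B \<in> blocks. Infinity \<in> B \<and> pt 0 0 0 \<in> B} = card X"
    by (metis card_image)
  have "inj_on fst X"
  proof (rule inj_onI)
    fix f f' assume f: "f \<in> X" "f' \<in> X" "fst f = fst f'"
    obtain x M M' where xMN: "f = (x, M)" "f' = (x, M')" using f(3) by (metis prod.collapse)
    have "M = M'"
    proof (cases "x = Infinity")
      case True
      then show ?thesis
        using \<Omega>_unique[of x M M' "pt 0 0 0"] f xMN by (auto simp: X_def)
    next
      case False
      then show ?thesis
        using \<Omega>_unique[of x M M' Infinity] f xMN by (auto simp: X_def)
    qed
    then show "f = f'" by (simp add: xMN)
  qed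
  moreover have "fst ` X = insert Infinity (inverse_pt ` (ree_w e ` L0 - {Infinity}))"
  proof (intro Set.set_eqI iffI)
    fix x assume "x \<in> fst ` X"
    then obtain M where M: "(x, M) \<in> \<Omega>" "Infinity \<in> M" "pt 0 0 0 \<in> M"
      by (auto simp: X_def)
    then have "x \<in> V" using \<Omega>_subset by blast
    then show "x \<in> insert Infinity (inverse_pt ` (ree_w e ` L0 - {Infinity}))"
    proof (cases x rule: V_cases)
      case (2 a b c)
      then have "inverse_pt x \<in> ree_w e ` L0" using M block_through_Infinity_zero[of a b c M] by simp
      moreover have "inverse_pt x \<noteq> Infinity" by (simp add: 2 inverse_pt_pt)
      moreover have "x = inverse_pt (inverse_pt x)" using \<open>x \<in> V\<close> by (simp add: inverse_pt_inverse_pt)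
      ultimately show ?thesis by blast
    qed simp
  next
    fix x assume "x \<in> insert Infinity (inverse_pt ` (ree_w e ` L0 - {Infinity}))"
    then consider "x = Infinity" | y where "y \<in> ree_w e ` L0" "y \<noteq> Infinity" "x = inverse_pt y" by blast
    then show "x \<in> fst ` X"
    proof cases
      case 1
      have "(Infinity, L0) \<in> X" by (auto simp: X_def \<Omega>_at_Infinity)
      then show ?thesis using 1 by (metis fst_conv imageI)
    next
      case (2 y)
      then have yV: "y \<in> V" using L0_in_V by auto
      then obtain a b c where y: "y = pt a b c" using 2 by (auto elim: V_cases)
      then obtain a' b' c' where x: "x = pt a' b' c'" using 2 inverse_pt_pt by blast
      have "inverse_pt x \<in> ree_w e ` L0" using 2 yV by (simp add: inverse_pt_inverse_pt)
      then have "(x, ree_t e a' b' c' ` ree_w e ` L0) \<in> X"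
        using block_through_Infinity_zero[of a' b' c'] by (simp add: x X_def)
      then show ?thesis by (metis fst_conv imageI)
    qed
  qed
  ultimately have "card X = card (insert Infinity (inverse_pt ` (ree_w e ` L0 - {Infinity})))"
    by (metis card_image)
  also have "\<dots> = Suc (card (inverse_pt ` (ree_w e ` L0 - {Infinity})))"
  proof (rule card_insert_disjoint)
    show "finite (inverse_pt ` (ree_w e ` L0 - {Infinity}))"
      using finite_subset[OF L0_in_V finite_V] by simp
    show "Infinity \<notin> inverse_pt ` (ree_w e ` L0 - {Infinity})"
    proof
      assume "Infinity \<in> inverse_pt ` (ree_w e ` L0 - {Infinity})"
      then obtain y where "y \<in> ree_w e ` L0" "y \<noteq> Infinity" "inverse_pt y = Infinity"
        by force
      moreover have "ree_w e ` L0 \<subseteq> V" using L0_in_V by auto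
      ultimately have y: "y \<in> V" "y \<noteq> Infinity" "inverse_pt y = Infinity" by auto
      then obtain a b c where "y = pt a b c" by (auto elim: V_cases)
      with y show False by (simp add: inverse_pt_pt)
    qed
  qed
  also have "card (inverse_pt ` (ree_w e ` L0 - {Infinity})) = card (ree_w e ` L0 - {Infinity})"
  proof (rule card_image)
    show "inj_on inverse_pt (ree_w e ` L0 - {Infinity})"
      using L0_in_V inverse_pt_inverse_pt by (intro inj_on_inverseI[where g = inverse_pt]) auto
  qed
  also have "\<dots> = q"
  proof -
    have "card (ree_w e ` L0) = q + 1"
      using card_image[OF inj_on_subset[OF R_inj[OF w_in_R] L0_in_V]] card_centred_block by simp
    moreover have "Infinity \<in> ree_w e ` L0"
      by (rule image_eqI[of _ _ "pt 0 0 0"]) simp_all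
    ultimately show ?thesis by simp
  qed
  finally show ?thesis using 1 by simp
qed

lemma block_flag:
  assumes "B \<in> blocks"
  shows "\<exists>x. (x, B) \<in> \<Omega>"
proof -
  obtain f where "B = snd f" "f \<in> \<Omega>" using assms by (rule imageE)
  then have "(fst f, B) \<in> \<Omega>" by simp
  then show ?thesis by (rule exI)
qed

lemma blocks_subset_V: "B \<in> blocks \<Longrightarrow> B \<subseteq> V"
  and card_block: "B \<in> blocks \<Longrightarrow> card B = q + 1"
  using block_flag \<Omega>_subset by blast+

lemma blocks_act:
  assumes "g \<in> R" "B \<in> blocks"
  shows "g ` B \<in> blocks"
proof -
  obtain x where "(x, B) \<in> \<Omega>" using block_flag[OF assms(2)] by blast
  from \<Omega>_act[OF assms(1) this] show ?thesis by (rule image_eqI[rotated]) simp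
qed

lemma card_blocks_through:
  assumes "x \<in> V" "y \<in> V" "x \<noteq> y"
  shows "card {B \<in> blocks. x \<in> B \<and> y \<in> B} = q + 1"
proof -
  obtain g where g: "g \<in> R" "g Infinity = x" "g (pt 0 0 0) = y"
    using R_two_transitive assms by metis
  obtain h where h: "h \<in> R" "\<And>x. x \<in> V \<Longrightarrow> h (g x) = x" "\<And>x. x \<in> V \<Longrightarrow> g (h x) = x"
    using R_inverse[OF g(1)] by blast
  have hxy: "h x = Infinity" "h y = pt 0 0 0" using h(2) g by auto
  note BV = blocks_subset_V
  have gh: "g ` h ` M = M" "h ` g ` M = M" if "M \<subseteq> V" for M
    using image_inverse[of V g h] image_inverse[of V h g] h(2,3) that by simp_all
  have "bij_betw ((`) g) {B \<in> blocks. Infinity \<in> B \<and> pt 0 0 0 \<in> B} {B \<in> blocks. x \<in> B \<and> y \<in> B}"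
  proof (rule bij_betw_byWitness[where f' = "(`) h"])
    show "(`) g ` {B \<in> blocks. Infinity \<in> B \<and> pt 0 0 0 \<in> B} \<subseteq> {B \<in> blocks. x \<in> B \<and> y \<in> B}"
      using blocks_act[OF g(1)] g(2,3) by blast
    show "(`) h ` {B \<in> blocks. x \<in> B \<and> y \<in> B} \<subseteq> {B \<in> blocks. Infinity \<in> B \<and> pt 0 0 0 \<in> B}"
    proof (rule image_subsetI)
      fix B assume "B \<in> {B \<in> blocks. x \<in> B \<and> y \<in> B}"
      then show "h ` B \<in> {B \<in> blocks. Infinity \<in> B \<and> pt 0 0 0 \<in> B}"
        using blocks_act[OF h(1), of B] imageI[of x B h] imageI[of y B h] hxy by simp
    qed
  qed (use gh BV in auto)
  then show ?thesis
    using card_blocks_through_Infinity_zero bij_betw_same_card by fastforce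
qed

lemma t_design_\<D>: "t_design 2 (q ^ 3 + 1) (q + 1) (q + 1) \<D>"
  unfolding t_design_def
proof (intro conjI ballI allI impI)
  show "finite (fst \<D>)" "card (fst \<D>) = q ^ 3 + 1"
    by (simp_all add: finite_V card_V)
  show "B \<subseteq> fst \<D>" "card B = q + 1" if "B \<in> snd \<D>" for B
    using blocks_subset_V card_block that by simp_all
  fix S assume S: "S \<subseteq> fst \<D> \<and> card S = 2"
  then obtain x y where "S = {x, y}" "x \<noteq> y" by (auto simp: card_2_iff)
  then show "card {B \<in> snd \<D>. S \<subseteq> B} = q + 1"
    using card_blocks_through[of x y] S by simp
qed

section \<open>Groups preserving the flags\<close>

text \<open>
  What the Ree group and its extension by a field automorphism have in common. The assertions about
  designs and flag graphs hold for every such group: it permutes the flags, and its subgroup \<open>R\<close> has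
  all the transitivity that is needed.
\<close>

definition flag_preserving :: "('a ree_point \<Rightarrow> 'a ree_point) set \<Rightarrow> bool" where
  "flag_preserving S \<longleftrightarrow> subgroup S (BijGroup V) \<and> R \<subseteq> S \<and> (\<forall>g\<in>S. \<forall>f\<in>\<Omega>. flag_act g f \<in> \<Omega>)"

lemma flag_preserving_R: "flag_preserving R"
  using R_subgroup \<Omega>_act by (auto simp: flag_preserving_def flag_act_def)

context
  fixes S :: "('a ree_point \<Rightarrow> 'a ree_point) set"
  assumes S: "flag_preserving S"
begin

lemma S_subgroup: "subgroup S (BijGroup V)" and R_subset_S: "R \<subseteq> S"
  using S by (auto simp: flag_preserving_def)

lemma S_flag_act: "g \<in> S \<Longrightarrow> f \<in> \<Omega> \<Longrightarrow> flag_act g f \<in> \<Omega>"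
  using S unfolding flag_preserving_def by blast

lemma S_act: "g \<in> S \<Longrightarrow> (x, M) \<in> \<Omega> \<Longrightarrow> (g x, g ` M) \<in> \<Omega>"
  using S_flag_act[of g "(x, M)"] by (simp add: flag_act_def)

lemma S_inj: "g \<in> S \<Longrightarrow> inj_on g V"
  using subgroup_BijGroup_Bij[OF S_subgroup] by (auto simp: Bij_def bij_betw_def)

lemma S_in_V: "g \<in> S \<Longrightarrow> x \<in> V \<Longrightarrow> g x \<in> V"
  by (rule subgroup_BijGroup_in[OF S_subgroup])

lemma orbit_flag:
  assumes "f \<in> \<Omega>"
  shows "Group_Action.orbit (perm_group S) flag_act f = \<Omega>"
  unfolding orbit_perm_group
proof
  show "(\<lambda>g. flag_act g f) ` S \<subseteq> \<Omega>" using S_flag_act assms by blast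
  show "\<Omega> \<subseteq> (\<lambda>g. flag_act g f) ` S"
  proof
    fix f' assume "f' \<in> \<Omega>"
    with assms obtain g where "g \<in> R" "flag_act g f = f'" by (rule R_flag_transitive)
    then show "f' \<in> (\<lambda>g. flag_act g f) ` S" using R_subset_S by blast
  qed
qed

lemma orbit_block:
  assumes "B \<in> blocks"
  shows "Group_Action.orbit (perm_group S) (`) B = blocks"
proof -
  obtain x where x: "(x, B) \<in> \<Omega>" using block_flag[OF assms] by blast
  have "blocks = snd ` Group_Action.orbit (perm_group S) flag_act (x, B)"
    by (simp only: orbit_flag[OF x])
  then show ?thesis by (simp only: orbit_perm_group image_image flag_act_def map_prod_simp snd_conv)
qed

lemma subgroup_automorphism_group: "subgroup (carrier (perm_group S)) (automorphism_group \<D>)"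
proof -
  let ?A = "{g \<in> Bij V. (`) g ` blocks = blocks}"
  note BV = blocks_subset_V
  have "subgroup ?A (BijGroup V)"
  proof (rule subgroup_BijGroupI)
    have "(`) (\<lambda>x\<in>V. x) ` blocks = (\<lambda>B. B) ` blocks"
    proof (rule image_cong)
      fix B assume "B \<in> blocks"
      from BV[OF this] show "(\<lambda>x\<in>V. x) ` B = B" by (simp add: subset_iff)
    qed simp
    then show "(\<lambda>x\<in>V. x) \<in> ?A" by (simp add: id_Bij)
    fix g h assume g: "g \<in> ?A"
    show "compose V g h \<in> ?A" if "h \<in> ?A"
    proof -
      have "(`) (compose V g h) ` blocks = (\<lambda>B. g ` h ` B) ` blocks"
        using BV by (intro image_cong refl compose_image)
      also have "\<dots> = (`) g ` (`) h ` blocks" by (simp only: image_image)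
      finally have "(`) (compose V g h) ` blocks = (`) g ` (`) h ` blocks" .
      with g that show ?thesis by (simp add: compose_Bij)
    qed
    assume h: "h \<in> Bij V" "\<And>x. x \<in> V \<Longrightarrow> h (g x) = x"
    have "(`) h ` blocks = (`) h ` (`) g ` blocks" using g by simp
    also have "\<dots> = (\<lambda>B. B) ` blocks"
      unfolding image_image[of "(`) h"]
    proof (rule image_cong)
      fix B assume "B \<in> blocks"
      with BV have "B \<subseteq> V" by blast
      then show "h ` g ` B = B" using image_inverse[of V h g] h(2) by blast
    qed simp
    finally show "h \<in> ?A" using h(1) by simp
  qed auto
  moreover have "S \<subseteq> ?A"
  proof
    fix g assume g: "g \<in> S"
    have act: "k ` B \<in> blocks" if k: "k \<in> S" and B: "B \<in> blocks" for k B
    proof -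
      obtain x where "(x, B) \<in> \<Omega>" using block_flag[OF B] by blast
      from S_act[OF k this] show ?thesis by (rule image_eqI[rotated]) simp
    qed
    obtain h where h: "h \<in> S" "\<And>x. x \<in> V \<Longrightarrow> h (g x) = x" "\<And>x. x \<in> V \<Longrightarrow> g (h x) = x"
      using subgroup_BijGroup_inverse[OF S_subgroup g] by blast
    have "(`) g ` blocks = blocks"
    proof
      show "(`) g ` blocks \<subseteq> blocks" using act[OF g] by blast
      show "blocks \<subseteq> (`) g ` blocks"
      proof
        fix B assume B: "B \<in> blocks"
        have "g ` h ` B = B" by (intro image_inverse[of V g h] h(3) BV[OF B])
        with act[OF h(1) B] show "B \<in> (`) g ` blocks" by (metis imageI)
      qed
    qed
    then show "g \<in> ?A" using subgroup_BijGroup_Bij[OF S_subgroup g] by simp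
  qed
  ultimately show ?thesis
    using group.subgroup_incl[OF group_BijGroup S_subgroup] by (simp add: automorphism_group_def)
qed

lemma two_transitive: "two_transitive_on (perm_group S) V"
  unfolding two_transitive_on_def transitive_on_def
proof (rule ballI, clarify)
  fix x y assume xy: "x \<in> V" "y \<in> V" "x \<noteq> y"
  show "Group_Action.orbit (perm_group S) (\<lambda>g. map_prod g g) (x, y)
      = {(x, y). x \<in> V \<and> y \<in> V \<and> x \<noteq> y}"
  proof (intro Set.set_eqI iffI; clarify)
    fix u v assume "(u, v) \<in> Group_Action.orbit (perm_group S) (\<lambda>g. map_prod g g) (x, y)"
    then obtain g where g: "g \<in> S" "u = g x" "v = g y" by (auto simp: Group_Action.orbit_def)
    then show "u \<in> V \<and> v \<in> V \<and> u \<noteq> v"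
      using S_in_V xy inj_onD[OF S_inj[OF g(1)], of x y] by auto
  next
    fix u v assume uv: "u \<in> V" "v \<in> V" "u \<noteq> v"
    obtain g where g: "g \<in> R" "g Infinity = x" "g (pt 0 0 0) = y"
      using R_two_transitive xy by metis
    obtain h where h: "h \<in> R" "h Infinity = u" "h (pt 0 0 0) = v"
      using R_two_transitive uv by metis
    obtain k where k: "k \<in> R" "\<And>x. x \<in> V \<Longrightarrow> k (g x) = x" "\<And>x. x \<in> V \<Longrightarrow> g (k x) = x"
      using R_inverse[OF g(1)] by blast
    have "compose V h k \<in> S" using R_compose[OF h(1) k(1)] R_subset_S by blast
    moreover have "compose V h k x = u" "compose V h k y = v"
      using g h k(2) xy by (auto simp: compose_eq)
    ultimately show "(u, v) \<in> Group_Action.orbit (perm_group S) (\<lambda>g. map_prod g g) (x, y)"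
      unfolding Group_Action.orbit_def by (auto intro!: exI[of _ "compose V h k"])
  qed
qed

lemma block_transitive: "transitive_on (perm_group S) (`) (snd \<D>)"
  unfolding transitive_on_def using orbit_block by simp

lemma one_feasible: "one_feasible (perm_group S) \<D> \<Omega>"
  unfolding one_feasible_def
proof (intro conjI ballI allI impI)
  show "\<Omega> \<in> orbits (perm_group S) (flags \<D>) flag_act"
    unfolding orbits_def
  proof (intro CollectI exI conjI)
    show "\<Omega> = Group_Action.orbit (perm_group S) flag_act (Infinity, L0)"
      using orbit_flag[OF base_flag] by simp
    show "(Infinity, L0) \<in> flags \<D>"
      using base_flag by (force simp: flags_def)
  qed
  show "card (flags_at \<Omega> x) \<ge> 2" if "x \<in> fst \<D>" for x
    using card_flags_at[of x] that q_ge_3 self_le_power[of q 2] by simp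
  have stab: "set_stab (point_stab (perm_group S) Infinity) L0 =
      perm_group {g \<in> S. g Infinity = Infinity \<and> g ` L0 = L0}"
    by (auto simp: set_stab_def point_stab_def stabilizer_def)
  show "\<exists>(x, L)\<in>\<Omega>. transitive_on (set_stab (point_stab (perm_group S) x) L) (\<lambda>g. g) (L - {x})"
  proof (rule bexI[OF _ base_flag], clarify, unfold transitive_on_def, intro ballI Set.set_eqI iffI)
    fix y z assume y: "y \<in> L0 - {Infinity}"
    {
      assume "z \<in> Group_Action.orbit (set_stab (point_stab (perm_group S) Infinity) L0) (\<lambda>g. g) y"
      then obtain g where g: "g \<in> S" "g Infinity = Infinity" "g ` L0 = L0" "z = g y"
        unfolding stab orbit_perm_group by blast
      have "y \<in> V" using y L0_in_V by blast
      then show "z \<in> L0 - {Infinity}"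
        using g y inj_onD[OF S_inj[OF g(1)], of y Infinity] by auto
    }
    assume "z \<in> L0 - {Infinity}"
    with y obtain c d where "y = pt 0 0 c" "z = pt 0 0 d" by (auto simp: centred_block_def)
    moreover have "ree_t e 0 0 (d - c) \<in> {g \<in> S. g Infinity = Infinity \<and> g ` L0 = L0}"
      using R_subset_S t_in_R t_image_L0 by auto
    ultimately show "z \<in> Group_Action.orbit (set_stab (point_stab (perm_group S) Infinity) L0) (\<lambda>g. g) y"
      unfolding stab orbit_perm_group by (intro image_eqI[of _ _ "ree_t e 0 0 (d - c)"]) simp_all
  qed
  fix x L M'
  assume *: "(x, L) \<in> flags_at \<Omega> x \<and> (x, M') \<in> flags_at \<Omega> x \<and> (x, L) \<noteq> (x, M')"
  then have "(x, L) \<in> \<Omega>" "(x, M') \<in> \<Omega>" "L \<noteq> M'" by (auto simp: flags_at_def)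
  then show "L \<inter> M' = {x}"
    using \<Omega>_unique[of x L M'] \<Omega>_subset by blast
qed

lemma is_flag_graph:
  "is_flag_graph_of (perm_group S) \<D> \<Omega> (flag_arcs \<Omega>) (flag_graph \<Omega> (flag_arcs \<Omega>))"
  unfolding is_flag_graph_of_def
proof (intro conjI one_feasible refl arcs_converse)
  define f0 where "f0 = ((Infinity :: 'a ree_point, L0), (pt 0 0 0, ree_w e ` L0))"
  have f0: "f0 \<in> flag_arcs \<Omega>"
    unfolding f0_def arcs_iff
  proof (intro bexI conjI)
    have "ree_t e 0 0 0 ` A = A" if "A \<subseteq> V" for A :: "'a ree_point set"
      using that by (simp add: subset_iff)
    moreover have "ree_w e ` L0 \<subseteq> V" using L0_in_V by auto
    ultimately show "L0 = ree_t e 0 0 0 ` L0" "ree_w e ` L0 = ree_t e 0 0 0 ` ree_w e ` L0"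
      using L0_in_V by metis+
  qed simp_all
  then have f0\<Omega>: "f0 \<in> \<Omega> \<times> \<Omega>" by (auto simp: flag_arcs_def)
  have "flag_arcs \<Omega> = Group_Action.orbit (perm_group S) (\<lambda>g. map_prod (flag_act g) (flag_act g)) f0"
  proof (intro Set.set_eqI iffI)
    fix a assume "a \<in> flag_arcs \<Omega>"
    then obtain g where "g \<in> R" "a = map_prod (flag_act g) (flag_act g) f0"
      by (cases a) (auto simp: arcs_iff f0_def flag_act_def)
    then show "a \<in> Group_Action.orbit (perm_group S) (\<lambda>g. map_prod (flag_act g) (flag_act g)) f0"
      using R_subset_S by (auto simp: Group_Action.orbit_def)
  next
    fix a assume "a \<in> Group_Action.orbit (perm_group S) (\<lambda>g. map_prod (flag_act g) (flag_act g)) f0"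
    then obtain g where g: "g \<in> S" "a = map_prod (flag_act g) (flag_act g) f0"
      by (auto simp: Group_Action.orbit_def)
    have "g Infinity \<noteq> g (pt 0 0 0)"
      using inj_onD[OF S_inj[OF g(1)], of Infinity "pt 0 0 0"] by auto
    moreover have "(g Infinity, g ` L0) \<in> \<Omega>" "(g (pt 0 0 0), g ` ree_w e ` L0) \<in> \<Omega>"
      using f0\<Omega> S_act[OF g(1)] by (auto simp: f0_def)
    moreover have "Infinity \<in> ree_w e ` L0" "pt 0 0 0 \<in> ree_w e ` L0"
      using f0 by (auto simp: f0_def flag_arcs_def)
    ultimately show "a \<in> flag_arcs \<Omega>"
      by (auto simp: g(2) f0_def flag_act_def flag_arcs_def)
  qed
  with f0\<Omega> show "flag_arcs \<Omega> \<in> orbits (perm_group S) (\<Omega> \<times> \<Omega>) (\<lambda>g. map_prod (flag_act g) (flag_act g))"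
    by (auto simp: orbits_def)
qed

end

section \<open>Imprimitive blocks of the stabilizer of infinity\<close>

text \<open>
  The orbit of the origin under the centre of the group of all \<open>t\<close>.
\<close>

definition centre_orbit :: "'a ree_point set" where "centre_orbit = {pt 0 0 c | c. True}"

lemma L0_eq: "L0 = centre_orbit \<union> {Infinity}"
  by (auto simp: centre_orbit_def centred_block_def)

lemma pt_in_centre_orbit [simp]: "pt a b c \<in> centre_orbit \<longleftrightarrow> a = 0 \<and> b = 0"
  by (auto simp: centre_orbit_def)

lemma centre_orbit_subset: "centre_orbit \<subseteq> V"
  by (auto simp: centre_orbit_def)

lemma card_centre_orbit: "card centre_orbit = q"
proof -
  have "centre_orbit = range (pt 0 0)" by (auto simp: centre_orbit_def)
  moreover have "inj (pt 0 0)" by (auto simp: inj_on_def)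
  ultimately show ?thesis by (simp add: card_image card_field)
qed

lemma sigma_mult_self_is_square: "\<exists>y. \<sigma> x * x = y ^ 2"
proof -
  have "even ((3::nat) ^ (e + 1) + 1)" by simp
  then obtain m where "(3::nat) ^ (e + 1) + 1 = m * 2" by (metis dvd_def mult.commute)
  then have "\<sigma> x * x = (x ^ m) ^ 2"
    unfolding ree_sigma_def by (metis power_add power_mult power_one_right)
  then show ?thesis by blast
qed

text \<open>
  Let \<open>p0 = (a, b, c, \<dots>)\<close>. Since \<open>P\<close> is a block containing the origin, it is preserved by \<open>t\<close> with
  parameters \<open>a, b, c\<close>, hence it contains the image of \<open>p0\<close> under that map; in characteristic 3 this
  is \<open>(-a, -b + a\<^bsup>\<sigma>+1\<^esup>, -c - a\<^bsup>\<sigma>+2\<^esup>, \<dots>)\<close>. If \<open>a \<noteq> 0\<close>, the only image of \<open>p0\<close> under an \<open>n\<close> with first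
  coordinate \<open>-a\<close> has third coordinate \<open>-c\<close>. If \<open>a = 0 \<noteq> b\<close>, then \<open>-1 = \<kappa>\<^bsup>\<sigma>+1\<^esup>\<close> for some \<open>\<kappa>\<close>, which would
  be a square. So \<open>P\<close> is contained in the centre orbit, and the two sets have the same size.
\<close>

lemma block_eq_centre_orbit:
  assumes PV: "P \<subseteq> V - {Infinity}" and zero: "pt 0 0 0 \<in> P"
    and block: "\<And>a b c. ree_t e a b c ` P = P \<or> ree_t e a b c ` P \<inter> P = {}"
    and p0: "p0 \<in> P" "p0 \<noteq> pt 0 0 0"
    and orbit: "\<And>p. p \<in> P \<Longrightarrow> p \<noteq> pt 0 0 0 \<Longrightarrow> \<exists>\<kappa>. \<kappa> \<noteq> 0 \<and> p = ree_n e \<kappa> p0"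
    and card: "card (P - {pt 0 0 0}) = q - 1"
  shows "P = centre_orbit"
proof -
  have double: "ree_t e a b c (pt a b c) \<in> P" if "pt a b c \<in> P" for a b c
  proof -
    have "ree_t e a b c (pt 0 0 0) = pt a b c" by simp
    then have "ree_t e a b c ` P \<inter> P \<noteq> {}" using zero that by (metis IntI empty_iff imageI)
    with block have "ree_t e a b c ` P = P" by blast
    with that show ?thesis by (metis imageI)
  qed
  have "p0 \<in> V" "p0 \<noteq> Infinity" using p0(1) PV by auto
  then obtain a b c where abc: "p0 = pt a b c"
    by (blast elim: V_cases)
  have dbl: "pt (- a) (- b + \<sigma> a * a) (- c - \<sigma> a * a * a) \<in> P"
  proof -
    have self: "x + x = - x" for x :: 'a
      using two by (metis mult_2 mult_minus1)
    have "ree_t e a b c (pt a b c) = pt (- a) (- b + \<sigma> a * a) (- c - \<sigma> a * a * a)"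
      by (simp add: self mult.commute[of b a])
    then show ?thesis using double[of a b c] p0(1) by (simp only: abc)
  qed
  have a: "a = 0"
  proof (rule ccontr)
    assume a: "a \<noteq> 0"
    then obtain \<kappa> where "pt (- a) (- b + \<sigma> a * a) (- c - \<sigma> a * a * a) = ree_n e \<kappa> p0"
      using orbit[OF dbl] by auto
    then have "- a = \<kappa> * a" "- c - \<sigma> a * a * a = \<sigma> \<kappa> * \<kappa>^2 * c"
      by (simp_all add: abc)
    with a have "\<kappa> = -1" by (metis mult_cancel_right mult_minus1)
    with \<open>- c - \<sigma> a * a * a = \<sigma> \<kappa> * \<kappa>^2 * c\<close> a show False by simp
  qed
  have b: "b = 0"
  proof (rule ccontr)
    assume b: "b \<noteq> 0"
    then obtain \<kappa> where "pt (- a) (- b + \<sigma> a * a) (- c - \<sigma> a * a * a) = ree_n e \<kappa> p0"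
      using orbit[OF dbl] a by auto
    then have "- b = \<sigma> \<kappa> * \<kappa> * b"
      by (simp add: abc a)
    with b have "\<sigma> \<kappa> * \<kappa> = -1" by (metis mult_cancel_right mult_minus1)
    with sigma_mult_self_is_square[of \<kappa>] minus_one_not_square show False by metis
  qed
  have "P \<subseteq> centre_orbit"
  proof
    fix p assume "p \<in> P"
    then show "p \<in> centre_orbit"
      using orbit[of p] by (cases "p = pt 0 0 0") (auto simp: abc a b)
  qed
  moreover have "card P = card centre_orbit"
  proof -
    have "finite P" using PV finite_V by (meson Diff_subset finite_subset)
    then have "card P = Suc (card (P - {pt 0 0 0}))" using zero by (rule card.remove)
    then show ?thesis using card q_ge_3 by (simp add: card_centre_orbit)
  qed
  moreover have "finite centre_orbit"
    using centre_orbit_subset finite_V by (rule finite_subset)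
  ultimately show ?thesis by (rule card_subset_eq[rotated])
qed

lemma subgroup_stabilizer:
  assumes S: "subgroup S (BijGroup V)" and "x \<in> V" "A \<subseteq> V"
  shows "subgroup {g \<in> S. g x = x \<and> g ` A = A} (BijGroup V)"
proof (rule subgroup_BijGroupI)
  show "{g \<in> S. g x = x \<and> g ` A = A} \<subseteq> Bij V"
    using subgroup_BijGroup_Bij[OF S] by blast
  have "(\<lambda>x\<in>V. x) ` A = A" using assms(3) by (simp add: subset_iff)
  then show "(\<lambda>x\<in>V. x) \<in> {g \<in> S. g x = x \<and> g ` A = A}"
    using subgroup_BijGroup_id[OF S] assms(2) by simp
  fix g h assume g: "g \<in> {g \<in> S. g x = x \<and> g ` A = A}"
  show "compose V g h \<in> {g \<in> S. g x = x \<and> g ` A = A}" if "h \<in> {g \<in> S. g x = x \<and> g ` A = A}"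
    using g that assms(2,3) subgroup_BijGroup_compose[OF S, of g h]
    by (simp add: compose_eq compose_image)
  assume h: "h \<in> Bij V" "\<And>x. x \<in> V \<Longrightarrow> h (g x) = x"
  obtain k where k: "k \<in> S" "\<And>x. x \<in> V \<Longrightarrow> k (g x) = x" "\<And>x. x \<in> V \<Longrightarrow> g (k x) = x"
    using subgroup_BijGroup_inverse[OF S, of g] g by blast
  have "h y = k y" if "y \<in> V" for y
    using h(2)[OF subgroup_BijGroup_in[OF S k(1) that]] k(3)[OF that] by simp
  then have "h = k"
    by (intro Bij_eqI[OF h(1) subgroup_BijGroup_Bij[OF S k(1)]])
  moreover have "h ` A = A"
    using image_inverse[of V h g A] h(2) assms(3) g by simp
  ultimately show "h \<in> {g \<in> S. g x = x \<and> g ` A = A}"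
    using k(1) h(2)[OF assms(2)] g by simp
qed

section \<open>The extension by a field automorphism\<close>

context
  fixes \<tau> :: "'a \<Rightarrow> 'a"
  assumes aut: "field_automorphism \<tau>"
    and perm: "ree_componentwise e \<tau> \<in> carrier (BijGroup V)"
    and normal: "R \<lhd> ree_group_extension e \<tau>"
begin

abbreviation \<zeta> :: "'a ree_point \<Rightarrow> 'a ree_point" where "\<zeta> \<equiv> ree_componentwise e \<tau>"

abbreviation G :: "('a ree_point \<Rightarrow> 'a ree_point) set" where "G \<equiv> carrier (ree_group_extension e \<tau>)"

lemma tau_add [simp]: "\<tau> (x + y) = \<tau> x + \<tau> y" and tau_mult [simp]: "\<tau> (x * y) = \<tau> x * \<tau> y"
  using aut by (auto simp: field_automorphism_def)

lemma tau_0 [simp]: "\<tau> 0 = 0"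
  using tau_add[of 0 0] by (metis add_cancel_right_right)

lemma \<zeta>_Bij: "\<zeta> \<in> Bij V"
  using perm by (simp add: BijGroup_def)

lemma \<zeta>_Infinity: "\<zeta> Infinity = Infinity"
  by (simp add: ree_componentwise_def)

lemma \<zeta>_pt: "\<exists>c'. \<zeta> (pt 0 0 c) = pt 0 0 c'"
proof -
  have "\<zeta> (pt 0 0 c) \<in> V"
    by (rule funcset_mem[OF Bij_imp_funcset[OF \<zeta>_Bij] pt_in_V])
  moreover have "\<zeta> (pt 0 0 c) = map_ree_point \<tau> (pt 0 0 c)"
    by (simp add: ree_componentwise_def)
  ultimately show ?thesis by (auto simp: ree_pt_def elim!: V_cases)
qed

lemma \<zeta>_centre_orbit: "\<zeta> ` centre_orbit = centre_orbit"
proof (rule card_subset_eq)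
  show "finite centre_orbit"
    using centre_orbit_subset finite_V by (rule finite_subset)
  show "\<zeta> ` centre_orbit \<subseteq> centre_orbit"
    using \<zeta>_pt by (auto simp: centre_orbit_def)
  have "inj_on \<zeta> V" using \<zeta>_Bij by (simp add: Bij_def bij_betw_def)
  then show "card (\<zeta> ` centre_orbit) = card centre_orbit"
    using centre_orbit_subset by (meson card_image inj_on_subset)
qed

lemma G_eq: "G = generate (BijGroup V) (R \<union> {\<zeta>})"
  by (simp add: ree_group_extension_def perm_group_generated_def)

lemma G_subgroup: "subgroup G (BijGroup V)"
  unfolding G_eq by (rule subgroup_generate_BijGroup) (use R_Bij \<zeta>_Bij in auto)

lemma ree_group_extension_eq: "ree_group_extension e \<tau> = perm_group G"
  by (simp add: ree_group_extension_def perm_group_generated_def)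

lemma R_subset_G: "R \<subseteq> G" and \<zeta>_in_G: "\<zeta> \<in> G"
  unfolding G_eq by (auto intro: generate.incl)

text \<open>
  As \<open>R\<close> is normal, its product with the group generated by \<open>\<zeta>\<close> is a subgroup.
\<close>

lemma G_decomposition:
  assumes "g \<in> G"
  obtains r z where "r \<in> R" "z \<in> generate (BijGroup V) {\<zeta>}" "g = compose V r z"
proof -
  let ?Z = "generate (BijGroup V) {\<zeta>}"
  interpret B: group "BijGroup V" by (rule group_BijGroup)
  have Z: "subgroup ?Z (BijGroup V)"
    by (rule subgroup_generate_BijGroup) (simp add: \<zeta>_Bij)
  have ZG: "?Z \<subseteq> G"
    by (rule generate_BijGroup_subset[OF G_subgroup]) (simp add: \<zeta>_in_G)
  have "group (perm_group G)"
    using subgroup.subgroup_is_group[OF G_subgroup group_BijGroup] .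
  moreover have "R \<lhd> perm_group G" using normal by (simp only: ree_group_extension_eq[symmetric])
  moreover have "subgroup ?Z (perm_group G)"
    by (rule B.subgroup_incl[OF Z G_subgroup ZG])
  ultimately have "subgroup (R <#>\<^bsub>perm_group G\<^esub> ?Z) (perm_group G)"
    by (rule group.mult_norm_subgroup)
  then have sub: "subgroup (R <#>\<^bsub>perm_group G\<^esub> ?Z) (BijGroup V)"
    by (rule B.incl_subgroup[OF G_subgroup])
  have RZ: "R <#>\<^bsub>perm_group G\<^esub> ?Z = {compose V r z | r z. r \<in> R \<and> z \<in> ?Z}"
  proof -
    have "r \<otimes>\<^bsub>perm_group G\<^esub> z = compose V r z" if "r \<in> R" "z \<in> ?Z" for r z
      using R_Bij[OF that(1)] subgroup_BijGroup_Bij[OF Z that(2)] by (simp add: BijGroup_def)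
    then show ?thesis by (auto simp: set_mult_def)
  qed
  have inc: "R \<union> {\<zeta>} \<subseteq> {compose V r z | r z. r \<in> R \<and> z \<in> ?Z}"
  proof -
    have "r \<in> {compose V r z | r z. r \<in> R \<and> z \<in> ?Z}" if "r \<in> R" for r
    proof (intro CollectI exI conjI)
      show "r = compose V r (\<lambda>x\<in>V. x)"
        using compose_Id[OF R_Bij[OF that, THEN Bij_imp_funcset] R_Bij[OF that, THEN Bij_imp_extensional]] ..
    qed (use that subgroup_BijGroup_id[OF Z] in auto)
    moreover have "\<zeta> \<in> {compose V r z | r z. r \<in> R \<and> z \<in> ?Z}"
    proof (intro CollectI exI conjI)
      show "\<zeta> = compose V (\<lambda>x\<in>V. x) \<zeta>"
        using Id_compose[OF \<zeta>_Bij[THEN Bij_imp_funcset] \<zeta>_Bij[THEN Bij_imp_extensional]] ..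
    qed (use R_id in \<open>auto intro: generate.incl\<close>)
    ultimately show ?thesis by blast
  qed
  have "G \<subseteq> {compose V r z | r z. r \<in> R \<and> z \<in> ?Z}"
    unfolding G_eq by (rule generate_BijGroup_subset[OF sub[unfolded RZ] inc])
  from subsetD[OF this assms] show thesis
    using that by blast
qed

lemma generate_\<zeta>_stabilizes:
  assumes "z \<in> generate (BijGroup V) {\<zeta>}"
  shows "z Infinity = Infinity" "z ` centre_orbit = centre_orbit" "z ` L0 = L0"
proof -
  have "subgroup {g \<in> G. g Infinity = Infinity \<and> g ` centre_orbit = centre_orbit} (BijGroup V)"
    by (rule subgroup_stabilizer[OF G_subgroup Infinity_in_V centre_orbit_subset])
  then have "generate (BijGroup V) {\<zeta>} \<subseteq> {g \<in> G. g Infinity = Infinity \<and> g ` centre_orbit = centre_orbit}"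
    by (rule generate_BijGroup_subset) (simp add: \<zeta>_in_G \<zeta>_Infinity \<zeta>_centre_orbit)
  with assms show "z Infinity = Infinity" "z ` centre_orbit = centre_orbit" by auto
  then show "z ` L0 = L0" by (simp add: L0_eq)
qed

lemma flag_preserving_G: "flag_preserving G"
  unfolding flag_preserving_def
proof (intro conjI ballI G_subgroup R_subset_G)
  fix g f assume g: "g \<in> G" and f: "f \<in> \<Omega>"
  obtain r where r: "r \<in> R" "f = flag_act r (Infinity, L0)" using \<Omega>_rep[OF f] by blast
  have "compose V g r \<in> G"
    using subgroup_BijGroup_compose[OF G_subgroup g] r(1) R_subset_G by blast
  then obtain r' z where r': "r' \<in> R" and z: "z \<in> generate (BijGroup V) {\<zeta>}"
    and eq: "compose V g r = compose V r' z"
    by (rule G_decomposition)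
  have "flag_act g f = flag_act (compose V g r) (Infinity, L0)"
    by (simp add: r(2) flag_act_compose L0_in_V)
  also have "\<dots> = flag_act r' (Infinity, L0)"
    unfolding eq using generate_\<zeta>_stabilizes[OF z]
    by (simp add: flag_act_compose L0_in_V) (simp add: flag_act_def)
  also have "\<dots> \<in> \<Omega>"
    using flag_in_\<Omega>[OF r'] by (simp add: flag_act_def)
  finally show "flag_act g f \<in> \<Omega>" .
qed

text \<open>
  Write an element as \<open>r z\<close> with \<open>r\<close> in the Ree group and \<open>z\<close> a power of \<open>\<zeta>\<close>. As \<open>z\<close> stabilizes
  infinity and the centre orbit, so does \<open>r\<close>; then \<open>r\<close> is a product of a \<open>t\<close> and an \<open>n\<close>, and the image of the
  origin shows that the first two parameters of \<open>t\<close> vanish.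
\<close>

lemma stabilizer_of_centre_orbit:
  "carrier (set_stab (point_stab (ree_group_extension e \<tau>) Infinity) centre_orbit) =
     generate (BijGroup V) ({ree_n e \<kappa> | \<kappa>. \<kappa> \<noteq> 0} \<union> {ree_t e 0 0 \<xi> | \<xi>. True} \<union> {\<zeta>})"
    (is "_ = generate _ ?gens")
proof -
  let ?S = "{g \<in> G. g Infinity = Infinity \<and> g ` centre_orbit = centre_orbit}"
  have "carrier (set_stab (point_stab (ree_group_extension e \<tau>) Infinity) centre_orbit) = ?S"
    by (auto simp: set_stab_def point_stab_def stabilizer_def)
  moreover have "?S = generate (BijGroup V) ?gens"
  proof
    have L0_imp: "g ` centre_orbit = centre_orbit"
      if "g \<in> R" "g Infinity = Infinity" "g ` L0 = L0" for g
    proof -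
      have "centre_orbit = L0 - {Infinity}" by (auto simp: centre_orbit_def centred_block_def)
      then have "g ` centre_orbit = g ` L0 - g ` {Infinity}"
        using inj_on_image_set_diff[OF R_inj[OF that(1)], of L0 "{Infinity}"] L0_in_V by auto
      with that \<open>centre_orbit = L0 - {Infinity}\<close> show ?thesis by simp
    qed
    have n: "ree_n e \<kappa> \<in> ?S" if "\<kappa> \<noteq> 0" for \<kappa>
      using that R_subset_G n_in_R[OF that] L0_imp[OF n_in_R[OF that]] n_image_L0[OF that] by auto
    have t: "ree_t e 0 0 \<xi> \<in> ?S" for \<xi>
      using R_subset_G t_in_R L0_imp[OF t_in_R] t_image_L0 by auto
    have "\<zeta> \<in> ?S"
      by (simp add: \<zeta>_in_G \<zeta>_Infinity \<zeta>_centre_orbit)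
    with n t have "?gens \<subseteq> ?S" by blast
    then show "generate (BijGroup V) ?gens \<subseteq> ?S"
      by (rule generate_BijGroup_subset[OF subgroup_stabilizer[OF G_subgroup Infinity_in_V centre_orbit_subset]])
    have gens: "subgroup (generate (BijGroup V) ?gens) (BijGroup V)"
      by (rule subgroup_generate_BijGroup) (use t_Bij n_Bij \<zeta>_Bij in auto)
    show "?S \<subseteq> generate (BijGroup V) ?gens"
    proof
      fix g assume g: "g \<in> ?S"
      then have "g \<in> G" by simp
      then obtain r z where r: "r \<in> R" and z: "z \<in> generate (BijGroup V) {\<zeta>}"
        and eq: "g = compose V r z"
        by (rule G_decomposition)
      have "r Infinity = Infinity"
        using g generate_\<zeta>_stabilizes(1)[OF z] by (simp add: eq compose_eq)
      then obtain a b c \<kappa> where \<kappa>: "\<kappa> \<noteq> 0" "r = compose V (ree_t e a b c) (ree_n e \<kappa>)"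
        by (rule R_fixing_Infinity[OF r])
      have "r ` centre_orbit = centre_orbit"
        using g generate_\<zeta>_stabilizes(2)[OF z] by (simp add: eq compose_image centre_orbit_subset)
      moreover have "r (pt 0 0 0) = pt a b c"
        by (simp add: \<kappa>(2) compose_eq)
      moreover have "pt 0 0 0 \<in> centre_orbit" by simp
      ultimately have "pt a b c \<in> centre_orbit" by (metis imageI)
      then have ab: "a = 0" "b = 0" by simp_all
      have "ree_t e 0 0 c \<in> generate (BijGroup V) ?gens" "ree_n e \<kappa> \<in> generate (BijGroup V) ?gens"
        using \<kappa>(1) by (auto intro!: generate.incl)
      then have "r \<in> generate (BijGroup V) ?gens"
        unfolding \<kappa>(2) ab by (rule subgroup_BijGroup_compose[OF gens])
      moreover have "z \<in> generate (BijGroup V) ?gens"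
        using z group.mono_generate[OF group_BijGroup, of "{\<zeta>}" ?gens] by blast
      ultimately show "g \<in> generate (BijGroup V) ?gens"
        unfolding eq by (rule subgroup_BijGroup_compose[OF gens])
    qed
  qed
  ultimately show ?thesis by simp
qed

end

section \<open>The connected component of the base flag\<close>

abbreviation linked :: "'a ree_point flag \<Rightarrow> 'a ree_point flag \<Rightarrow> bool" where
  "linked f f' \<equiv> (f, f') \<in> (flag_arcs \<Omega>)\<^sup>*"

abbreviation base :: "'a ree_point flag" where "base \<equiv> (Infinity, L0)"

lemma linked_sym:
  assumes "linked f f'"
  shows "linked f' f"
proof -
  have "(f', f) \<in> ((flag_arcs \<Omega>)\<inverse>)\<^sup>*" using assms by (rule rtrancl_converseI)
  then show ?thesis unfolding arcs_converse .
qed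

lemma linked_trans: "linked f f' \<Longrightarrow> linked f' f'' \<Longrightarrow> linked f f''"
  by (rule rtrancl_trans)

lemma arc_act:
  assumes g: "g \<in> R" and "(f, f') \<in> flag_arcs \<Omega>"
  shows "(flag_act g f, flag_act g f') \<in> flag_arcs \<Omega>"
proof -
  obtain x M y M' where f: "f = (x, M)" "f' = (y, M')" by fastforce
  from assms(2) have *: "(x, M) \<in> \<Omega>" "(y, M') \<in> \<Omega>" "x \<noteq> y" "x \<in> M" "x \<in> M'" "y \<in> M" "y \<in> M'"
    unfolding f by (auto simp: flag_arcs_def)
  have "x \<in> V" "y \<in> V" using * \<Omega>_subset by blast+
  then have "g x \<noteq> g y" using inj_onD[OF R_inj[OF g]] *(3) by blast
  moreover have "(g x, g ` M) \<in> \<Omega>" "(g y, g ` M') \<in> \<Omega>"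
    using \<Omega>_act[OF g] *(1,2) by blast+
  moreover have "g x \<in> g ` M" "g x \<in> g ` M'" "g y \<in> g ` M" "g y \<in> g ` M'"
    using * by blast+
  moreover have "flag_act g f = (g x, g ` M)" "flag_act g f' = (g y, g ` M')"
    by (simp_all add: f flag_act_def)
  ultimately show ?thesis
    by (simp add: flag_arcs_def)
qed

lemma linked_act:
  assumes "g \<in> R" "linked f f'"
  shows "linked (flag_act g f) (flag_act g f')"
  using assms(2)
proof (induction rule: rtrancl_induct)
  case (step f' f'')
  from step.IH arc_act[OF assms(1) step.hyps(2)] show ?case by (rule rtrancl_into_rtrancl)
qed simp

text \<open>
  The elements that preserve the connected component of the base flag. All \<open>n\<close>, all \<open>t\<close> with first two
  parameters zero, and \<open>w\<close> are among them.
\<close>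

definition component_stab :: "('a ree_point \<Rightarrow> 'a ree_point) set" where
  "component_stab = {g \<in> R. linked base (flag_act g base)}"

lemma component_stab_subset_R: "g \<in> component_stab \<Longrightarrow> g \<in> R" by (simp add: component_stab_def)

lemma flag_act_compose_base: "g \<in> R \<Longrightarrow> h \<in> R \<Longrightarrow>
    flag_act (compose V g h) base = flag_act g (flag_act h base)"
  by (simp add: flag_act_compose L0_in_V)

lemma component_stab_compose:
  assumes "g \<in> component_stab" "h \<in> component_stab"
  shows "compose V g h \<in> component_stab"
proof -
  have g: "g \<in> R" "linked base (flag_act g base)" and h: "h \<in> R" "linked base (flag_act h base)"
    using assms by (auto simp: component_stab_def)
  have "linked (flag_act g base) (flag_act (compose V g h) base)"
    unfolding flag_act_compose_base[OF g(1) h(1)] by (rule linked_act[OF g(1) h(2)])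
  with g(2) have "linked base (flag_act (compose V g h) base)" by (rule linked_trans)
  with R_compose[OF g(1) h(1)] show ?thesis by (simp add: component_stab_def)
qed

lemma stabilizer_in_component_stab: "g \<in> R \<Longrightarrow> flag_act g base = base \<Longrightarrow> g \<in> component_stab"
  by (simp add: component_stab_def)

lemma n_in_component_stab: "\<kappa> \<noteq> 0 \<Longrightarrow> ree_n e \<kappa> \<in> component_stab"
  by (rule stabilizer_in_component_stab) (simp_all add: flag_act_def n_image_L0)

lemma t_in_component_stab_iff: "ree_t e a b c \<in> component_stab \<longleftrightarrow> linked base (Infinity, centred_block a b)"
  by (simp add: component_stab_def flag_act_def t_image_L0)

lemma centre_in_component_stab: "ree_t e 0 0 c \<in> component_stab"
  by (simp add: t_in_component_stab_iff)

lemma w_in_component_stab: "ree_w e \<in> component_stab"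
proof -
  have "\<exists>g\<in>R. Infinity = g Infinity \<and> pt 0 0 0 = g (pt 0 0 0) \<and> L0 = g ` L0 \<and> ree_w e ` L0 = g ` ree_w e ` L0"
  proof (intro bexI conjI)
    have *: "ree_t e 0 0 0 ` A = A" if "A \<subseteq> V" for A :: "'a ree_point set"
      using that by (simp add: subset_iff)
    have "ree_w e ` L0 \<subseteq> V" using L0_in_V by auto
    then show "L0 = ree_t e 0 0 0 ` L0" "ree_w e ` L0 = ree_t e 0 0 0 ` ree_w e ` L0"
      using *[OF L0_in_V] * by simp_all
  qed simp_all
  then have "(base, (pt 0 0 0, ree_w e ` L0)) \<in> flag_arcs \<Omega>"
    unfolding arcs_iff .
  then show ?thesis by (auto simp: component_stab_def flag_act_def)
qed

text \<open>
  Parameters of the flags at infinity in the component of the base flag. They form a subgroup of the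
  group of all \<open>t\<close> modulo its centre, invariant under all \<open>n\<close>.
\<close>

definition reached :: "('a \<times> 'a) set" where "reached = {(a, b). linked base (Infinity, centred_block a b)}"

lemma reached_iff: "(a, b) \<in> reached \<longleftrightarrow> ree_t e a b c \<in> component_stab"
  by (simp add: reached_def t_in_component_stab_iff)

lemma reached_if_component_stab:
  assumes "g \<in> component_stab" "g Infinity = Infinity" "g (pt 0 0 0) = pt a b c"
  shows "(a, b) \<in> reached"
proof -
  have "(Infinity, g ` L0) \<in> \<Omega>"
    using flag_in_\<Omega>[OF component_stab_subset_R[OF assms(1)]] assms(2) by simp
  then obtain a' b' where "g ` L0 = centred_block a' b'" unfolding \<Omega>_at_Infinity by blast
  moreover have "pt a b c \<in> g ` L0"
    using assms(3) by (metis image_eqI pt_in_centred_block)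
  ultimately have "g ` L0 = centred_block a b" by simp
  with assms(1,2) show ?thesis by (simp add: component_stab_def reached_def flag_act_def)
qed

lemma reached_0: "(0, 0) \<in> reached"
  by (simp add: reached_def)

lemma reached_mult:
  assumes "(a, b) \<in> reached" "(a', b') \<in> reached"
  shows "(a + a', b + b' + \<sigma> a' * a) \<in> reached"
proof (rule reached_if_component_stab)
  show "compose V (ree_t e a' b' 0) (ree_t e a b 0) \<in> component_stab"
    using assms reached_iff by (intro component_stab_compose) blast+
qed (simp_all add: compose_eq)

lemma reached_scale:
  assumes "(a, b) \<in> reached" "\<kappa> \<noteq> 0"
  shows "(\<kappa> * a, \<sigma> \<kappa> * \<kappa> * b) \<in> reached"
proof (rule reached_if_component_stab)
  show "compose V (ree_n e \<kappa>) (ree_t e a b 0) \<in> component_stab"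
    using assms reached_iff by (intro component_stab_compose n_in_component_stab) blast+
qed (simp_all add: compose_eq)

lemma reached_inverse:
  assumes "(a, b) \<in> reached"
  shows "(- a, \<sigma> a * a - b) \<in> reached"
proof -
  let ?t = "ree_t e a b 0" and ?u = "ree_t e (- a) (\<sigma> a * a - b) 0"
  have "linked base (flag_act ?t base)" using assms by (simp add: reached_def flag_act_def t_image_L0)
  then have "linked (flag_act ?u base) (flag_act ?u (flag_act ?t base))"
    by (rule linked_act[OF t_in_R])
  moreover have "flag_act ?u (flag_act ?t base) = base"
    by (rule flag_act_inverse[OF _ base_flag]) (simp add: t_inverse[of _ a b 0, simplified])
  ultimately have "linked base (flag_act ?u base)"
    using linked_sym by simp
  then show ?thesis by (simp add: reached_def flag_act_def t_image_L0)
qed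

lemma lambda_formulas: "ree_lambda1 e a b c = a^2 * b - a * c + \<sigma> b - \<sigma> a * a^3"
  "ree_lambda2 e a b c = \<sigma> a * \<sigma> b - \<sigma> c + a * b^2 + b * c - (\<sigma> a)^2 * a^3"
  "N a b c = a * \<sigma> c - \<sigma> a * a * \<sigma> b + \<sigma> a * a^3 * b + a^2 * b^2 - \<sigma> b * b - c^2 + (\<sigma> a)^2 * a^4"
  by (simp_all add: ree_lambda1_def ree_lambda2_def ree_lambda3_def Let_def)

text \<open>
  Over the prime field there is a walk with seven arcs from the base flag to another flag at infinity.
  It is given by a word in \<open>w\<close> and the centre of the group of all \<open>t\<close>, whose values can be computed.
\<close>

lemma reached_1: "(1, - 1) \<in> reached"
proof (rule reached_if_component_stab)
  define wt where "wt c g = compose V (ree_w e) (compose V (ree_t e 0 0 c) g)" for c and g :: "'a ree_point \<Rightarrow> 'a ree_point"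
  have closed: "wt c g \<in> component_stab" if "g \<in> component_stab" for c g
    unfolding wt_def using that by (intro component_stab_compose w_in_component_stab centre_in_component_stab)
  have wt: "wt c g p = ree_w e (ree_t e 0 0 c (g p))" if "p \<in> V" for c g p
    using that by (simp add: wt_def compose_eq)
  \<comment> \<open>a word in \<open>w\<close> and the centre of the group of all \<open>t\<close> that fixes infinity but not the base flag\<close>
  let ?g = "wt 1 (wt (- 1) (wt 1 (wt 1 (wt (- 1) (wt 1 (ree_w e))))))"
  show "?g \<in> component_stab" by (intro closed w_in_component_stab)
  have w: "ree_w e (pt a b c) = pt a' b' c'"
    if abc: "\<not> (a = 0 \<and> b = 0 \<and> c = 0)" and l: "ree_lambda2 e a b c = a' * N a b c"
      "ree_lambda1 e a b c = b' * N a b c" "c' * N a b c = c" for a b c a' b' c' :: 'a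
  proof -
    have "N a b c \<noteq> 0" using abc N_eq_0_iff by blast
    then have "ree_lambda2 e a b c / N a b c = a'" "ree_lambda1 e a b c / N a b c = b'" "c / N a b c = c'"
      using l by (auto simp: divide_eq_eq)
    then show ?thesis using w_pt[OF abc] by simp
  qed
  have
    "ree_w e (pt 0 0 1) = pt 1 0 (- 1)" "ree_w e (pt 1 0 1) = pt 1 1 1"
    "ree_w e (pt 1 1 (- 1)) = pt (- 1) 1 1" "ree_w e (pt (- 1) 1 (- 1)) = pt (- 1) 0 (- 1)"
    "ree_w e (pt (- 1) 0 1) = pt 0 0 (- 1)" "ree_w e (pt 0 0 (- 1)) = pt (- 1) 0 1"
    "ree_w e (pt (- 1) 0 (- 1)) = pt (- 1) 1 (- 1)" "ree_w e (pt (- 1) 1 0) = pt (- 1) 1 0"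
    "ree_w e (pt (- 1) 0 0) = pt 1 (- 1) 0"
    by (rule w; simp add: lambda_formulas two three)+
  note eval = wt this two three
  show "?g Infinity = Infinity" by (simp add: eval)
  show "?g (pt 0 0 0) = pt 1 (- 1) 0" by (simp add: eval)
qed

lemma reached_diagonal: "(\<kappa>, - (\<sigma> \<kappa> * \<kappa>)) \<in> reached"
  using reached_scale[OF reached_1, of \<kappa>] reached_0 by (cases "\<kappa> = 0") simp_all

text \<open>
  If \<open>q > 3\<close>, some \<open>\<kappa>\<close> is not fixed by \<open>\<sigma>\<close>. Comparing the product of the elements that belong to \<open>\<kappa>\<close> and
  to 1 with the element that belongs to \<open>\<kappa> + 1\<close> yields \<open>(0, d)\<close> with \<open>d = \<sigma> \<kappa> - \<kappa> \<noteq> 0\<close>. The second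
  coordinates of the elements \<open>(0, b)\<close> form an additive group invariant under multiplication by all
  \<open>\<sigma> x \<cdot> x\<close>. These are all squares, because \<open>x = \<sigma> y / y\<close> gives \<open>y\<^sup>2\<close>, and every field element is a difference
  of two squares.
\<close>

lemma reached_UNIV:
  assumes "q > 3"
  shows "reached = UNIV"
proof -
  have "\<exists>x::'a. \<sigma> x \<noteq> x"
  proof (rule ccontr)
    assume "\<not> (\<exists>x::'a. \<sigma> x \<noteq> x)"
    then have "x ^ 3 = x" for x :: 'a using sigma_sigma[of x] by simp
    then have "(x - 0) * (x - 1) * (x + 1) = 0" for x :: 'a
      by (simp add: algebra_simps power3_eq_cube)
    then have "x \<in> {0, 1, - 1}" for x :: 'a
      by (metis add_eq_0_iff2 diff_zero eq_iff_diff_eq_0 insert_iff mult_eq_0_iff)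
    then have "card (UNIV :: 'a set) \<le> card {0, 1, - 1 :: 'a}"
      by (intro card_mono) auto
    also have "\<dots> \<le> 3" by (simp add: card_insert_if)
    finally show False using assms card_field by simp
  qed
  then obtain \<kappa> :: 'a where \<kappa>: "\<sigma> \<kappa> \<noteq> \<kappa>" by blast
  define d where "d = \<sigma> \<kappa> - \<kappa>"
  have d: "(0, d) \<in> reached"
  proof -
    have *: "(- (\<kappa> + 1), \<sigma> (\<kappa> + 1) * (\<kappa> + 1) - - (\<sigma> (\<kappa> + 1) * (\<kappa> + 1))) \<in> reached"
      by (rule reached_inverse[OF reached_diagonal])
    have "(\<kappa> + 1, - (\<sigma> \<kappa> * \<kappa>) + - (\<sigma> 1 * 1) + \<sigma> 1 * \<kappa>) \<in> reached"
      by (rule reached_mult[OF reached_diagonal reached_diagonal])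
    note reached_mult[OF * this]
    moreover have "\<sigma> (\<kappa> + 1) * (\<kappa> + 1) - - (\<sigma> (\<kappa> + 1) * (\<kappa> + 1))
        + (- (\<sigma> \<kappa> * \<kappa>) + - (\<sigma> 1 * 1) + \<sigma> 1 * \<kappa>) + \<sigma> (\<kappa> + 1) * (- (\<kappa> + 1)) = d"
      by (rule eq_mod_3[where Q = "\<kappa>"]) (simp add: d_def algebra_simps)
    ultimately show ?thesis by simp
  qed
  have mult: "(0, b + b') \<in> reached" if "(0, b) \<in> reached" "(0, b') \<in> reached" for b b'
    using reached_mult[OF that] by simp
  have neg: "(0, - b) \<in> reached" if "(0, b) \<in> reached" for b
    using reached_inverse[OF that] by simp
  have square: "(0, x ^ 2 * b) \<in> reached" if "(0, b) \<in> reached" for x b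
  proof (cases "x = 0")
    case False
    then have "\<sigma> (\<sigma> x / x) * (\<sigma> x / x) = x ^ 2"
      by (simp add: power3_eq_cube power2_eq_square)
    with False show ?thesis using reached_scale[OF that, of "\<sigma> x / x"] by simp
  qed (simp add: reached_0)
  have "(0, b) \<in> reached" for b
  proof -
    define y where "y = b / d"
    \<comment> \<open>\<open>(y + 1)\<^sup>2 - (y - 1)\<^sup>2 = 4 y = y\<close> in characteristic 3\<close>
    have "(0, (y + 1) ^ 2 * d + - ((y - 1) ^ 2 * d)) \<in> reached"
      by (intro mult neg square d)
    moreover have "(y + 1) ^ 2 * d + - ((y - 1) ^ 2 * d) = y * d"
      by (rule eq_mod_3[where Q = "y * d"]) (simp add: algebra_simps power2_eq_square)
    ultimately show ?thesis using \<kappa> by (simp add: y_def d_def)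
  qed
  then have "(a + 0, - (\<sigma> a * a) + b + \<sigma> 0 * a) \<in> reached" for a b
    by (rule reached_mult[OF reached_diagonal])
  then have "(a, b) \<in> reached" for a b
    by (metis add.right_neutral minus_add_cancel mult_zero_left sigma_0)
  then show ?thesis by auto
qed

section \<open>Flags at infinity in a component\<close>

text \<open>
  For \<open>q = 3\<close> this is a homomorphism from the group of all \<open>t\<close> to the additive group of the field; its
  kernel preserves the component of the base flag.
\<close>

definition \<phi> :: "'a \<Rightarrow> 'a \<Rightarrow> 'a" where "\<phi> a b = b + a ^ 2"

lemma q3_sigma:
  assumes "q = 3"
  shows "\<sigma> x = x"
proof -
  have "e = 0" using assms by (cases e) (simp_all add: q_def)
  then show ?thesis using power_q[of x] assms by (simp add: ree_sigma_def)
qed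

lemma q3_cases:
  assumes "q = 3"
  obtains "x = 0" | "x = 1" | "x = (- 1 :: 'a)"
proof -
  have "card {0, 1, - 1 :: 'a} = card (UNIV :: 'a set)"
    using one_neq_minus_one card_field assms by (simp add: eq_neg_iff_add_eq_0)
  then have "{0, 1, - 1 :: 'a} = UNIV" by (intro card_subset_eq) auto
  then show thesis using that by blast
qed

lemma \<phi>_mult:
  assumes "q = 3"
  shows "\<phi> (a + a') (b + b' + \<sigma> a' * a) = \<phi> a b + \<phi> a' b'"
  by (rule eq_mod_3[where Q = "a * a'"]) (simp add: \<phi>_def q3_sigma[OF assms] algebra_simps power2_eq_square)

lemma \<phi>_0_reached:
  assumes "q = 3" "\<phi> a b = 0"
  shows "(a, b) \<in> reached"
proof -
  have "b = - (\<sigma> a * a)"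
    using assms(2) by (simp add: \<phi>_def q3_sigma[OF assms(1)] power2_eq_square eq_neg_iff_add_eq_0)
  then show ?thesis using reached_diagonal by simp
qed

text \<open>
  When \<open>q = 3\<close>, the kernel of \<open>\<phi>\<close> has three orbits on affine points, distinguished by the value of \<open>\<phi>\<close>.
  The origin lies in one of them, and \<open>w\<close> maps two points of that orbit into the two others.
\<close>

lemma component_reaches_every_point:
  assumes "x \<in> V"
  shows "\<exists>g\<in>component_stab. g Infinity = x"
  using assms
proof (cases x rule: V_cases)
  case 1
  then show ?thesis by (intro bexI[OF _ centre_in_component_stab[of 0]]) simp
next
  case (2 a b c)
  have *: "\<exists>g\<in>component_stab. g Infinity = pt a b c"
    if "h \<in> component_stab" "h Infinity = pt a' b' c'" "(a - a', b - b' - \<sigma> (a - a') * a') \<in> reached" for h a' b' c'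
  proof -
    let ?t = "ree_t e (a - a') (b - b' - \<sigma> (a - a') * a')
      (c - c' + (a - a') * b' - (b - b' - \<sigma> (a - a') * a') * a' + \<sigma> (a - a') * (a - a') * a')"
    have "?t \<in> component_stab" using that(3) reached_iff by blast
    moreover have "?t (pt a' b' c') = pt a b c" by (simp only: t_pt) (simp add: algebra_simps)
    ultimately show ?thesis
      using component_stab_compose[of ?t h] that(1,2) by (intro bexI[of _ "compose V ?t h"]) (simp_all add: compose_eq)
  qed
  show ?thesis
  proof (cases "q = 3")
    case False
    then have "reached = UNIV" using q_ge_3 by (intro reached_UNIV) simp
    with *[OF w_in_component_stab w_Infinity] show ?thesis by (simp add: 2)
  next
    case True
    note s = q3_sigma[OF True]
    have trans: "\<phi> (a - a') (b - b' - \<sigma> (a - a') * a') = \<phi> a b - \<phi> a' b'" for a' b'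
      using \<phi>_mult[OF True, of a' "a - a'" b' "b - b' - \<sigma> (a - a') * a'"] by (simp add: algebra_simps)
    have reach: "\<exists>g\<in>component_stab. g Infinity = pt a b c" if "h \<in> component_stab" "h Infinity = pt a' b' c'" "\<phi> a' b' = \<phi> a b"
      for h a' b' c'
      by (rule *[OF that(1,2)], rule \<phi>_0_reached[OF True]) (simp only: trans that(3) diff_self)
    have w1: "ree_w e (pt 0 0 1) = pt 1 0 (- 1)"
      by (simp add: w_pt_centre)
    have w2: "ree_w e (pt 1 (- 1) 1) = pt 0 (- 1) 1"
      by (subst w_pt) (simp_all add: lambda_formulas two three)
    have t: "ree_t e 0 0 1 \<in> component_stab" "ree_t e 1 (- 1) 1 \<in> component_stab"
      using centre_in_component_stab reached_1 reached_iff by blast+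
    have h1: "compose V (ree_w e) (compose V (ree_t e 0 0 1) (ree_w e)) \<in> component_stab"
      and h2: "compose V (ree_w e) (compose V (ree_t e 1 (- 1) 1) (ree_w e)) \<in> component_stab"
      by (intro component_stab_compose w_in_component_stab t)+
    show ?thesis
      unfolding 2
    proof (rule q3_cases[OF True, of "\<phi> a b"])
      assume "\<phi> a b = 0"
      then show "\<exists>g\<in>component_stab. g Infinity = pt a b c"
        by (intro reach[OF w_in_component_stab w_Infinity]) (simp add: \<phi>_def)
    next
      assume "\<phi> a b = 1"
      then show "\<exists>g\<in>component_stab. g Infinity = pt a b c"
        by (intro reach[OF h1, of 1 0 "- 1"]) (simp_all add: compose_eq w1 \<phi>_def)
    next
      assume "\<phi> a b = - 1"
      then show "\<exists>g\<in>component_stab. g Infinity = pt a b c"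
        by (intro reach[OF h2, of 0 "- 1" 1]) (simp_all add: compose_eq w2 \<phi>_def)
    qed
  qed
qed

text \<open>
  The component of the base flag has a flag at every point; by transitivity on flags, so has every other
  component.
\<close>

lemma linked_to_Infinity:
  assumes "f \<in> \<Omega>"
  shows "\<exists>a b. linked f (Infinity, centred_block a b)"
proof -
  obtain g where g: "g \<in> R" "f = flag_act g base" using \<Omega>_rep[OF assms] by blast
  obtain h where h: "h \<in> R" "\<And>x. x \<in> V \<Longrightarrow> h (g x) = x" "\<And>x. x \<in> V \<Longrightarrow> g (h x) = x"
    using R_inverse[OF g(1)] by blast
  obtain k where k: "k \<in> component_stab" "k Infinity = h Infinity"
    using component_reaches_every_point[OF R_in_V[OF h(1) Infinity_in_V]] by blast
  have "linked base (flag_act k base)" using k(1) by (simp add: component_stab_def)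
  then have "linked f (flag_act g (flag_act k base))"
    unfolding g(2) by (rule linked_act[OF g(1)])
  moreover have "flag_act g (flag_act k base) \<in> \<Omega>"
    using \<Omega>_act[OF g(1) flag_in_\<Omega>[OF component_stab_subset_R[OF k(1)]]] by (simp add: flag_act_def)
  moreover have "fst (flag_act g (flag_act k base)) = Infinity"
    by (simp add: flag_act_def k(2) h(3))
  ultimately show ?thesis
    by (cases "flag_act g (flag_act k base)") (auto simp: \<Omega>_at_Infinity)
qed

lemma linked_all:
  assumes "q > 3" "f \<in> \<Omega>" "f' \<in> \<Omega>"
  shows "linked f f'"
proof -
  have base: "linked f base" if f: "f \<in> \<Omega>" for f
  proof -
    obtain a b where ab: "linked f (Infinity, centred_block a b)" using linked_to_Infinity[OF f] by blast
    have "(a, b) \<in> reached" using reached_UNIV[OF assms(1)] by simp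
    then have "linked (Infinity, centred_block a b) base"
      unfolding reached_def by (blast intro: linked_sym)
    with ab show ?thesis by (rule linked_trans)
  qed
  show ?thesis
    using base[OF assms(2)] linked_sym[OF base[OF assms(3)]] by (rule linked_trans)
qed

section \<open>A colouring of the flags when \<open>q = 3\<close>\<close>

text \<open>
  The invariant that separates the components for \<open>q = 3\<close>. It is a relation because a flag is given by
  its point and the parameters of its block relative to that point; \<open>flag_colour_Infinity\<close> and
  \<open>flag_colour_pt\<close> show that the value is determined by the flag.
\<close>

definition flag_colour :: "'a ree_point flag \<Rightarrow> 'a \<Rightarrow> bool" where
  "flag_colour f k \<longleftrightarrow>
     (\<exists>a b. f = (Infinity, centred_block a b) \<and> k = \<phi> a b) \<or>
     (\<exists>a b c a' b'. f = (pt a b c, ree_t e a b c ` ree_w e ` centred_block a' b') \<and> k = \<phi> a b + \<phi> a' b')"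

lemma flag_colour_Infinity: "flag_colour (Infinity, centred_block a b) k \<longleftrightarrow> k = \<phi> a b"
  by (auto simp: flag_colour_def centred_block_eq_iff)

lemma flag_colour_pt: "flag_colour (pt a b c, ree_t e a b c ` ree_w e ` centred_block a' b') k
    \<longleftrightarrow> k = \<phi> a b + \<phi> a' b'"
proof -
  have "centred_block a' b' = centred_block a'' b''"
    if "ree_t e a b c ` ree_w e ` centred_block a' b' = ree_t e a b c ` ree_w e ` centred_block a'' b''" for a'' b''
  proof -
    have "inj_on (ree_t e a b c) V" "inj_on (ree_w e) V" by (intro R_inj t_in_R w_in_R)+
    moreover have "ree_w e ` centred_block x y \<subseteq> V" for x y
      by (rule subgroup_BijGroup_image_subset[OF R_subgroup w_in_R centred_block_subset_V])
    ultimately show ?thesis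
      using that centred_block_subset_V by (metis inj_on_image_eq_iff)
  qed
  then show ?thesis
    by (auto simp: flag_colour_def centred_block_eq_iff)
qed

lemma flag_at_pt:
  assumes "(pt a b c, M) \<in> \<Omega>"
  obtains a' b' where "M = ree_t e a b c ` ree_w e ` centred_block a' b'"
proof -
  let ?g = "compose V (ree_t e a b c) (ree_w e)"
  have g: "?g \<in> R" by (intro R_compose t_in_R w_in_R)
  obtain h where h: "h \<in> R" "\<And>x. x \<in> V \<Longrightarrow> h (?g x) = x" "\<And>x. x \<in> V \<Longrightarrow> ?g (h x) = x"
    using R_inverse[OF g] by blast
  have "?g Infinity = pt a b c" by (simp add: compose_eq)
  then have "h (pt a b c) = Infinity" using h(2)[of Infinity] by simp
  then have "(Infinity, h ` M) \<in> \<Omega>" using \<Omega>_act[OF h(1) assms] by simp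
  then obtain a' b' where "h ` M = centred_block a' b'" unfolding \<Omega>_at_Infinity by blast
  moreover have "?g ` h ` M = M"
    using \<Omega>_subset[OF assms] by (intro image_inverse[of V ?g h] h(3)) auto
  ultimately have "M = ?g ` centred_block a' b'" by simp
  then have "M = ree_t e a b c ` ree_w e ` centred_block a' b'"
    by (simp add: compose_image centred_block_subset_V)
  then show thesis by (rule that)
qed

lemma flag_colour_pt_Infinity:
  assumes "(pt a b c, M) \<in> \<Omega>" "Infinity \<in> M"
  shows "flag_colour (pt a b c, M) k \<longleftrightarrow> k = \<phi> a b"
proof -
  obtain a' b' where M: "M = ree_t e a b c ` ree_w e ` centred_block a' b'"
    by (rule flag_at_pt[OF assms(1)])
  then obtain p where p: "p \<in> centred_block a' b'" "ree_t e a b c (ree_w e p) = Infinity"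
    using assms(2) by force
  have pV: "p \<in> V" using p(1) centred_block_subset_V by blast
  have "ree_w e p = Infinity"
    using w_in_V[OF pV]
  proof (cases "ree_w e p" rule: V_cases)
    case (2 x y z)
    with p(2) show ?thesis by simp
  qed
  then have "p = pt 0 0 0" using w_w[OF pV] by simp
  then have "a' = 0" "b' = 0" using p(1) by simp_all
  then show ?thesis unfolding M flag_colour_pt by (simp add: \<phi>_def)
qed

lemma flag_colour_pt_pt:
  assumes "(pt a b c, M) \<in> \<Omega>" "ree_t e a b c p \<in> M" "p \<in> V" "ree_w e p = pt x y z"
  shows "flag_colour (pt a b c, M) k \<longleftrightarrow> k = \<phi> a b + \<phi> x y"
proof -
  obtain a' b' where M: "M = ree_t e a b c ` ree_w e ` centred_block a' b'"
    by (rule flag_at_pt[OF assms(1)])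
  then obtain r where r: "r \<in> centred_block a' b'" "ree_t e a b c p = ree_t e a b c (ree_w e r)"
    using assms(2) by blast
  have rV: "r \<in> V" using r(1) centred_block_subset_V by blast
  then have "p = ree_w e r"
    using r(2) inj_onD[OF R_inj[OF t_in_R] r(2) assms(3)] by simp
  then have "r = pt x y z" using assms(4) w_w[OF rV] by simp
  then have "a' = x" "b' = y" using r(1) by simp_all
  then show ?thesis unfolding M flag_colour_pt by simp
qed

text \<open>
  The coordinates lie in the field with 3 elements, so finitely many cases remain.
\<close>

lemma \<phi>_w:
  assumes q: "q = 3" and abc: "\<not> (a = 0 \<and> b = 0 \<and> c = 0)"
    and w: "ree_w e (pt a b c) = pt x y z"
    and w': "ree_w e (inverse_pt (pt a b c)) = pt x' y' z'"
  shows "\<phi> x y = \<phi> a b + \<phi> x' y'"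
proof -
  note s = q3_sigma[OF q]
  have ne: "\<not> (- a = 0 \<and> \<sigma> a * a - b = 0 \<and> - c = 0)"
    using abc by auto
  have 1: "x = ree_lambda2 e a b c / N a b c" "y = ree_lambda1 e a b c / N a b c"
    using w w_pt[OF abc] by simp_all
  have 2: "x' = ree_lambda2 e (- a) (\<sigma> a * a - b) (- c) / N (- a) (\<sigma> a * a - b) (- c)"
    "y' = ree_lambda1 e (- a) (\<sigma> a * a - b) (- c) / N (- a) (\<sigma> a * a - b) (- c)"
    using w' w_pt[OF ne] by (simp_all add: inverse_pt_pt)
  have "a = 0 \<or> a = 1 \<or> a = - 1" "b = 0 \<or> b = 1 \<or> b = - 1" "c = 0 \<or> c = 1 \<or> c = - 1"
    using q3_cases[OF q] by metis+
  then show ?thesis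
    unfolding 1 2 using abc
    by (elim disjE; simp add: lambda_formulas s \<phi>_def two three power_numeral_reduce)
qed

text \<open>
  For affine \<open>x\<close> and \<open>y\<close>, let \<open>u\<close> be the position of \<open>y\<close> relative to \<open>x\<close>; then \<open>inverse_pt u\<close> is that
  of \<open>x\<close> relative to \<open>y\<close>. The colours of the two flags are \<open>\<phi>\<close> of \<open>x\<close> plus \<open>\<phi>\<close> of \<open>w u\<close>, and \<open>\<phi>\<close> of \<open>y\<close> plus
  \<open>\<phi>\<close> of \<open>w (inverse_pt u)\<close>. Their equality is \<open>\<phi>_w\<close>, because \<open>\<phi>\<close> is a homomorphism.
\<close>

lemma arc_same_colour:
  assumes q: "q = 3" and arc: "(f, f') \<in> flag_arcs \<Omega>" and k: "flag_colour f k"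
  shows "flag_colour f' k"
proof -
  obtain x M y M' where f: "f = (x, M)" "f' = (y, M')" by fastforce
  from arc have *: "(x, M) \<in> \<Omega>" "(y, M') \<in> \<Omega>" "x \<noteq> y" "x \<in> M" "x \<in> M'" "y \<in> M" "y \<in> M'"
    unfolding f by (auto simp: flag_arcs_def)
  have V: "x \<in> V" "y \<in> V" using * \<Omega>_subset by blast+
  from V(1) show ?thesis
  proof (cases x rule: V_cases)
    case 1
    with V(2) *(3) obtain a b c where y: "y = pt a b c" by (auto elim: V_cases)
    obtain a' b' where "M = centred_block a' b'" using *(1) \<Omega>_at_Infinity unfolding 1 by blast
    then have M: "M = centred_block a b" using *(6) y by simp
    have "k = \<phi> a b" using k unfolding f 1 M flag_colour_Infinity .
    then show ?thesis
      using flag_colour_pt_Infinity[of a b c M' k] * unfolding f y 1 by simp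
  next
    case (2 a b c)
    note x = this
    show ?thesis using V(2)
    proof (cases y rule: V_cases)
      case 1
      obtain a' b' where "M' = centred_block a' b'" using *(2) \<Omega>_at_Infinity unfolding 1 by blast
      then have M': "M' = centred_block a b" using *(5) x by simp
      have "k = \<phi> a b"
        using flag_colour_pt_Infinity[of a b c M k] * k unfolding f x 1 by simp
      then show ?thesis unfolding f 1 M' flag_colour_Infinity .
    next
      case (2 a' b' c')
      note y = this
      define u where "u = ree_t e (- a) (\<sigma> a * a - b) (- c) y"
      have u: "ree_t e a b c u = y"
        unfolding u_def y by (simp add: algebra_simps)
      obtain ua ub uc where uabc: "u = pt ua ub uc"
        unfolding u_def y by simp
      have y': "a' = ua + a" "b' = ub + b + \<sigma> a * ua"
        using u unfolding uabc y by simp_all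
      have une: "\<not> (ua = 0 \<and> ub = 0 \<and> uc = 0)"
        using u *(3) unfolding uabc x by auto
      have inv: "ree_t e a' b' c' (inverse_pt u) = x"
        using u unfolding uabc y x inverse_pt_pt by (auto simp: algebra_simps)
      obtain p1 p2 p3 where w: "ree_w e u = pt p1 p2 p3"
        unfolding uabc w_pt[OF une] by blast
      have "inverse_pt u \<noteq> pt 0 0 0" unfolding uabc inverse_pt_pt using une by auto
      then obtain r1 r2 r3 where w': "ree_w e (inverse_pt u) = pt r1 r2 r3"
        unfolding uabc inverse_pt_pt by (subst (asm) pt_eq_iff) (metis w_pt)
      have "k = \<phi> a b + \<phi> p1 p2"
        using flag_colour_pt_pt[of a b c M u p1 p2 p3 k] w k * u unfolding f x by (simp add: uabc)
      also have "\<phi> p1 p2 = \<phi> ua ub + \<phi> r1 r2"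
        by (rule \<phi>_w[OF q une]) (use w w' uabc in simp_all)
      also have "\<phi> a b + (\<phi> ua ub + \<phi> r1 r2) = \<phi> a' b' + \<phi> r1 r2"
        unfolding y' \<phi>_mult[OF q] by simp
      finally show ?thesis
        using flag_colour_pt_pt[of a' b' c' M' "inverse_pt u" r1 r2 r3 k] w' * inv
        unfolding f y by (simp add: uabc inverse_pt_pt)
    qed
  qed
qed

lemma linked_same_colour:
  assumes "q = 3" "linked f f'" "flag_colour f k"
  shows "flag_colour f' k"
  using assms(2)
  by (induction rule: rtrancl_induct) (use assms(1,3) arc_same_colour in blast)+

lemma linked_to_colour:
  assumes q: "q = 3" and f: "f \<in> \<Omega>"
  obtains k where "linked f (Infinity, centred_block 0 k)"
proof -
  obtain a b where ab: "linked f (Infinity, centred_block a b)"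
    using linked_to_Infinity[OF f] by blast
  define k where "k = \<phi> a b"
  \<comment> \<open>the block with parameters \<open>(a, b)\<close> is a translate of one whose colour is zero\<close>
  have "(a, b - k) \<in> reached"
    by (rule \<phi>_0_reached[OF q]) (simp add: k_def \<phi>_def)
  then have "linked base (Infinity, centred_block a (b - k))" by (simp add: reached_def)
  from linked_act[OF t_in_R[of 0 k 0] this]
  have "linked (Infinity, centred_block 0 k) (Infinity, ree_t e 0 k 0 ` centred_block a (b - k))"
    by (simp add: flag_act_def t_image_L0)
  moreover have "ree_t e 0 k 0 ` centred_block a (b - k) = centred_block a b"
  proof -
    have "centred_block a (b - k) = ree_t e a (b - k) 0 ` L0" by (simp add: t_image_L0)
    then have "ree_t e 0 k 0 ` centred_block a (b - k) = (\<lambda>p. ree_t e 0 k 0 (ree_t e a (b - k) 0 p)) ` L0"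
      by (simp only: image_image)
    also have "\<dots> = ree_t e a b (k * a) ` L0"
      using L0_in_V by (intro image_cong) (auto simp: t_t)
    finally show ?thesis by (simp add: t_image_L0)
  qed
  ultimately have "linked (Infinity, centred_block a b) (Infinity, centred_block 0 k)"
    using linked_sym by simp
  with ab have "linked f (Infinity, centred_block 0 k)" by (rule linked_trans)
  then show thesis by (rule that)
qed

section \<open>Valency and components of the flag graph\<close>

abbreviation \<Gamma> :: "'a ree_point flag pair_pre_digraph" where "\<Gamma> \<equiv> flag_graph \<Omega> (flag_arcs \<Omega>)"

lemma \<Gamma>_simps: "pverts \<Gamma> = \<Omega>" "parcs \<Gamma> = flag_arcs \<Omega>"
  by (simp_all add: flag_graph_def)

text \<open>
  The arcs at \<open>(x, M)\<close> correspond to the points of \<open>M\<close> other than \<open>x\<close>: the block with centre \<open>y\<close> through \<open>x\<close>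
  is unique.
\<close>

lemma has_valency: "has_valency (flag_graph \<Omega> (flag_arcs \<Omega>)) q"
  unfolding has_valency_def
proof
  fix v assume "v \<in> pverts (flag_graph \<Omega> (flag_arcs \<Omega>))"
  then obtain x M where v: "v = (x, M)" "(x, M) \<in> \<Omega>"
    by (cases v) (simp add: flag_graph_def)
  note xM = \<Omega>_subset[OF v(2)]
  let ?O = "out_arcs (with_proj (flag_graph \<Omega> (flag_arcs \<Omega>))) v"
  have O: "?O = {a \<in> flag_arcs \<Omega>. fst a = v}"
    by (simp add: out_arcs_def flag_graph_def)
  have "inj_on (\<lambda>a. fst (snd a)) ?O"
  proof (rule inj_onI)
    fix a a' assume "a \<in> ?O" "a' \<in> ?O" "fst (snd a) = fst (snd a')"
    then obtain y M1 M2 where a: "a = (v, (y, M1))" "a' = (v, (y, M2))"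
      unfolding O by (cases a, cases a') auto
    have "(v, (y, M1)) \<in> flag_arcs \<Omega>" "(v, (y, M2)) \<in> flag_arcs \<Omega>"
      using \<open>a \<in> ?O\<close> \<open>a' \<in> ?O\<close> unfolding O a by auto
    then have "(y, M1) \<in> \<Omega>" "(y, M2) \<in> \<Omega>" "x \<in> M1" "x \<in> M2" "x \<noteq> y"
      unfolding v by (simp_all add: flag_arcs_def)
    then have "M1 = M2" using \<Omega>_unique by blast
    then show "a = a'" by (simp add: a)
  qed
  moreover have "(\<lambda>a. fst (snd a)) ` ?O = M - {x}"
  proof
    show "(\<lambda>a. fst (snd a)) ` ?O \<subseteq> M - {x}"
      unfolding O unfolding v by (auto simp: flag_arcs_def)
    show "M - {x} \<subseteq> (\<lambda>a. fst (snd a)) ` ?O"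
    proof
      fix y assume y: "y \<in> M - {x}"
      then have "y \<in> V" "x \<in> V" using xM by auto
      then obtain M' where M': "(y, M') \<in> \<Omega>" "x \<in> M'" using \<Omega>_exists[of y x] y by blast
      then have "y \<in> M'" using \<Omega>_subset by blast
      moreover have "x \<noteq> y" using y by blast
      ultimately have "(v, (y, M')) \<in> ?O"
        using M' y v xM unfolding O by (simp add: flag_arcs_def)
      then show "y \<in> (\<lambda>a. fst (snd a)) ` ?O" by (rule image_eqI[rotated]) simp
    qed
  qed
  ultimately have "card ?O = card (M - {x})" using card_image[of "\<lambda>a. fst (snd a)" ?O] by simp
  then show "out_degree (with_proj (flag_graph \<Omega> (flag_arcs \<Omega>))) v = q"
    using xM by (simp add: out_degree_def)
qed

lemma arcs_in_\<Omega>: "(f, f') \<in> flag_arcs \<Omega> \<Longrightarrow> f \<in> \<Omega> \<and> f' \<in> \<Omega>"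
  by (auto simp: flag_arcs_def)

lemma reachable_iff_linked:
  assumes "f \<in> \<Omega>" "f' \<in> \<Omega>"
  shows "f \<rightarrow>\<^sup>*\<^bsub>with_proj \<Gamma>\<^esub> f' \<longleftrightarrow> linked f f'"
proof
  assume "f \<rightarrow>\<^sup>*\<^bsub>with_proj \<Gamma>\<^esub> f'"
  then show "linked f f'"
    unfolding reachable_def with_proj_simps \<Gamma>_simps by (rule rtrancl_on_rtranclI)
next
  assume "linked f f'"
  then show "f \<rightarrow>\<^sup>*\<^bsub>with_proj \<Gamma>\<^esub> f'"
    unfolding reachable_def with_proj_simps \<Gamma>_simps
    by (rule rtrancl_consistent_rtrancl_on[OF _ assms]) (use arcs_in_\<Omega> in blast)
qed

lemma \<Gamma>_digraph: "fin_digraph (with_proj \<Gamma>)"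
proof unfold_locales
  show "finite (arcs (with_proj \<Gamma>))"
    unfolding with_proj_simps \<Gamma>_simps
    by (rule finite_subset[of _ "\<Omega> \<times> \<Omega>"]) (use arcs_in_\<Omega> finite_\<Omega> in auto)
qed (use arcs_in_\<Omega> finite_\<Omega> in \<open>auto simp: \<Gamma>_simps\<close>)

lemma mk_symmetric_\<Gamma>: "mk_symmetric (with_proj \<Gamma>) = \<Gamma>"
proof -
  have "(\<Union>a\<in>r. {(fst a, snd a), (snd a, fst a)}) = r \<union> r\<inverse>" for r :: "('b \<times> 'b) set"
    by force
  from this[of "flag_arcs \<Omega>"] have "(\<Union>a\<in>flag_arcs \<Omega>. {(fst a, snd a), (snd a, fst a)}) = flag_arcs \<Omega>"
    by (simp only: arcs_converse Un_absorb)
  then show ?thesis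
    unfolding mk_symmetric_def with_proj_simps \<Gamma>_simps by (simp add: flag_graph_def)
qed

lemma connected_\<Gamma>:
  assumes "q > 3"
  shows "Digraph_Component.connected (with_proj \<Gamma>)"
  unfolding connected_def mk_symmetric_\<Gamma> strongly_connected_def
proof (intro conjI ballI)
  show "verts (with_proj \<Gamma>) \<noteq> {}" using base_flag by (auto simp: \<Gamma>_simps)
  fix f f' assume "f \<in> verts (with_proj \<Gamma>)" "f' \<in> verts (with_proj \<Gamma>)"
  then have "f \<in> \<Omega>" "f' \<in> \<Omega>" by (simp_all add: \<Gamma>_simps)
  then show "f \<rightarrow>\<^sup>*\<^bsub>with_proj \<Gamma>\<^esub> f'"
    using linked_all[OF assms] reachable_iff_linked by blast
qed

lemma num_components_\<Gamma>:
  assumes q: "q = 3"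
  shows "num_components \<Gamma> = 3"
proof -
  interpret D: fin_digraph "with_proj \<Gamma>" by (rule \<Gamma>_digraph)
  define rep where "rep k = (Infinity :: 'a ree_point, centred_block 0 k)" for k
  have rep: "rep k \<in> \<Omega>" for k unfolding rep_def \<Omega>_at_Infinity by blast
  have scc: "D.scc_of f = {f' \<in> \<Omega>. linked f f'}" if f: "f \<in> \<Omega>" for f
  proof -
    have "f' \<in> \<Omega>" if "f \<rightarrow>\<^sup>*\<^bsub>with_proj \<Gamma>\<^esub> f'" for f'
      using D.reachable_in_verts(2)[OF that] by (simp add: \<Gamma>_simps)
    then show ?thesis
      using reachable_iff_linked f linked_sym unfolding D.scc_of_def by blast
  qed
  have "D.scc_of ` \<Omega> = (\<lambda>k. D.scc_of (rep k)) ` UNIV"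
  proof
    show "(\<lambda>k. D.scc_of (rep k)) ` UNIV \<subseteq> D.scc_of ` \<Omega>" using rep by blast
    show "D.scc_of ` \<Omega> \<subseteq> (\<lambda>k. D.scc_of (rep k)) ` UNIV"
    proof (rule image_subsetI)
      fix f assume f: "f \<in> \<Omega>"
      obtain k where k: "linked f (rep k)"
        unfolding rep_def by (rule linked_to_colour[OF q f])
      have "linked f f' \<longleftrightarrow> linked (rep k) f'" for f'
        using k linked_sym linked_trans by blast
      then have "D.scc_of f = D.scc_of (rep k)"
        unfolding scc[OF f] scc[OF rep] by blast
      then show "D.scc_of f \<in> (\<lambda>k. D.scc_of (rep k)) ` UNIV" by blast
    qed
  qed
  moreover have "inj (\<lambda>k. D.scc_of (rep k))"
  proof (rule injI)
    fix k l assume "D.scc_of (rep k) = D.scc_of (rep l)"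
    then have "linked (rep k) (rep l)" using scc rep by blast
    moreover have "flag_colour (rep k) k" unfolding rep_def flag_colour_Infinity by (simp add: \<phi>_def)
    ultimately have "flag_colour (rep l) k" by (rule linked_same_colour[OF q])
    then show "k = l" unfolding rep_def flag_colour_Infinity by (simp add: \<phi>_def)
  qed
  ultimately have "card (D.scc_of ` \<Omega>) = q"
    by (simp add: card_image card_field)
  then have "card D.sccs = q"
    using D.sccs_verts_conv_scc_of D.card_sccs_verts by (simp add: \<Gamma>_simps)
  then show ?thesis by (simp add: num_components_def q)
qed

end

section \<open>The main result\<close>

theorem lemma3p7:
  fixes e q :: nat
    and \<tau> :: "'a::{field,finite} \<Rightarrow> 'a"
    and P :: "'a ree_point set"
  assumes q: "q = 3 ^ (2 * e + 1)"
    and card_field: "card (UNIV :: 'a set) = q"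
    and aut: "field_automorphism \<tau>"
    and perm: "ree_componentwise e \<tau> \<in> carrier (BijGroup (ree_points e))"
    and normal: "carrier (ree_group e) \<lhd> ree_group_extension e \<tau>"
    and block: "imprimitive_block (point_stab (ree_group_extension e \<tau>) Infinity)
                  (ree_points e - {Infinity}) P"
    and zero_in: "ree_zero \<in> P"
    and orbit: "P - {ree_zero} \<in>
                  orbits (point_stab (point_stab (ree_group e) Infinity) ree_zero)
                    (ree_points e - {Infinity, ree_zero}) (\<lambda>g. g)"
    and orbit_length: "card (P - {ree_zero}) = q - 1"
  shows "let V = ree_points e;
             R = ree_group e;
             \<zeta> = ree_componentwise e \<tau>;
             G = ree_group_extension e \<tau>;
             L = P \<union> {Infinity};
             D = block_orbit_structure V R L;
             \<Omega> = Group_Action.orbit R flag_act (Infinity, L);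
             \<Xi> = flag_arcs \<Omega>;
             \<Gamma> = flag_graph \<Omega> \<Xi>
         in
           (P = {ree_pt e 0 0 \<eta> | \<eta>. True} \<and>
            carrier (set_stab (point_stab G Infinity) P) =
              generate (BijGroup V)
                ({ree_n e \<kappa> | \<kappa>. \<kappa> \<noteq> 0} \<union> {ree_t e 0 0 \<xi> | \<xi>. True} \<union> {\<zeta>})) \<and>
           (D = block_orbit_structure V G L \<and>
            t_design 2 (q ^ 3 + 1) (q + 1) (q + 1) D \<and>
            subgroup (carrier G) (automorphism_group D) \<and>
            two_transitive_on G V \<and>
            transitive_on G (`) (snd D) \<and>
            \<Omega> = Group_Action.orbit G flag_act (Infinity, L) \<and>
            one_feasible G D \<Omega> \<and>
            is_flag_graph_of G D \<Omega> \<Xi> \<Gamma> \<and>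
            is_flag_graph_of R D \<Omega> \<Xi> \<Gamma>) \<and>
           (card \<Omega> = q ^ 2 * (q ^ 3 + 1) \<and>
            has_valency \<Gamma> q \<and>
            (q > 3 \<longrightarrow> Digraph_Component.connected (with_proj \<Gamma>)) \<and>
            (q = 3 \<longrightarrow> num_components \<Gamma> = 3))"
proof -
  interpret ree_field e q "TYPE('a)"
    by unfold_locales (fact q card_field)+
  note ext = ree_group_extension_eq[OF aut perm normal]
  note G_sub = R_subset_G[OF aut perm normal] and FG = flag_preserving_G[OF aut perm normal]
  obtain p0 where p0: "p0 \<noteq> pt 0 0 0" "P - {ree_zero} = Group_Action.orbit
      (point_stab (point_stab (ree_group e) Infinity) ree_zero) (\<lambda>g. g) p0" "p0 \<in> ree_points e"
    using orbit by (auto simp: orbits_def ree_zero_eq)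
  have stab: "carrier (point_stab (point_stab (ree_group e) Infinity) ree_zero)
      = {g \<in> R. g Infinity = Infinity \<and> g (pt 0 0 0) = pt 0 0 0}"
    by (auto simp: point_stab_def stabilizer_def ree_zero_eq)
  have P_eq: "P - {pt 0 0 0} = {g p0 | g. g \<in> R \<and> g Infinity = Infinity \<and> g (pt 0 0 0) = pt 0 0 0}"
    using p0(2) unfolding Group_Action.orbit_def stab by (simp add: ree_zero_eq)
  have "p0 = ree_t e 0 0 0 p0" using p0(3) by simp
  moreover have "ree_t e 0 0 0 \<in> R \<and> ree_t e 0 0 0 Infinity = (Infinity :: 'a ree_point)
      \<and> ree_t e 0 0 0 (pt 0 0 0) = pt 0 0 0" by simp
  ultimately have p0P: "p0 \<in> P - {pt 0 0 0}" unfolding P_eq by blast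
  have P: "P = centre_orbit"
  proof (rule block_eq_centre_orbit)
    show "P \<subseteq> ree_points e - {Infinity}" "pt 0 0 0 \<in> P"
      using block zero_in by (auto simp: imprimitive_block_def ree_zero_eq)
    show "ree_t e a b c ` P = P \<or> ree_t e a b c ` P \<inter> P = {}" for a b c
    proof -
      have "ree_t e a b c \<in> carrier (point_stab (ree_group_extension e \<tau>) Infinity)"
        using G_sub t_in_R by (auto simp: point_stab_def stabilizer_def)
      then show ?thesis using block by (auto simp: imprimitive_block_def)
    qed
    show "p0 \<in> P" "p0 \<noteq> pt 0 0 0" using p0P by auto
    show "\<exists>\<kappa>. \<kappa> \<noteq> 0 \<and> p = ree_n e \<kappa> p0" if "p \<in> P" "p \<noteq> pt 0 0 0" for p
    proof -
      have "p \<in> P - {pt 0 0 0}" using that by simp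
      then obtain g where "g \<in> R" "g Infinity = Infinity" "g (pt 0 0 0) = pt 0 0 0" "p = g p0"
        unfolding P_eq by blast
      then show ?thesis using R_fixing_Infinity_zero by metis
    qed
    show "card (P - {pt 0 0 0}) = q - 1" using orbit_length by (simp add: ree_zero_eq)
  qed
  have L: "P \<union> {Infinity} = L0" by (simp add: P L0_eq)
  have L0: "L0 \<in> blocks" using base_flag by (rule image_eqI[rotated]) simp
  have DR: "block_orbit_structure V (ree_group e) L0 = \<D>"
    using orbit_block[OF flag_preserving_R L0]
    unfolding ree_group_eq[symmetric] block_orbit_structure_def by simp
  have DG: "block_orbit_structure V (ree_group_extension e \<tau>) L0 = \<D>"
    using orbit_block[OF FG L0] unfolding ext[symmetric] block_orbit_structure_def by simp
  show ?thesis
    unfolding Let_def L DR DG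
  proof (intro conjI impI)
    show "P = {ree_pt e 0 0 \<eta> |\<eta>. True}" by (simp add: P centre_orbit_def)
    show "carrier (set_stab (point_stab (ree_group_extension e \<tau>) Infinity) P) =
        generate (BijGroup V) ({ree_n e \<kappa> |\<kappa>. \<kappa> \<noteq> 0} \<union> {ree_t e 0 0 \<xi> |\<xi>. True} \<union> {ree_componentwise e \<tau>})"
      unfolding P by (rule stabilizer_of_centre_orbit[OF aut perm normal])
    show "t_design 2 (q ^ 3 + 1) (q + 1) (q + 1) \<D>" by (rule t_design_\<D>)
    show "subgroup (carrier (ree_group_extension e \<tau>)) (automorphism_group \<D>)"
      using subgroup_automorphism_group[OF FG] by simp
    show "two_transitive_on (ree_group_extension e \<tau>) V"
      using two_transitive[OF FG] unfolding ext[symmetric] .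
    show "transitive_on (ree_group_extension e \<tau>) (`) (snd \<D>)"
      using block_transitive[OF FG] unfolding ext[symmetric] .
    show "\<Omega> = Group_Action.orbit (ree_group_extension e \<tau>) flag_act (Infinity, L0)"
      using orbit_flag[OF FG base_flag] unfolding ext[symmetric] by simp
    show "one_feasible (ree_group_extension e \<tau>) \<D> \<Omega>"
      using one_feasible[OF FG] unfolding ext[symmetric] .
    show "is_flag_graph_of (ree_group_extension e \<tau>) \<D> \<Omega> (flag_arcs \<Omega>) \<Gamma>"
      using is_flag_graph[OF FG] unfolding ext[symmetric] .
    show "is_flag_graph_of (ree_group e) \<D> \<Omega> (flag_arcs \<Omega>) \<Gamma>"
      using is_flag_graph[OF flag_preserving_R] unfolding ree_group_eq[symmetric] .
  qed (use card_\<Omega> has_valency connected_\<Gamma> num_components_\<Gamma> in simp_all)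
qed

end
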